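(* Let $F=\{p_0,\ldots,p_n\}\subset\mathbb{R}$ contain at least two distinct points and consider the homogeneous IFS $S_i(x)=\lambda x+(1-\lambda)p_i$, $i=0,\ldots,n$. If $\lambda\in(2^{-1/2},1)$ and $\lambda^{-2}$ is not a Pisot number, then $\mathrm{int}(X)=X_{uni}$. In particular, if $\lambda\in(\theta^{-1/2},1)$ where $\theta=1.3247\ldots$ is the smallest Pisot number (the real root of $x^3-x-1$), then $\mathrm{int}(X)=X_{uni}$.
   Context: $\mathcal{D}=\{0,\ldots,n\}$. $X\subset\mathbb{R}$ is the unique non-empty compact set with $X=\bigcup_{i\in\mathcal{D}}S_i(X)$. The coding map is $\pi(\mathbf{a})=\lim_{j\to\infty}(S_{a_1}\circ\cdots\circ S_{a_j})(0)$. A sequence in $\mathcal{D}^{\mathbb{N}}$ is universal if it contains every finite word over $\mathcal{D}$ as a block of consecutive digits; $X_{uni}$ is the set of $x\in X$ with a universal $\mathbf{a}$ satisfying $\pi(\mathbf{a})=x$. A Pisot number is a real algebraic integer $>1$ all of whose Galois conjugates have modulus strictly less than $1$. *)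

theory Defs
  imports "HOL-Analysis.Analysis" "HOL-Computational_Algebra.Computational_Algebra"
begin

text \<open>Pisot number: a real algebraic integer > 1 all of whose Galois conjugates have
modulus < 1. The minimal polynomial of an algebraic integer is a monic irreducible
integer polynomial; the conjugates are its other complex roots.\<close>
definition pisot :: "real \<Rightarrow> bool" where
  "pisot x \<longleftrightarrow> x > 1 \<and>
     (\<exists>q :: int poly. lead_coeff q = 1 \<and> irreducible q \<and>
        poly (map_poly of_int q) (complex_of_real x) = 0 \<and>
        (\<forall>z. poly (map_poly of_int q) z = 0 \<and> z \<noteq> complex_of_real x \<longrightarrow> cmod z < 1))"

definition ifs_map :: "real \<Rightarrow> (nat \<Rightarrow> real) \<Rightarrow> nat \<Rightarrow> real \<Rightarrow> real" where
  "ifs_map lam p i x = lam * x + (1 - lam) * p i"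

fun ifs_comp :: "real \<Rightarrow> (nat \<Rightarrow> real) \<Rightarrow> (nat \<Rightarrow> nat) \<Rightarrow> nat \<Rightarrow> real \<Rightarrow> real" where
  "ifs_comp lam p a 0 = id"
| "ifs_comp lam p a (Suc j) = ifs_comp lam p a j \<circ> ifs_map lam p (a j)"

definition coding :: "real \<Rightarrow> (nat \<Rightarrow> real) \<Rightarrow> (nat \<Rightarrow> nat) \<Rightarrow> real" where
  "coding lam p a = lim (\<lambda>j. ifs_comp lam p a j 0)"

definition universal :: "nat \<Rightarrow> (nat \<Rightarrow> nat) \<Rightarrow> bool" where
  "universal n a \<longleftrightarrow>
     (\<forall>w :: nat list. set w \<subseteq> {..n} \<longrightarrow> (\<exists>k. \<forall>i < length w. a (k + i) = w ! i))"

definition X_uni :: "nat \<Rightarrow> real \<Rightarrow> (nat \<Rightarrow> real) \<Rightarrow> real set \<Rightarrow> real set" where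
  "X_uni n lam p X = {x \<in> X. \<exists>a. (\<forall>k. a k \<le> n) \<and> universal n a \<and> coding lam p a = x}"

text \<open>theta: the real root of x^3 - x - 1 (the smallest Pisot number).\<close>
definition theta :: real where
  "theta = (THE x. x ^ 3 - x - 1 = 0)"

end

theory Submission
  imports Defs "HOL-Complex_Analysis.Cauchy_Integral_Formula"
begin

text \<open>
  The attractor is the interval spanned by the extreme points of \<open>F\<close>, and the coding of an interior
  point \<open>x\<close> can be continued by an arbitrary word after a suitable prefix as soon as the backward
  orbit of \<open>x\<close> under the two extreme maps is dense. With \<open>q = 1 / \<lambda>\<close> this density holds if, for some
  \<open>m \<ge> 2\<close> with \<open>q\<^sup>m < 2\<close>, the values at \<open>q\<^sup>m\<close> of polynomials with coefficients in \<open>{-1, 0, 1}\<close>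
  accumulate at \<open>0\<close>: the exponents divisible by \<open>m\<close> provide a fine chain of digit sums, and the
  remaining exponents suffice for a coarse greedy approximation.

  Accumulation at \<open>0\<close> holds for every non-Pisot base, again called \<open>q\<close>, in \<open>(1, 2)\<close>. Otherwise the values are separated from
  \<open>0\<close>; a maximality argument (Feng) then shows that only finitely many of them lie in \<open>[-C, C]\<close>
  for \<open>C < 1 / (q - 1)\<close>, so \<open>q\<close> is an algebraic integer and \<open>P(p)\<close> stays bounded along with \<open>P(q)\<close>
  for each conjugate \<open>p\<close>. If \<open>p \<noteq> q\<close> and \<open>|p| \<ge> 1\<close>, one expands the least positive value in base \<open>q\<close>
  with digits whose signs are those of \<open>Re (\<omega> / p\<^sup>i) - c / q\<^sup>i\<close>; for suitable \<open>\<omega>\<close> and \<open>c\<close> this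
  makes a bounded functional increase too much.

  For the last part, if both \<open>q\<^sup>2\<close> and \<open>q\<^sup>3\<close> were Pisot numbers then so would be \<open>q < \<surd>\<theta>\<close>, which Siegel's
  Parseval argument for the power series \<open>R / R\<^sup>*\<close> excludes, where \<open>R\<close> is the minimal polynomial of \<open>q\<close>
  and \<open>R\<^sup>*\<close> its reciprocal polynomial.
\<close>

section \<open>Integer polynomials at complex points\<close>

text \<open>The target ring is arbitrary so that one integer polynomial can be read at the real
  base, at a complex conjugate and at an integer.\<close>

definition int_eval :: "int poly \<Rightarrow> 'a::comm_ring_1 \<Rightarrow> 'a" where
  "int_eval P z = poly (map_poly of_int P) z"

lemma int_eval_0 [simp]: "int_eval 0 z = 0"
  by (simp add: int_eval_def)

lemma int_eval_pCons [simp]: "int_eval (pCons a P) z = of_int a + z * int_eval P z"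
  by (simp add: int_eval_def map_poly_pCons)

lemma int_eval_1 [simp]: "int_eval 1 z = 1"
  by (simp add: one_pCons)

lemma int_eval_add [simp]: "int_eval (P + Q) z = int_eval P z + int_eval Q z"
  by (induction P Q rule: poly_induct2) (simp_all add: algebra_simps)

lemma int_eval_minus [simp]: "int_eval (- P) z = - int_eval P z"
  by (induction P) simp_all

lemma int_eval_diff [simp]: "int_eval (P - Q) z = int_eval P z - int_eval Q z"
  using int_eval_add[of P "- Q" z] by simp

lemma int_eval_smult [simp]: "int_eval (smult c P) z = of_int c * int_eval P z"
  by (induction P) (simp_all add: algebra_simps)

lemma int_eval_mult [simp]: "int_eval (P * Q) z = int_eval P z * int_eval Q z"
  by (induction P) (simp_all add: algebra_simps)

lemma int_eval_monom [simp]: "int_eval (monom c n) z = of_int c * z ^ n"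
  by (induction n) (simp_all add: monom_Suc monom_0 algebra_simps)

lemma int_eval_of_real: "int_eval P (of_real x) = of_real (int_eval P x)"
  for x :: real
  by (induction P) simp_all

lemma int_eval_prod_mset_eq_0:
  fixes z :: "'a::{idom}"
  shows "int_eval (\<Prod>\<^sub># M) z = 0 \<longleftrightarrow> (\<exists>P\<in>#M. int_eval P z = 0)"
  by (induction M) auto

text \<open>Let \<open>T\<close> have least degree among the nonzero integer polynomials vanishing
  at \<open>z\<close>. It divides a nonzero integer multiple of each of them. As \<open>R\<close> is
  prime in the factorial ring of integer polynomials, it divides \<open>T\<close>, hence a multiple
  \<open>smult c P\<close>, hence \<open>P\<close>.\<close>

lemma irreducible_dvd_of_common_root:
  fixes R P :: "int poly" and z :: complex
  assumes R: "irreducible R" and Rz: "int_eval R z = 0" and Pz: "int_eval P z = 0"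
  shows "R dvd P"
proof -
  have prime: "prime_elem R"
    using R by (rule irreducible_imp_prime_elem_gcd)
  define S where "S = {T :: int poly. T \<noteq> 0 \<and> int_eval T z = 0}"
  have "R \<in> S" using R Rz by (auto simp: S_def)
  then obtain T where T: "T \<in> S" "\<And>U. U \<in> S \<Longrightarrow> degree T \<le> degree U"
    using ex_has_least_nat[of "\<lambda>T. T \<in> S" R degree] by blast
  have T0: "T \<noteq> 0" and Tz: "int_eval T z = 0" using T(1) by (auto simp: S_def)
  \<comment> \<open>Pseudo-division keeps the coefficients integral; its remainder vanishes at
    \<open>z\<close> and is 0 by the minimality of \<open>T\<close>.\<close>
  have key: "\<exists>c Q. c \<noteq> 0 \<and> smult c U = T * Q" if U: "int_eval U z = 0" for U
  proof -
    obtain Q V where QV: "pseudo_divmod U T = (Q, V)" by fastforce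
    note pd = pseudo_divmod[OF T0 QV]
    have "int_eval V z = 0"
      using arg_cong[OF pd(1), of "\<lambda>W. int_eval W z"] Tz U by simp
    hence "V = 0" using pd(2) T(2)[of V] by (fastforce simp: S_def)
    with pd(1) T0 show ?thesis
      by (intro exI[of _ "lead_coeff T ^ (Suc (degree U) - degree T)"] exI[of _ Q]) auto
  qed
  have degT: "degree T > 0"
  proof (rule ccontr)
    assume "\<not> degree T > 0"
    then obtain a where "T = [:a:]" using degree_eq_zeroE by auto
    with T0 Tz show False by auto
  qed
  have "R dvd T"
  proof -
    from key[OF Rz] obtain c Q where cQ: "c \<noteq> 0" "smult c R = T * Q" by blast
    have "R dvd T * Q" using cQ(2) by (metis dvd_smult dvd_refl)
    hence "R dvd T \<or> R dvd Q" using prime prime_elem_dvd_mult_iff by blast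
    moreover have "\<not> R dvd Q"
    proof
      assume "R dvd Q"
      moreover have "Q \<noteq> 0" using cQ R by auto
      ultimately have "degree R \<le> degree Q" by (rule dvd_imp_degree_le)
      moreover have "degree R = degree T + degree Q"
        using cQ T0 \<open>Q \<noteq> 0\<close> by (metis degree_mult_eq degree_smult_eq)
      ultimately show False using degT by simp
    qed
    ultimately show ?thesis by blast
  qed
  moreover from key[OF Pz] obtain c Q where cQ: "c \<noteq> 0" "smult c P = T * Q" by blast
  ultimately have "R dvd smult c P" by simp
  hence "R dvd [:c:] * P" by simp
  hence "R dvd [:c:] \<or> R dvd P" using prime prime_elem_dvd_mult_iff by blast
  moreover have "\<not> R dvd [:c:]"
  proof
    assume "R dvd [:c:]"
    hence "degree R \<le> degree [:c:]" using cQ(1) by (intro dvd_imp_degree_le) auto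
    hence "degree R = 0" by simp
    then obtain a where "R = [:a:]" using degree_eq_zeroE by auto
    with Rz R show False by auto
  qed
  ultimately show ?thesis by blast
qed

text \<open>Stands in for the field isomorphism taking \<open>z\<close> to \<open>w\<close>: integer
  relations pass from the base \<open>q\<close> to its conjugates and back.\<close>

corollary common_root_transfer:
  fixes R P :: "int poly" and z w :: complex
  assumes "irreducible R" "int_eval R z = 0" "int_eval P z = 0" "int_eval R w = 0"
  shows "int_eval P w = 0"
proof -
  obtain Q where "P = R * Q" using irreducible_dvd_of_common_root[OF assms(1-3)] by (auto simp: dvd_def)
  thus ?thesis using assms(4) by simp
qed

text \<open>Some prime factor of \<open>P\<close> vanishes at \<open>z\<close>. Its leading
  coefficient divides 1, and a change of sign repairs the value -1.\<close>

lemma monic_irreducible_factor: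
  fixes P :: "int poly" and z :: complex
  assumes "lead_coeff P = 1" "int_eval P z = 0"
  obtains R where "lead_coeff R = 1" "irreducible R" "int_eval R z = 0" "R dvd P"
proof -
  have P0: "P \<noteq> 0" using assms(1) by auto
  have "P dvd \<Prod>\<^sub># (prime_factorization P)"
    using prod_mset_prime_factorization_weak[OF P0] by (metis associated_iff_dvd)
  hence "int_eval (\<Prod>\<^sub># (prime_factorization P)) z = 0"
    using assms(2) by (auto simp: dvd_def)
  then obtain R where R: "R \<in># prime_factorization P" "int_eval R z = 0"
    using int_eval_prod_mset_eq_0 by blast
  have "prime_elem R" "R dvd P" using R(1) by (auto simp: in_prime_factors_iff prime_def)
  hence irr: "irreducible R" "R dvd P" by (auto intro: prime_elem_imp_irreducible)
  then obtain Q where Q: "P = R * Q" by (auto simp: dvd_def)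
  hence "lead_coeff R * lead_coeff Q = 1" using assms(1) by (simp add: lead_coeff_mult)
  hence "lead_coeff R = 1 \<or> lead_coeff R = -1" by (metis zmult_eq_1_iff)
  thus ?thesis
  proof
    assume "lead_coeff R = 1" thus ?thesis using that irr R(2) by blast
  next
    assume l: "lead_coeff R = -1"
    have "irreducible (- R)"
      using irr(1) irreducible_mult_unit_left[of "-1" R] by simp
    thus ?thesis using that[of "-R"] l irr(2) R(2) by simp
  qed
qed

section \<open>Bases whose sign polynomial values are separated from zero\<close>

definition sign_polys :: "int poly set" where
  "sign_polys = {P. \<forall>i. coeff P i \<in> {-1, 0, 1}}"

definition bit_polys :: "int poly set" where
  "bit_polys = {P. \<forall>i. coeff P i \<in> {0, 1}}"

lemma zero_in_bit_polys [simp]: "0 \<in> bit_polys"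
  by (simp add: bit_polys_def)

lemma one_in_sign_polys [simp]: "1 \<in> sign_polys"
  by (auto simp: sign_polys_def coeff_1)

lemma pCons_in_sign_polys:
  "P \<in> sign_polys \<Longrightarrow> s \<in> {-1, 0, 1} \<Longrightarrow> pCons s P \<in> sign_polys"
  by (auto simp: sign_polys_def coeff_pCons split: nat.splits)

lemma uminus_in_sign_polys: "P \<in> sign_polys \<Longrightarrow> - P \<in> sign_polys"
proof -
  assume "P \<in> sign_polys"
  hence "\<And>i. coeff P i = -1 \<or> coeff P i = 0 \<or> coeff P i = 1" by (auto simp: sign_polys_def)
  hence "\<And>i. coeff (- P) i \<in> {-1, 0, 1}" by (metis coeff_minus insert_iff minus_minus minus_zero)
  thus ?thesis by (simp add: sign_polys_def)
qed

lemma bit_polys_diff_in_sign_polys: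
  assumes "A \<in> bit_polys" "B \<in> bit_polys"
  shows "A - B \<in> sign_polys"
proof -
  have "coeff (A - B) i \<in> {-1, 0, 1}" for i
  proof -
    have "coeff A i \<in> {0, 1}" "coeff B i \<in> {0, 1}" using assms unfolding bit_polys_def by blast+
    thus ?thesis by auto
  qed
  thus ?thesis by (simp add: sign_polys_def)
qed

lemma sign_poly_eq_bit_polys_diff:
  assumes "P \<in> sign_polys"
  obtains A B where "A \<in> bit_polys" "B \<in> bit_polys" "P = A - B"
proof -
  define A where "A = map_poly (\<lambda>c. if c = 1 then 1 else 0 :: int) P"
  define B where "B = map_poly (\<lambda>c. if c = - 1 then 1 else 0 :: int) P"
  have "coeff P i = coeff (A - B) i" for i
  proof -
    have "coeff P i \<in> {-1, 0, 1}" using assms by (auto simp: sign_polys_def)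
    thus ?thesis by (auto simp: A_def B_def coeff_map_poly)
  qed
  hence "P = A - B" by (intro poly_eqI)
  moreover have "A \<in> bit_polys" "B \<in> bit_polys"
    by (auto simp: A_def B_def bit_polys_def coeff_map_poly)
  ultimately show ?thesis using that by blast
qed

text \<open>Digit strings are joined without carries: \<open>B\<close> fills the places below
  \<open>k\<close>, \<open>A\<close> the places from \<open>k\<close> on.\<close>

lemma bit_poly_concat:
  assumes "A \<in> bit_polys" "B \<in> bit_polys" "\<And>i. i \<ge> k \<Longrightarrow> coeff B i = 0"
  shows "monom 1 k * A + B \<in> bit_polys"
proof -
  have "coeff (monom 1 k * A + B) i \<in> {0, 1}" for i
  proof (cases "i < k")
    case True
    hence "coeff (monom 1 k * A + B) i = coeff B i" by (simp add: coeff_monom_mult)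
    thus ?thesis using assms(2) by (auto simp: bit_polys_def)
  next
    case False
    hence "coeff (monom 1 k * A + B) i = coeff A (i - k)" using assms(3) by (simp add: coeff_monom_mult)
    thus ?thesis using assms(1) by (auto simp: bit_polys_def)
  qed
  thus ?thesis by (simp add: bit_polys_def)
qed

text \<open>Greedy choice of the leading digit. With \<open>M\<close> the sum of the lower powers,
  the two choices serve \<open>[0, M]\<close> and \<open>[q^k, q^k + M]\<close>; since
  \<open>q < 2\<close>, a gap between them has length at most 1.\<close>

lemma bit_poly_values_dense:
  fixes q :: real
  assumes q: "1 < q" "q < 2" and z: "0 \<le> z" "z \<le> (q ^ k - 1) / (q - 1)"
  obtains P where "P \<in> bit_polys" "\<And>i. i \<ge> k \<Longrightarrow> coeff P i = 0" "\<bar>int_eval P q - z\<bar> \<le> 1"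
proof -
  have "\<exists>P\<in>bit_polys. (\<forall>i\<ge>k. coeff P i = 0) \<and> \<bar>int_eval P q - z\<bar> \<le> 1"
    using z
  proof (induction k arbitrary: z)
    case 0
    thus ?case by (intro bexI[of _ 0]) auto
  next
    case (Suc k)
    define M where "M = (q ^ k - 1) / (q - 1)"
    have M: "(q - 1) * M = q ^ k - 1" using q by (simp add: M_def)
    have M0: "M \<ge> 0" using q by (simp add: M_def)
    have M1: "q ^ k \<le> M + 1" using M M0 q mult_right_mono[of "q - 1" 1 M] by linarith
    have MS: "(q ^ Suc k - 1) / (q - 1) = M + q ^ k"
      using q by (simp add: M_def field_simps)
    consider "z \<le> M" | "z > M" "z \<ge> q ^ k" | "z > M" "z < q ^ k" by linarith
    thus ?case
    proof cases
      case 1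
      then obtain P where "P \<in> bit_polys" "\<forall>i\<ge>k. coeff P i = 0" "\<bar>int_eval P q - z\<bar> \<le> 1"
        using Suc.IH[of z] Suc.prems by (auto simp: M_def)
      thus ?thesis by (intro bexI[of _ P]) auto
    next
      case 2
      have "z - q ^ k \<le> M" using Suc.prems MS by simp
      then obtain P where P: "P \<in> bit_polys" "\<forall>i\<ge>k. coeff P i = 0" "\<bar>int_eval P q - (z - q ^ k)\<bar> \<le> 1"
        using Suc.IH[of "z - q ^ k"] 2 by (auto simp: M_def)
      have "monom 1 k * 1 + P \<in> bit_polys"
        using P by (intro bit_poly_concat) (auto simp: bit_polys_def coeff_1)
      moreover have "\<forall>i\<ge>Suc k. coeff (monom 1 k * 1 + P) i = 0" using P(2) by auto
      moreover have "\<bar>int_eval (monom 1 k * 1 + P) q - z\<bar> \<le> 1" using P(3) by simp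
      ultimately show ?thesis by blast
    next
      case 3
      \<comment> \<open>In the gap, \<open>q^k\<close> itself is within 1 of
        \<open>z\<close>.\<close>
      have "monom 1 k \<in> bit_polys" by (auto simp: bit_polys_def)
      thus ?thesis using 3 M1 by (intro bexI[of _ "monom 1 k"]) auto
    qed
  qed
  thus ?thesis using that by blast
qed

section \<open>Finiteness of the bounded sign polynomial values at a separated base\<close>

locale separated_base =
  fixes q \<delta> :: real
  assumes q_gt_1: "1 < q" and q_lt_2: "q < 2" and delta_pos: "0 < \<delta>"
    and separated: "\<And>P. P \<in> sign_polys \<Longrightarrow> int_eval P q = 0 \<or> \<delta> \<le> \<bar>int_eval P q\<bar>"
begin

definition bit_values :: "real set" where
  "bit_values = (\<lambda>P. int_eval P q) ` bit_polys"

text \<open>The radius 1 matches the accuracy of \<open>bit_poly_values_dense\<close>.\<close>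

definition window :: "real \<Rightarrow> real set" where
  "window y = {v \<in> bit_values. \<bar>v - y\<bar> \<le> 1}"

text \<open>Distinct elements of \<open>bit_values\<close> differ by at least \<delta>, so rounding
  \<open>v / \<delta>\<close> down is injective on a window. The bound is uniform in
  \<open>y\<close>, which permits the choice of a window of maximal cardinality.\<close>

lemma window_card:
  shows "finite (window y)" "card (window y) < nat \<lceil>2 / \<delta>\<rceil> + 4"
proof -
  let ?f = "\<lambda>v. \<lfloor>v / \<delta>\<rfloor>"
  have inj: "inj_on ?f (window y)"
  proof (rule inj_onI)
    fix v w assume vw: "v \<in> window y" "w \<in> window y" "?f v = ?f w"
    then obtain A B where AB: "A \<in> bit_polys" "B \<in> bit_polys" "v = int_eval A q" "w = int_eval B q"
      by (auto simp: window_def bit_values_def)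
    have "\<bar>v / \<delta> - w / \<delta>\<bar> < 1" using vw(3) by linarith
    hence "\<bar>v - w\<bar> < \<delta>" using delta_pos by (simp add: diff_divide_distrib[symmetric] field_simps)
    hence "int_eval (A - B) q = 0"
      using separated[OF bit_polys_diff_in_sign_polys[OF AB(1,2)]] AB(3,4) by auto
    thus "v = w" using AB by simp
  qed
  let ?I = "{\<lfloor>(y - 1) / \<delta>\<rfloor>..\<lfloor>(y + 1) / \<delta>\<rfloor>}"
  have sub: "?f ` window y \<subseteq> ?I"
    using delta_pos by (auto simp: window_def intro!: floor_mono divide_right_mono)
  show "finite (window y)"
    using finite_subset[OF sub] finite_image_iff[OF inj] by simp
  have "card (window y) \<le> card ?I"
    using card_mono[OF _ sub] card_image[OF inj] by simp
  also have "\<dots> = nat (\<lfloor>(y + 1) / \<delta>\<rfloor> - \<lfloor>(y - 1) / \<delta>\<rfloor> + 1)" by simp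
  also have "\<dots> < nat \<lceil>2 / \<delta>\<rceil> + 4"
  proof -
    have "(y + 1) / \<delta> = (y - 1) / \<delta> + 2 / \<delta>" by (simp add: add_divide_distrib[symmetric])
    hence "\<lfloor>(y + 1) / \<delta>\<rfloor> - \<lfloor>(y - 1) / \<delta>\<rfloor> + 1 \<le> \<lceil>2 / \<delta>\<rceil> + 3" by linarith
    thus ?thesis by linarith
  qed
  finally show "card (window y) < nat \<lceil>2 / \<delta>\<rceil> + 4" .
qed

lemma bit_values_shift:
  assumes "x \<in> bit_values" "c = int_eval B q" "B \<in> bit_polys" "\<And>i. i \<ge> k \<Longrightarrow> coeff B i = 0"
  shows "q ^ k * x + c \<in> bit_values"
proof -
  obtain A where "A \<in> bit_polys" "x = int_eval A q" using assms(1) by (auto simp: bit_values_def)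
  thus ?thesis using assms(2-) bit_poly_concat[of A B k]
    by (auto simp: bit_values_def intro!: image_eqI[of _ _ "monom 1 k * A + B"])
qed

text \<open>Around a window of maximal cardinality no further points can appear after rescaling, so
  every difference of two nearby points of \<open>bit_values\<close> is already visible at a fixed level.\<close>

lemma finite_sign_values_nonpos:
  assumes C: "C < 1 / (q - 1)"
  shows "finite {r. (\<exists>P\<in>sign_polys. r = int_eval P q) \<and> - C \<le> r \<and> r \<le> 0}"
proof -
  have "\<exists>y. True \<and> (\<forall>y'. True \<longrightarrow> card (window y') \<le> card (window y))"
    using window_card(2) by (intro Lattices_Big.ex_has_greatest_nat[where b = "nat \<lceil>2 / \<delta>\<rceil> + 4"]) auto
  then obtain y where y: "\<And>y'. card (window y') \<le> card (window y)" by blast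
  have "0 \<in> bit_values" by (force simp: bit_values_def intro!: image_eqI[of _ _ 0])
  hence "0 \<in> window 0" by (simp add: window_def)
  hence "card (window 0) > 0" using window_card(1) card_gt_0_iff by blast
  hence "card (window y) > 0" using y[of 0] by simp
  hence "window y \<noteq> {}" by auto
  then obtain v0 where v0: "v0 \<in> window y" by blast
  have nonneg: "v \<ge> 0" if "v \<in> bit_values" for v
  proof -
    have "int_eval P q \<ge> 0" if "P \<in> bit_polys" for P :: "int poly"
      using that
    proof (induction P)
      case (pCons a P)
      have c: "coeff (pCons a P) i \<in> {0, 1}" for i using pCons.prems unfolding bit_polys_def by blast
      have "a \<in> {0, 1}" using c[of 0] by simp
      moreover have "P \<in> bit_polys" using c[of "Suc _"] by (simp add: bit_polys_def)
      ultimately show ?case using pCons.IH q_gt_1 by auto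
    qed simp
    thus ?thesis using that by (auto simp: bit_values_def)
  qed
  have y1: "y \<ge> -1" using v0 nonneg[of v0] by (auto simp: window_def)
  have "\<forall>v\<in>window y. \<exists>P\<in>bit_polys. v = int_eval P q" by (auto simp: window_def bit_values_def)
  then obtain p where p: "\<And>v. v \<in> window y \<Longrightarrow> p v \<in> bit_polys \<and> v = int_eval (p v) q" by metis
  \<comment> \<open>Beyond \<open>k0\<close> all chosen representatives of the window points have no
    digits, so a further polynomial can be placed above them.\<close>
  define k0 where "k0 = Suc (Max ((\<lambda>v. degree (p v)) ` window y))"
  have k0: "coeff (p v) i = 0" if "v \<in> window y" "i \<ge> k0" for v i
  proof -
    have "degree (p v) \<le> Max ((\<lambda>v. degree (p v)) ` window y)"
      using that(1) window_card(1) by (intro Max_ge) auto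
    thus ?thesis using that(2) by (intro coeff_eq_0) (auto simp: k0_def)
  qed
  \<comment> \<open>Since \<open>C < 1 / (q - 1)\<close>, a large \<open>k\<close> puts
    \<open>y - q^k * r\<close> within the range of digit sums with places below \<open>k\<close>,
    for every \<open>r \<ge> - C\<close>.\<close>
  obtain k1 where "(y + 1 / (q - 1)) / (1 / (q - 1) - C) < q ^ k1"
    using real_arch_pow[OF q_gt_1] by blast
  hence k1: "(y + 1 / (q - 1)) / (1 / (q - 1) - C) \<le> q ^ k" if "k \<ge> k1" for k
    using power_increasing[OF that, of q] q_gt_1 by linarith
  define k where "k = max k0 k1"
  have k: "y + q ^ k * C \<le> (q ^ k - 1) / (q - 1)"
    using k1[of k] C by (simp add: k_def pos_divide_le_eq diff_divide_distrib algebra_simps)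
  \<comment> \<open>The finitely many low-order blocks \<open>c\<close> that can occur for any
    \<open>r\<close>; with the window they give finitely many candidates for
    \<open>r\<close>.\<close>
  define V where "V = {c. \<exists>B\<in>bit_polys. (\<forall>i\<ge>k. coeff B i = 0) \<and> c = int_eval B q \<and> c \<le> (q ^ k - 1) / (q - 1) + 1}"
  have finV: "finite V"
  proof -
    define n where "n = nat \<lceil>(q ^ k - 1) / (q - 1) + 1\<rceil>"
    have "V \<subseteq> (\<Union>j\<le>n. window (real j))"
    proof
      fix c assume c: "c \<in> V"
      hence cb: "c \<in> bit_values" by (auto simp: V_def bit_values_def)
      hence c0: "c \<ge> 0" by (rule nonneg)
      have "c \<le> (q ^ k - 1) / (q - 1) + 1" using c by (auto simp: V_def)
      hence "nat \<lfloor>c\<rfloor> \<le> n" unfolding n_def using c0 by linarith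
      moreover have "\<bar>c - real (nat \<lfloor>c\<rfloor>)\<bar> \<le> 1" using c0 by linarith
      ultimately show "c \<in> (\<Union>j\<le>n. window (real j))" using cb by (auto simp: window_def)
    qed
    thus ?thesis using window_card(1) by (meson finite_UN_I finite_atMost finite_subset)
  qed
  have "{r. (\<exists>P\<in>sign_polys. r = int_eval P q) \<and> - C \<le> r \<and> r \<le> 0}
      \<subseteq> (\<lambda>(v, c). (v - c) / q ^ k) ` (window y \<times> V)"
  proof
    fix r assume "r \<in> {r. (\<exists>P\<in>sign_polys. r = int_eval P q) \<and> - C \<le> r \<and> r \<le> 0}"
    then obtain P where P: "P \<in> sign_polys" "r = int_eval P q" and r: "- C \<le> r" "r \<le> 0" by blast
    obtain A B where AB: "A \<in> bit_polys" "B \<in> bit_polys" "P = A - B"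
      using sign_poly_eq_bit_polys_diff[OF P(1)] .
    define x' x where "x' = int_eval A q" and "x = int_eval B q"
    have rx: "r = x' - x" using P AB by (simp add: x_def x'_def)
    have xb: "x \<in> bit_values" "x' \<in> bit_values" using AB by (auto simp: bit_values_def x_def x'_def)
    \<comment> \<open>A block \<open>c\<close> within 1 of \<open>z\<close> moves
      \<open>q^k * x'\<close> into the window around \<open>q^k * x + y\<close>.\<close>
    define z where "z = y - q ^ k * r"
    have qk: "q ^ k > 0" using q_gt_1 by simp
    have "q ^ k * r \<le> 0" "q ^ k * (- C) \<le> q ^ k * r" using r qk mult_left_mono[OF r(1), of "q ^ k"] by (auto simp: mult_nonneg_nonpos)
    hence z: "y \<le> z" "z \<le> (q ^ k - 1) / (q - 1)" using k by (auto simp: z_def)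
    obtain D where D: "D \<in> bit_polys" "\<And>i. i \<ge> k \<Longrightarrow> coeff D i = 0" "\<bar>int_eval D q - z\<bar> \<le> 1"
    proof (cases "z \<ge> 0")
      case True
      show ?thesis using bit_poly_values_dense[OF q_gt_1 q_lt_2 True z(2)] that by blast
    next
      case False
      \<comment> \<open>For negative \<open>z\<close> the empty block suffices, because
        \<open>z \<ge> y \<ge> -1\<close>.\<close>
      show ?thesis using that[of 0] False z y1 by auto
    qed
    define c where "c = int_eval D q"
    have shifted: "(\<lambda>v. q ^ k * x + v) ` window y \<subseteq> window (q ^ k * x + y)"
    proof
      fix w assume "w \<in> (\<lambda>v. q ^ k * x + v) ` window y"
      then obtain v where v: "v \<in> window y" "w = q ^ k * x + v" by blast
      have "w \<in> bit_values"
        unfolding v(2) using p[OF v(1)] k0[OF v(1)]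
        by (intro bit_values_shift[OF xb(1), of v "p v"]) (auto simp: k_def)
      thus "w \<in> window (q ^ k * x + y)" using v by (auto simp: window_def)
    qed
    have "card ((\<lambda>v. q ^ k * x + v) ` window y) = card (window y)"
      by (intro card_image) (auto simp: inj_on_def)
    \<comment> \<open>By maximality the translated window is the whole window at its new place, so
      the point built from \<open>x'\<close> comes from some \<open>v\<close>.\<close>
    hence "(\<lambda>v. q ^ k * x + v) ` window y = window (q ^ k * x + y)"
      using y[of "q ^ k * x + y"] shifted window_card(1) card_seteq by metis
    moreover have "q ^ k * x' + c \<in> window (q ^ k * x + y)"
    proof -
      have "q ^ k * x' + c \<in> bit_values"
        using D by (intro bit_values_shift[OF xb(2), of c D]) (auto simp: c_def)
      moreover have "q ^ k * x' + c - (q ^ k * x + y) = c - z"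
        by (simp add: z_def rx algebra_simps)
      ultimately show ?thesis using D(3) by (simp add: window_def c_def)
    qed
    ultimately obtain v where v: "v \<in> window y" "q ^ k * x' + c = q ^ k * x + v" by (auto simp: image_iff)
    have "r * q ^ k = v - c" using v(2) by (simp add: rx algebra_simps)
    hence "r = (v - c) / q ^ k" using qk q_gt_1 by (simp add: eq_divide_eq)
    moreover have "c \<in> V"
    proof -
      have "c \<le> (q ^ k - 1) / (q - 1) + 1" using D(3) z(2) by (simp add: c_def abs_le_iff)
      thus ?thesis using D(1,2) by (auto simp: V_def c_def)
    qed
    ultimately show "r \<in> (\<lambda>(v, c). (v - c) / q ^ k) ` (window y \<times> V)" using v(1) by force
  qed
  thus ?thesis by (rule finite_subset) (use finV window_card(1) in simp)
qed

lemma finite_sign_values: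
  assumes C: "C < 1 / (q - 1)"
  shows "finite {r. (\<exists>P\<in>sign_polys. r = int_eval P q) \<and> \<bar>r\<bar> \<le> C}" (is "finite ?S")
proof -
  let ?N = "{r. (\<exists>P\<in>sign_polys. r = int_eval P q) \<and> - C \<le> r \<and> r \<le> 0}"
  have "?S \<subseteq> ?N \<union> uminus ` ?N"
  proof
    fix r assume r: "r \<in> ?S"
    show "r \<in> ?N \<union> uminus ` ?N"
    proof (cases "r \<le> 0")
      case True thus ?thesis using r by auto
    next
      case False
      from r obtain P where "P \<in> sign_polys" "r = int_eval P q" by blast
      hence "\<exists>P\<in>sign_polys. - r = int_eval P q"
        using uminus_in_sign_polys by (intro bexI[of _ "- P"]) auto
      hence "- r \<in> ?N" using r False by auto
      thus ?thesis by (intro UnI2 image_eqI[of _ _ "- r"]) simp_all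
    qed
  qed
  thus ?thesis by (rule finite_subset) (use finite_sign_values_nonpos[OF C] in simp)
qed

end

section \<open>Conjugates of multinacci numbers\<close>

lemma int_eval_sum [simp]: "int_eval (\<Sum>i\<in>A. f i) z = (\<Sum>i\<in>A. int_eval (f i) z)"
  by (induction A rule: infinite_finite_induct) simp_all

lemma norm_add_one_eqD:
  fixes z :: complex
  assumes "norm (z + 1) = norm z + 1"
  shows "z = of_real (norm z)"
proof -
  have "(norm (z + 1))\<^sup>2 = (norm z)\<^sup>2 + 2 * Re z + 1"
    unfolding cmod_power2 by (simp add: power2_eq_square algebra_simps)
  moreover have "(norm (z + 1))\<^sup>2 = (norm z)\<^sup>2 + 2 * norm z + 1"
    unfolding assms by (simp add: power2_eq_square algebra_simps)
  ultimately have "Re z = norm z" by simp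
  moreover from this have "Im z = 0" using cmod_power2[of z] by simp
  ultimately show ?thesis by (simp add: complex_eq_iff)
qed

text \<open>The exceptional case of \<open>least_positive_value_cases\<close>. The hypothesis says
  that \<open>q^n\<close> is the sum of all lower powers. Both forms of this relation pass to
  \<open>p\<close>; their norms force equality in the triangle inequality, so \<open>p\<close> is a
  positive real, and the relation has only one root above 1.\<close>

lemma multinacci_conjugate:
  fixes q :: real and p :: complex
  assumes q: "1 < q" "q < 2" and n: "q ^ n * (2 - q) = 1"
    and R: "irreducible R" "int_eval R (complex_of_real q) = 0" "int_eval R p = 0"
    and p: "1 \<le> norm p"
  shows "p = of_real q"
proof -
  let ?a = "norm p"
  have transfer: "int_eval P p = 0" if "int_eval P q = 0" for P
    using common_root_transfer[OF R(1,2) _ R(3)] that by (simp add: int_eval_of_real)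
  have n0: "n > 0" using n q by (cases n) auto
  have geo: "x ^ n = (\<Sum>i<n. x ^ i)" if x: "x ^ n * (2 - x) = 1" "x > 1" for x :: real
  proof -
    have "(x - 1) * (\<Sum>i<n. x ^ i) = x ^ n - 1" by (metis power_diff_1_eq)
    also have "\<dots> = (x - 1) * x ^ n" using x(1) by (simp add: algebra_simps)
    finally show ?thesis using x(2) by simp
  qed
  have 1: "2 * p ^ n = p ^ Suc n + 1"
    using transfer[of "monom 2 n - monom 1 (Suc n) - 1"] n by (simp add: algebra_simps)
  have 2: "p ^ n = (\<Sum>i<n. p ^ i)"
    using transfer[of "monom 1 n - (\<Sum>i<n. monom 1 i)"] geo[OF n q(1)] by simp
  have "2 * ?a ^ n = norm (p ^ Suc n + 1)"
    using arg_cong[OF 1, of norm] by (simp add: norm_mult norm_power)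
  moreover have "norm (p ^ Suc n + 1) \<le> ?a ^ Suc n + 1"
    by (metis norm_triangle_ineq norm_power norm_one)
  moreover have "?a ^ Suc n + 1 \<le> 2 * ?a ^ n"
  proof -
    have "?a ^ n \<le> (\<Sum>i<n. ?a ^ i)"
      using arg_cong[OF 2, of norm] norm_sum[of "\<lambda>i. p ^ i" "{..<n}"] by (simp add: norm_power)
    hence "(?a - 1) * ?a ^ n \<le> (?a - 1) * (\<Sum>i<n. ?a ^ i)"
      using p by (intro mult_left_mono) auto
    also have "\<dots> = ?a ^ n - 1" by (metis power_diff_1_eq)
    finally show ?thesis by (simp add: algebra_simps)
  qed
  ultimately have eq: "2 * ?a ^ n = ?a ^ Suc n + 1" "norm (p ^ Suc n + 1) = ?a ^ Suc n + 1" by linarith+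
  have pS: "p ^ Suc n = of_real (?a ^ Suc n)"
    using norm_add_one_eqD[of "p ^ Suc n"] eq(2) by (simp add: norm_mult norm_power)
  have "2 * p ^ n = of_real (2 * ?a ^ n)" unfolding 1 pS eq(1) by simp
  hence pn: "p ^ n = of_real (?a ^ n)" by simp
  have "p ^ n * p = p ^ n * of_real ?a" using pS by (metis pn of_real_mult power_Suc2)
  hence pa: "p = of_real ?a" using p by auto
  \<comment> \<open>If 1 were a conjugate of \<open>q\<close>, then \<open>q\<close> would be a root
    of \<open>x - 1\<close>.\<close>
  have "?a \<noteq> 1"
  proof
    assume "?a = 1"
    hence "int_eval R (1::complex) = 0" using pa R(3) by simp
    hence "int_eval [:-1, 1:] (complex_of_real q) = 0"
      using common_root_transfer[OF R(1), of 1 "[:-1, 1:]" "of_real q"] R(2) by simp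
    thus False using q by simp
  qed
  hence a1: "?a > 1" using p by simp
  have "?a ^ n * (2 - ?a) = 1" using eq(1) by (simp add: algebra_simps)
  note ga = geo[OF this a1] and gq = geo[OF n q(1)]
  \<comment> \<open>Division by \<open>x^n\<close> turns the relation into a sum of powers of
    \<open>1 / x\<close> equal to 1, which is strictly decreasing in \<open>x\<close>.\<close>
  have inv: "1 = (\<Sum>i<n. (1 / x) ^ (n - i))" if "x ^ n = (\<Sum>i<n. x ^ i)" "x > 1" for x :: real
  proof -
    have "x ^ n \<noteq> 0" using that(2) by simp
    hence "1 = (\<Sum>i<n. x ^ i) / x ^ n" by (simp add: that(1)[symmetric])
    also have "\<dots> = (\<Sum>i<n. (1 / x) ^ (n - i))"
      unfolding sum_divide_distrib using that(2)
      by (intro sum.cong refl) (simp add: power_one_over power_diff field_simps)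
    finally show ?thesis .
  qed
  have mono: "(\<Sum>i<n. (1 / y) ^ (n - i)) < (\<Sum>i<n. (1 / x) ^ (n - i))" if "1 < x" "x < y" for x y :: real
    using that n0 by (intro sum_strict_mono) (auto intro!: power_strict_mono divide_strict_left_mono)
  have "?a = q"
    using mono[of ?a q] mono[of q ?a] inv[OF ga a1] inv[OF gq q(1)] a1 q(1) by force
  thus ?thesis using pa by simp
qed

section \<open>Integrality of the base and its least positive sign polynomial value\<close>

context separated_base
begin

lemma one_lt_range: "1 < 1 / (q - 1)"
  using q_gt_1 q_lt_2 by simp

text \<open>Horner steps with a suitable digit keep the value in \<open>[-1, 1]\<close>, as
  \<open>q < 2\<close>. This gives a monic sign polynomial of each degree; two of them share a value
  by finiteness, and their difference is still monic.\<close>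

lemma algebraic_integer:
  obtains P where "lead_coeff P = 1" "int_eval P (complex_of_real q) = 0"
proof -
  have "\<exists>f. \<forall>n. (f n \<in> sign_polys \<and> lead_coeff (f n) = 1 \<and> degree (f n) = n \<and> \<bar>int_eval (f n) q\<bar> \<le> 1) \<and> True"
  proof (rule dependent_nat_choice)
    show "\<exists>P. P \<in> sign_polys \<and> lead_coeff P = 1 \<and> degree P = 0 \<and> \<bar>int_eval P q\<bar> \<le> 1"
      by (intro exI[of _ 1]) auto
  next
    fix P :: "int poly" and n
    assume P: "P \<in> sign_polys \<and> lead_coeff P = 1 \<and> degree P = n \<and> \<bar>int_eval P q\<bar> \<le> 1"
    define r where "r = int_eval P q"
    have "\<bar>q * r\<bar> \<le> q * 1" unfolding abs_mult using P q_gt_1 by (intro mult_mono) (auto simp: r_def)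
    hence qr: "\<bar>q * r\<bar> \<le> 2" using q_lt_2 by linarith
    obtain s :: int where s: "s \<in> {-1, 0, 1}" "\<bar>of_int s + q * r\<bar> \<le> 1"
    proof (cases "q * r > 1")
      case True thus ?thesis using that[of "-1"] qr by auto
    next
      case False
      show ?thesis
      proof (cases "q * r < -1")
        case True thus ?thesis using that[of 1] qr by auto
      next
        case False' : False thus ?thesis using that[of 0] False by auto
      qed
    qed
    have "P \<noteq> 0" using P by auto
    thus "\<exists>Q. (Q \<in> sign_polys \<and> lead_coeff Q = 1 \<and> degree Q = Suc n \<and> \<bar>int_eval Q q\<bar> \<le> 1) \<and> True"
      using P s pCons_in_sign_polys[of P s] by (intro exI[of _ "pCons s P"]) (auto simp: r_def)
  qed
  then obtain f where f: "\<And>n. f n \<in> sign_polys" "\<And>n. lead_coeff (f n) = 1" "\<And>n. degree (f n) = n"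
    "\<And>n. \<bar>int_eval (f n) q\<bar> \<le> 1" by blast
  have "range (\<lambda>n. int_eval (f n) q) \<subseteq> {r. (\<exists>P\<in>sign_polys. r = int_eval P q) \<and> \<bar>r\<bar> \<le> 1}"
    using f by auto
  hence "finite (range (\<lambda>n. int_eval (f n) q))"
    by (rule finite_subset) (rule finite_sign_values[OF one_lt_range])
  hence "\<not> inj (\<lambda>n. int_eval (f n) q)" using range_inj_infinite by blast
  then obtain i j where "i \<noteq> j" "int_eval (f i) q = int_eval (f j) q" by (auto simp: inj_def)
  then obtain i j where ij: "i < j" "int_eval (f i) q = int_eval (f j) q" by (metis linorder_neqE_nat)
  have "lead_coeff (- f i + f j) = lead_coeff (f j)"
    using ij f(3) by (intro lead_coeff_add_le) simp
  hence "lead_coeff (- f i + f j) = 1" using f(2) by simp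
  thus ?thesis using that[of "- f i + f j"] ij by (simp add: int_eval_of_real)
qed

text \<open>Only finitely many values lie in \<open>[-1, 1]\<close>, and 1 is one of them.
  Minimality later serves as a test: a value of smaller modulus must be 0.\<close>

lemma least_positive_value:
  obtains P where "P \<in> sign_polys" "0 < int_eval P q"
    "\<And>Q. Q \<in> sign_polys \<Longrightarrow> 0 < int_eval Q q \<Longrightarrow> int_eval P q \<le> int_eval Q q"
proof -
  define S where "S = {r. (\<exists>P\<in>sign_polys. r = int_eval P q) \<and> \<bar>r\<bar> \<le> 1} \<inter> {0<..}"
  have fin: "finite S" using finite_sign_values[OF one_lt_range] by (simp add: S_def)
  have "1 \<in> S" by (auto simp: S_def intro!: bexI[of _ 1])
  hence ne: "S \<noteq> {}" by auto
  have M: "Min S \<in> S" using fin ne by (rule Min_in)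
  then obtain P where P: "P \<in> sign_polys" "Min S = int_eval P q" by (auto simp: S_def)
  have "Min S \<le> int_eval Q q" if "Q \<in> sign_polys" "0 < int_eval Q q" for Q
  proof (cases "int_eval Q q \<le> 1")
    case True
    thus ?thesis using that fin by (intro Min_le) (auto simp: S_def)
  next
    case False
    thus ?thesis using M by (auto simp: S_def)
  qed
  thus ?thesis using that[of P] P M by (auto simp: S_def)
qed

text \<open>If the least value \<open>r\<close> is at least \<open>1 / (q^2 - 1)\<close>, then
  \<open>q * r - 1\<close> has modulus below \<open>r\<close>, hence vanishes. A second zero test,
  on a value of \<open>x^k - x^(k-1) - ... - 1\<close>, then makes \<open>q\<close> a multinacci
  number.\<close>

lemma least_positive_value_cases:
  assumes P: "P \<in> sign_polys" "0 < int_eval P q"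
    "\<And>Q. Q \<in> sign_polys \<Longrightarrow> 0 < int_eval Q q \<Longrightarrow> int_eval P q \<le> int_eval Q q"
  shows "int_eval P q < 1 / (q\<^sup>2 - 1) \<and> int_eval P q < 1 / q \<or> (\<exists>n. q ^ n * (2 - q) = 1)"
proof -
  define r where "r = int_eval P q"
  have r0: "0 < r" using P by (simp add: r_def)
  have zero: "int_eval Q q = 0" if "Q \<in> sign_polys" "\<bar>int_eval Q q\<bar> < r" for Q
    using P(3)[OF that(1)] P(3)[OF uminus_in_sign_polys[OF that(1)]] that(2)
    by (cases "int_eval Q q > 0"; cases "int_eval Q q < 0") (auto simp: r_def)
  have r1: "r \<le> 1" using P(3)[of 1] by (simp add: r_def)
  have q2: "q\<^sup>2 > 1" using q_gt_1 by (simp add: one_less_power)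
  have q21: "q\<^sup>2 - 1 = (q - 1) * (q + 1)" by (simp add: power2_eq_square algebra_simps)
  \<comment> \<open>\<open>V k\<close> is the polynomial
    \<open>x^k - x^(k-1) - ... - 1\<close>.\<close>
  define V where "V = (\<lambda>k::nat. (pCons (-1) ^^ k) (1 :: int poly))"
  have V_in: "V k \<in> sign_polys" for k
    unfolding V_def by (induction k) (auto intro: pCons_in_sign_polys)
  define v where "v = (\<lambda>k. int_eval (V k) q)"
  have v0: "v 0 = 1" and vS: "v (Suc k) = q * v k - 1" for k
    by (auto simp: v_def V_def)
  have v_closed: "(q - 1) * v k = 1 - q ^ k * (2 - q)" for k
  proof (induction k)
    case (Suc k)
    have "(q - 1) * v (Suc k) = q * ((q - 1) * v k) - (q - 1)" by (simp add: vS algebra_simps)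
    thus ?case unfolding Suc.IH by (simp add: algebra_simps)
  qed (simp add: v0)
  have "\<exists>k. v k < q / (q\<^sup>2 - 1)"
  proof -
    obtain k where "1 / (2 - q) < q ^ k" using real_arch_pow[OF q_gt_1] by blast
    hence "1 < q ^ k * (2 - q)" using q_lt_2 by (simp add: field_simps)
    hence "(q - 1) * v k < 0" by (simp add: v_closed)
    hence "v k < 0" using q_gt_1 by (simp add: mult_less_0_iff)
    moreover have "q / (q\<^sup>2 - 1) > 0" using q2 q_gt_1 by simp
    ultimately show ?thesis by (intro exI[of _ k]) linarith
  qed
  \<comment> \<open>The map \<open>x \<mapsto> q * x - 1\<close> sends the threshold
    \<open>q / (q^2 - 1)\<close> to \<open>1 / (q^2 - 1)\<close>. So the first value below the
    threshold is still positive, and the value after it is below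
    \<open>1 / (q^2 - 1)\<close>.\<close>
  define K where "K = (LEAST k. v k < q / (q\<^sup>2 - 1))"
  have K: "v K < q / (q\<^sup>2 - 1)" unfolding K_def by (rule LeastI_ex) fact
  have vK: "v K > 0"
  proof (cases K)
    case (Suc j)
    have "\<not> v j < q / (q\<^sup>2 - 1)" using Suc unfolding K_def by (intro not_less_Least) simp
    hence "q * (q / (q\<^sup>2 - 1)) \<le> q * v j" using q_gt_1 by (intro mult_left_mono) auto
    hence "v K \<ge> q * (q / (q\<^sup>2 - 1)) - 1" by (simp add: Suc vS)
    moreover have "q * (q / (q\<^sup>2 - 1)) - 1 = 1 / (q\<^sup>2 - 1)" using q2 by (simp add: field_simps power2_eq_square)
    moreover have "1 / (q\<^sup>2 - 1) > 0" using q2 by simp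
    ultimately show ?thesis by linarith
  qed (simp add: v0)
  have rv: "r \<le> v K" using P(3)[OF V_in[of K]] vK by (simp add: v_def r_def)
  show ?thesis
  proof (cases "r < 1 / (q\<^sup>2 - 1)")
    case True
    have "r < 1 / q"
    \<comment> \<open>The golden ratio separates the cases; below it the value \<open>q - 1\<close>
      bounds \<open>r\<close>.\<close>
    proof (cases "q\<^sup>2 - 1 \<ge> q")
      case True': True
      hence "1 / (q\<^sup>2 - 1) \<le> 1 / q" using q_gt_1 by (intro divide_left_mono) auto
      thus ?thesis using True by linarith
    next
      case False
      have "r \<le> q - 1" using P(3)[OF V_in[of 1]] q_gt_1 by (simp add: V_def r_def)
      moreover have "q - 1 < 1 / q" using False q_gt_1 by (simp add: field_simps power2_eq_square)
      ultimately show ?thesis by linarith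
    qed
    thus ?thesis using True by (simp add: r_def)
  next
    case False
    have "(q - 1) * r < 1"
    proof -
      have "(q - 1) * r \<le> (q - 1) * 1" using r1 q_gt_1 by (intro mult_left_mono) auto
      also have "\<dots> < 1" using q_lt_2 by simp
      finally show ?thesis .
    qed
    moreover have "r * (q + 1) > 1"
    proof -
      have "r * (q + 1) \<ge> 1 / (q\<^sup>2 - 1) * (q + 1)" using False q_gt_1 by (intro mult_right_mono) auto
      also have "1 / (q\<^sup>2 - 1) * (q + 1) = 1 / (q - 1)" using q_gt_1 by (simp add: q21)
      finally show ?thesis using one_lt_range by linarith
    qed
    ultimately have "\<bar>q * r - 1\<bar> < r" by (simp add: algebra_simps abs_less_iff)
    hence "int_eval (pCons (-1) P) q = 0"
      using P(1) by (intro zero pCons_in_sign_polys) (auto simp: r_def)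
    hence qr: "q * r = 1" by (simp add: r_def)
    hence rq: "r = 1 / q" using q_gt_1 by (simp add: field_simps)
    have "q * v K - 1 \<ge> 0" using rv q_gt_1 rq by (simp add: field_simps)
    moreover have "q * v K - 1 < r"
    proof -
      have "q * v K < q * (q / (q\<^sup>2 - 1))" using K q_gt_1 by (intro mult_strict_left_mono) auto
      also have "\<dots> = 1 + 1 / (q\<^sup>2 - 1)" using q2 by (simp add: field_simps power2_eq_square)
      finally show ?thesis using False by linarith
    qed
    ultimately have "v (Suc K) = 0" unfolding v_def using V_in vS[of K]
      by (intro zero) (auto simp: v_def)
    hence "q ^ Suc K * (2 - q) = 1" using v_closed[of "Suc K"] by simp
    thus ?thesis by blast
  qed
qed

lemma geometric_total: "(\<lambda>i. (1 / q) ^ Suc i) sums (1 / (q - 1))"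
proof -
  have "(\<lambda>i. (1 / q) * (1 / q) ^ i) sums ((1 / q) * (1 / (1 - 1 / q)))"
    using q_gt_1 by (intro sums_mult geometric_sums) auto
  also have "(1 / q) * (1 / (1 - 1 / q)) = 1 / (q - 1)" using q_gt_1 by (simp add: field_simps)
  finally show ?thesis by simp
qed

text \<open>The value at \<open>q\<close> determines the value at the conjugate \<open>p\<close>,
  and only finitely many values at \<open>q\<close> have modulus at most \<open>C\<close>.\<close>

lemma conjugate_values_bounded:
  fixes p :: complex
  assumes R: "irreducible R" "int_eval R (complex_of_real q) = 0" "int_eval R p = 0"
    and C: "C < 1 / (q - 1)"
  obtains K where "\<And>P. P \<in> sign_polys \<Longrightarrow> \<bar>int_eval P q\<bar> \<le> C \<Longrightarrow> norm (int_eval P p) \<le> K"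
proof -
  let ?S = "{r. (\<exists>P\<in>sign_polys. r = int_eval P q) \<and> \<bar>r\<bar> \<le> C}"
  define \<pi> where "\<pi> = (\<lambda>r. SOME P. P \<in> sign_polys \<and> r = int_eval P q)"
  have fin: "finite ((\<lambda>r. norm (int_eval (\<pi> r) p)) ` ?S)"
    using finite_sign_values[OF C] by (rule finite_imageI)
  have "norm (int_eval P p) \<le> Max ((\<lambda>r. norm (int_eval (\<pi> r) p)) ` ?S)"
    if P: "P \<in> sign_polys" "\<bar>int_eval P q\<bar> \<le> C" for P
  proof -
    define r where "r = int_eval P q"
    have "\<pi> r \<in> sign_polys \<and> r = int_eval (\<pi> r) q"
      unfolding \<pi>_def using P(1) by (intro someI_ex[of "\<lambda>P. P \<in> sign_polys \<and> r = int_eval P q"]) (auto simp: r_def)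
    hence "int_eval (P - \<pi> r) (complex_of_real q) = 0" by (simp add: int_eval_of_real r_def)
    hence "int_eval (P - \<pi> r) p = 0" using common_root_transfer[OF R(1,2) _ R(3)] by blast
    hence "norm (int_eval P p) = norm (int_eval (\<pi> r) p)" by simp
    moreover have "r \<in> ?S" using P by (auto simp: r_def)
    ultimately show ?thesis using fin by (intro Max_ge) auto
  qed
  thus ?thesis using that by blast
qed

text \<open>The functional \<open>Re (\<omega> z) - c r\<close> of a pair \<open>(r, z) = (P(q), P(p))\<close> can be made to
  increase along every step of an expansion of \<open>\<plusminus>r\<close> whose digits have the signs prescribed by \<open>A\<close>,
  whereas the pairs \<open>(r, z)\<close> occurring in such an expansion remain bounded.\<close>

lemma balanced_functional_contradiction:
  fixes p \<omega> :: complex and c :: real and A :: "nat set"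
  assumes P1: "P1 \<in> sign_polys" "0 < int_eval P1 q"
      "\<And>Q. Q \<in> sign_polys \<Longrightarrow> 0 < int_eval Q q \<Longrightarrow> int_eval P1 q \<le> int_eval Q q"
    and small: "int_eval P1 q < 1 / q"
    and R: "irreducible R" "int_eval R (complex_of_real q) = 0" "int_eval R p = 0"
    and p: "1 \<le> norm p" and \<omega>: "\<omega> \<noteq> 0"
    and posA: "\<And>i. 1 \<le> i \<Longrightarrow> i \<in> A \<Longrightarrow> c / q ^ i \<le> Re (\<omega> / p ^ i)"
    and negA: "\<And>i. 1 \<le> i \<Longrightarrow> i \<notin> A \<Longrightarrow> Re (\<omega> / p ^ i) \<le> c / q ^ i"
    and strict: "\<And>i. 2 \<le> i \<Longrightarrow> Re (\<omega> / p ^ i) \<noteq> c / q ^ i"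
    and sumA: "int_eval P1 q < (\<Sum>i. if Suc i \<in> A then (1 / q) ^ Suc i else 0)"
    and sumB: "int_eval P1 q < (\<Sum>i. if Suc i \<in> A then 0 else (1 / q) ^ Suc i)"
  shows False
proof -
  define r1 where "r1 = int_eval P1 q"
  define T where "T = 1 / (q - 1)"
  have T1: "T > 1" using one_lt_range by (simp add: T_def)
  have qT: "q * T = T + 1" using q_gt_1 by (simp add: T_def field_simps)
  have q0: "q > 0" "q \<noteq> 0" using q_gt_1 by auto
  have p0: "p \<noteq> 0" using p by auto
  have transfer: "int_eval P p = 0" if "int_eval P q = 0" for P
    using common_root_transfer[OF R(1,2) _ R(3)] that by (simp add: int_eval_of_real)
  have geo: "(\<lambda>i. (1 / q) ^ Suc i) sums T" unfolding T_def by (rule geometric_total)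
  \<comment> \<open>\<open>B k\<close> is the weight of the places beyond \<open>k\<close> outside
    \<open>A\<close>, rescaled by \<open>q^k\<close>. For \<open>B n - P(q)\<close> the digits 0, 1
    on \<open>A\<close> and -1, 0 off \<open>A\<close> become plain digits 0, 1.\<close>
  define b where "b = (\<lambda>k i. if Suc (i + k) \<in> A then 0 else (1 / q) ^ Suc i)"
  define B where "B = (\<lambda>k. \<Sum>i. b k i)"
  have sb: "summable (b k)" for k
    by (rule summable_comparison_test'[OF sums_summable[OF geo], of 0]) (use q0 in \<open>auto simp: b_def\<close>)
  have B_nonneg: "B k \<ge> 0" for k
    unfolding B_def using q0 by (intro suminf_nonneg sb) (auto simp: b_def)
  have B_le: "B k \<le> T" for k
    unfolding B_def sums_unique[OF geo] using q0
    by (intro suminf_le sb sums_summable[OF geo]) (auto simp: b_def)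
  have B_Suc: "B (Suc k) = q * B k - (if Suc k \<in> A then 0 else 1)" for k
  proof -
    have "B k = b k 0 + (\<Sum>i. b k (Suc i))" unfolding B_def using suminf_split_head[OF sb] by simp
    also have "(\<lambda>i. b k (Suc i)) = (\<lambda>i. (1 / q) * b (Suc k) i)" by (auto simp: b_def)
    also have "(\<Sum>i. (1 / q) * b (Suc k) i) = (1 / q) * B (Suc k)"
      unfolding B_def by (rule suminf_mult[OF sb])
    finally show ?thesis using q0 by (auto simp: b_def field_simps split: if_splits)
  qed
  define SA where "SA = (\<Sum>i. if Suc i \<in> A then (1 / q) ^ Suc i else 0)"
  have sA: "summable (\<lambda>i. if Suc i \<in> A then (1 / q) ^ Suc i else 0)"
    by (rule summable_comparison_test'[OF sums_summable[OF geo], of 0]) (use q0 in auto)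
  have SAB: "SA + B 0 = T"
    unfolding SA_def B_def suminf_add[OF sA sb] sums_unique[OF geo]
    by (intro suminf_cong) (auto simp: b_def)
  have rA: "r1 < SA" and rB: "r1 < B 0" and r1_pos: "0 < r1"
    using sumA sumB P1 by (simp_all add: r1_def SA_def B_def b_def)
  \<comment> \<open>The margin \<eta> keeps \<open>B n - P(q)\<close> in
    \<open>[\<eta>, T - \<eta>]\<close>, so that the values have modulus at most
    \<open>T - \<eta>\<close> and \<open>conjugate_values_bounded\<close> applies. The term
    \<open>(T - 1) / 2\<close> leaves room for choosing the next digit.\<close>
  define \<eta> where "\<eta> = min ((T - 1) / 2) (min (SA - r1) (B 0 - r1))"
  have \<eta>: "\<eta> > 0" "\<eta> \<le> (T - 1) / 2" "\<eta> \<le> SA - r1" "\<eta> \<le> B 0 - r1"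
    using T1 rA rB unfolding \<eta>_def by (simp, linarith+)
  \<comment> \<open>The sign makes the functional start nonnegative.\<close>
  define P0 where "P0 = (if Re (\<omega> * int_eval P1 p) - c * r1 \<ge> 0 then P1 else - P1)"
  have P0: "P0 \<in> sign_polys" "\<bar>int_eval P0 q\<bar> = r1" "Re (\<omega> * int_eval P0 p) - c * int_eval P0 q \<ge> 0"
    using P1 r1_pos by (auto simp: P0_def r1_def uminus_in_sign_polys)
  have "\<exists>f. \<forall>n. (f n \<in> sign_polys \<and> \<eta> \<le> B n - int_eval (f n) q \<and> B n - int_eval (f n) q \<le> T - \<eta> \<and> (n = 0 \<longrightarrow> f n = P0))
      \<and> (\<exists>s\<in>{-1,0,1}. f (Suc n) = pCons s (f n) \<and> (Suc n \<in> A \<longrightarrow> s \<ge> 0) \<and> (Suc n \<notin> A \<longrightarrow> s \<le> 0))"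
  proof (rule dependent_nat_choice)
    show "\<exists>P. P \<in> sign_polys \<and> \<eta> \<le> B 0 - int_eval P q \<and> B 0 - int_eval P q \<le> T - \<eta> \<and> (0 = (0::nat) \<longrightarrow> P = P0)"
      using P0(1,2) \<eta> SAB by (intro exI[of _ P0]) (auto simp: abs_if split: if_splits)
  next
    fix P :: "int poly" and n :: nat
    assume P: "P \<in> sign_polys \<and> \<eta> \<le> B n - int_eval P q \<and> B n - int_eval P q \<le> T - \<eta> \<and> (n = 0 \<longrightarrow> P = P0)"
    define u where "u = B n - int_eval P q"
    have u: "\<eta> \<le> u" "u \<le> T - \<eta>" using P by (auto simp: u_def)
    have "q * u \<le> q * (T - \<eta>)" using u q0 by (intro mult_left_mono) auto
    hence qu: "q * u \<le> T + 1 - q * \<eta>" using qT by (simp add: algebra_simps)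
    have q\<eta>: "q * \<eta> \<ge> \<eta>" "q * u \<ge> u" using q_gt_1 \<eta> u by auto
    obtain \<epsilon> :: int where \<epsilon>: "\<epsilon> \<in> {0, 1}" "\<eta> \<le> q * u - of_int \<epsilon>" "q * u - of_int \<epsilon> \<le> T - \<eta>"
    proof (cases "q * u \<le> T - \<eta>")
      case True thus ?thesis using that[of 0] u q\<eta> by auto
    next
      case False thus ?thesis using that[of 1] qu q\<eta> \<eta> by auto
    qed
    define s where "s = (if Suc n \<in> A then \<epsilon> else \<epsilon> - 1)"
    have "B (Suc n) - int_eval (pCons s P) q = q * u - of_int \<epsilon>"
      by (simp add: B_Suc u_def s_def algebra_simps)
    moreover have "s \<in> {-1, 0, 1}" "Suc n \<in> A \<longrightarrow> s \<ge> 0" "Suc n \<notin> A \<longrightarrow> s \<le> 0"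
      using \<epsilon>(1) by (auto simp: s_def)
    ultimately show "\<exists>Q. (Q \<in> sign_polys \<and> \<eta> \<le> B (Suc n) - int_eval Q q \<and> B (Suc n) - int_eval Q q \<le> T - \<eta>
        \<and> (Suc n = 0 \<longrightarrow> Q = P0))
      \<and> (\<exists>s\<in>{-1,0,1}. Q = pCons s P \<and> (Suc n \<in> A \<longrightarrow> s \<ge> 0) \<and> (Suc n \<notin> A \<longrightarrow> s \<le> 0))"
      using P \<epsilon> pCons_in_sign_polys[of P s] by (intro exI[of _ "pCons s P"]) auto
  qed
  then obtain f where f: "\<And>n. f n \<in> sign_polys" "\<And>n. \<eta> \<le> B n - int_eval (f n) q"
      "\<And>n. B n - int_eval (f n) q \<le> T - \<eta>" "f 0 = P0"
      "\<And>n. \<exists>s\<in>{-1,0,1}. f (Suc n) = pCons s (f n) \<and> (Suc n \<in> A \<longrightarrow> s \<ge> 0) \<and> (Suc n \<notin> A \<longrightarrow> s \<le> 0)"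
    by metis
  from f(5) obtain s where s: "\<And>n. s n \<in> {-1,0,1}" "\<And>n. f (Suc n) = pCons (s n) (f n)"
      "\<And>n. Suc n \<in> A \<Longrightarrow> s n \<ge> 0" "\<And>n. Suc n \<notin> A \<Longrightarrow> s n \<le> 0"
    by metis
  define r where "r = (\<lambda>n. int_eval (f n) q)"
  define z where "z = (\<lambda>n. int_eval (f n) p)"
  \<comment> \<open>One expansion step adds \<open>s n * g (Suc n)\<close> to \<open>L\<close>; the
    prescribed signs of the digits make this nonnegative.\<close>
  define g where "g = (\<lambda>n. Re (\<omega> / p ^ n) - c / q ^ n)"
  define L where "L = (\<lambda>n. Re (\<omega> * z n / p ^ n) - c * r n / q ^ n)"
  have rS: "r (Suc n) = of_int (s n) + q * r n" and zS: "z (Suc n) = of_int (s n) + p * z n" for n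
    by (simp_all add: r_def z_def s(2))
  have LS: "L (Suc n) = L n + of_int (s n) * g (Suc n)" for n
  proof -
    have "\<omega> * z (Suc n) / p ^ Suc n = of_real (of_int (s n)) * (\<omega> / p ^ Suc n) + \<omega> * z n / p ^ n"
      using p0 by (simp add: zS field_simps)
    hence "Re (\<omega> * z (Suc n) / p ^ Suc n) = of_int (s n) * Re (\<omega> / p ^ Suc n) + Re (\<omega> * z n / p ^ n)"
      by (metis plus_complex.sel(1) Re_complex_of_real Im_complex_of_real times_complex.sel(1) mult_zero_left diff_zero)
    moreover have "c * r (Suc n) / q ^ Suc n = of_int (s n) * (c / q ^ Suc n) + c * r n / q ^ n"
      using q0 by (simp add: rS field_simps)
    ultimately show ?thesis by (simp add: L_def g_def algebra_simps)
  qed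
  have inc: "of_int (s n) * g (Suc n) \<ge> 0" for n
    using s(3,4)[of n] posA[of "Suc n"] negA[of "Suc n"]
    by (cases "Suc n \<in> A") (auto simp: g_def intro: mult_nonneg_nonneg mult_nonpos_nonpos)
  have Lmono: "L m \<le> L n" if "m \<le> n" for m n
    using that by (rule lift_Suc_mono_le[of L, rotated]) (use LS inc in auto)
  have L0: "L 0 \<ge> 0" using P0(3) by (simp add: L_def z_def r_def f(4))
  have gne: "g (Suc (Suc n)) \<noteq> 0" for n using strict[of "Suc (Suc n)"] by (simp add: g_def)
  have rbound: "\<bar>r n\<bar> \<le> T - \<eta>" for n
    using f(2,3)[of n] B_nonneg[of n] B_le[of n] by (simp add: r_def abs_le_iff)
  obtain K where K: "\<And>n. norm (z n) \<le> K"
    using conjugate_values_bounded[OF R, of "T - \<eta>"] \<eta>(1) f(1) rbound unfolding z_def r_def T_def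
    by (metis diff_less_eq less_add_same_cancel1)
  have r_pow: "r (Suc n) = q ^ n * r 1" if "\<And>m. 1 \<le> m \<Longrightarrow> m \<le> n \<Longrightarrow> s m = 0" for n
    using that by (induction n) (auto simp: rS)
  have Lbound: "L n \<le> norm \<omega> * K / norm p ^ n + \<bar>c\<bar> * T / q ^ n" for n
  proof -
    have "Re (\<omega> * z n / p ^ n) \<le> norm (\<omega> * z n / p ^ n)" by (rule complex_Re_le_cmod)
    also have "\<dots> = norm \<omega> * norm (z n) / norm p ^ n" by (simp add: norm_mult norm_divide norm_power)
    also have "\<dots> \<le> norm \<omega> * K / norm p ^ n"
      using K[of n] by (intro divide_right_mono mult_left_mono) auto
    finally have 1: "Re (\<omega> * z n / p ^ n) \<le> norm \<omega> * K / norm p ^ n" .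
    have "- (c * r n / q ^ n) \<le> \<bar>c * r n / q ^ n\<bar>" by (rule abs_ge_minus_self)
    also have "\<dots> = \<bar>c\<bar> * \<bar>r n\<bar> / q ^ n" using q0 by (simp add: abs_mult)
    also have "\<dots> \<le> \<bar>c\<bar> * T / q ^ n"
      using rbound[of n] \<eta> q0 by (intro divide_right_mono mult_left_mono) auto
    finally show ?thesis using 1 by (simp add: L_def)
  qed
  have q_inv: "(\<lambda>n. 1 / q ^ n) \<longlonglongrightarrow> 0"
    using LIMSEQ_inverse_realpow_zero[OF q_gt_1] by (simp add: inverse_eq_divide)
  \<comment> \<open>For \<open>norm p > 1\<close> the upper bound of \<open>L\<close> tends to 0, so
    \<open>L\<close> is constantly 0 and all digits from \<open>s 1\<close> on vanish, which
    boundedness of \<open>r\<close> allows only if \<open>r 1 = 0\<close>. For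
    \<open>norm p = 1\<close> an orbit avoiding 0 has nonzero digits too often.\<close>
  have "\<exists>n. r n = 0"
  proof (cases "norm p > 1")
    case True
    have "(\<lambda>n. 1 / norm p ^ n) \<longlonglongrightarrow> 0"
      using LIMSEQ_inverse_realpow_zero[OF True] by (simp add: inverse_eq_divide)
    hence "(\<lambda>n. norm \<omega> * K * (1 / norm p ^ n) + \<bar>c\<bar> * T * (1 / q ^ n)) \<longlonglongrightarrow> norm \<omega> * K * 0 + \<bar>c\<bar> * T * 0"
      using q_inv by (intro tendsto_intros)
    hence lim: "(\<lambda>n. norm \<omega> * K / norm p ^ n + \<bar>c\<bar> * T / q ^ n) \<longlonglongrightarrow> 0" by simp
    have "L m \<le> 0" for m
    proof (rule tendsto_lowerbound[OF lim])
      show "\<forall>\<^sub>F n in sequentially. L m \<le> norm \<omega> * K / norm p ^ n + \<bar>c\<bar> * T / q ^ n"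
        using eventually_ge_at_top[of m] by eventually_elim (use Lmono Lbound order_trans in blast)
    qed auto
    hence Lz: "L m = 0" for m using L0 Lmono[of 0 m] by (simp add: order_antisym)
    have sz: "s (Suc m) = 0" for m using LS[of "Suc m"] Lz gne[of m] by simp
    have pw: "r (Suc n) = q ^ n * r 1" for n
    proof (rule r_pow)
      fix m assume "1 \<le> m" "m \<le> n" thus "s m = 0" using sz by (cases m) auto
    qed
    have "r 1 = 0"
    proof (rule ccontr)
      assume "r 1 \<noteq> 0"
      then obtain n where "T / \<bar>r 1\<bar> < q ^ n" using real_arch_pow[OF q_gt_1] by blast
      hence "T < q ^ n * \<bar>r 1\<bar>" using \<open>r 1 \<noteq> 0\<close> by (simp add: pos_divide_less_eq)
      also have "\<dots> = \<bar>r (Suc n)\<bar>" unfolding pw[of n] abs_mult using q0 by simp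
      finally have "T < \<bar>r (Suc n)\<bar>" .
      thus False using rbound[of "Suc n"] \<eta>(1) by linarith
    qed
    thus ?thesis by blast
  next
    case False
    hence np: "norm p = 1" using p by simp
    show ?thesis
    proof (rule ccontr)
      assume nz: "\<not> (\<exists>n. r n = 0)"
      have r_ge: "r1 \<le> \<bar>r n\<bar>" for n
        using nz P1(3)[of "f n"] P1(3)[of "- f n"] f(1)[of n] uminus_in_sign_polys[of "f n"]
        by (cases "r n > 0") (auto simp: r_def r1_def not_less le_less)
      \<comment> \<open>A run of \<open>W\<close> zero digits would carry a value of modulus at
        least \<open>r1\<close> beyond \<open>T\<close>.\<close>
      obtain W where "T / r1 < q ^ W" using real_arch_pow[OF q_gt_1] by blast
      hence W: "T < q ^ W * r1" using r1_pos by (simp add: field_simps)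
      have next_nz: "\<exists>j. i \<le> j \<and> j < i + W \<and> s j \<noteq> 0" for i
      proof (rule ccontr)
        assume no: "\<not> ?thesis"
        have "r (i + n) = q ^ n * r i" if "n \<le> W" for n
          using that no by (induction n) (auto simp: rS)
        hence "\<bar>r (i + W)\<bar> = q ^ W * \<bar>r i\<bar>" using q0 by (simp add: abs_mult)
        also have "\<dots> \<ge> q ^ W * r1" using r_ge[of i] q0 by (intro mult_left_mono) auto
        finally show False using W rbound[of "i + W"] \<eta>(1) by linarith
      qed
      \<comment> \<open>A real power of \<open>p\<close> on the unit circle would make
        \<open>p\<close>, and with it the conjugate \<open>q > 1\<close>, a root of unity.\<close>
      have Im_ne: "Im (p ^ d) \<noteq> 0" if "d > 0" for d
      proof
        assume "Im (p ^ d) = 0"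
        moreover have "(Re (p ^ d))\<^sup>2 + (Im (p ^ d))\<^sup>2 = 1"
          using cmod_power2[of "p ^ d"] np by (simp add: norm_power)
        ultimately have "p ^ d = 1 \<or> p ^ d = -1" by (auto simp: complex_eq_iff power2_eq_1_iff)
        hence "p ^ (2 * d) = 1" by (auto simp: power_mult power2_eq_square mult.commute[of 2])
        hence "int_eval (monom 1 (2 * d) - 1) p = 0" by simp
        hence "int_eval (monom 1 (2 * d) - 1) (complex_of_real q) = 0"
          using common_root_transfer[OF R(1,3) _ R(2)] by blast
        hence "complex_of_real (q ^ (2 * d)) = 1" by simp
        hence "q ^ (2 * d) = 1" unfolding of_real_eq_1_iff .
        moreover have "q ^ (2 * d) > 1" using q_gt_1 that by (intro one_less_power) auto
        ultimately show False by simp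
      qed
      \<comment> \<open>Late nonzero digits occur only where \<open>\<omega> / p^(n+1)\<close> has
        real part below \<nu> in modulus. Two such places at distance \<open>d \<le> W\<close> make
        \<open>p^d\<close> almost real, and the factor 4 makes this contradict
        \<open>Im_ne\<close>.\<close>
      define \<nu> where "\<nu> = norm \<omega> * Min ((\<lambda>d. \<bar>Im (p ^ d)\<bar>) ` {1..W}) / 4"
      have W0: "W > 0" using next_nz[of 0] by auto
      have \<nu>: "\<nu> > 0" using \<omega> W0 Im_ne by (auto simp: \<nu>_def Min_gr_iff)
      have \<nu>_le: "4 * \<nu> \<le> norm \<omega> * \<bar>Im (p ^ d)\<bar>" if "1 \<le> d" "d \<le> W" for d
        unfolding \<nu>_def using that by (auto intro!: mult_left_mono Min_le)
      have "L n \<le> norm \<omega> * K + \<bar>c\<bar> * T" for n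
      proof -
        have "\<bar>c\<bar> * T / q ^ n \<le> \<bar>c\<bar> * T / 1" using q_gt_1 T1 by (intro divide_left_mono) auto
        thus ?thesis using Lbound[of n] by (simp add: np)
      qed
      moreover have "incseq L" using Lmono by (simp add: incseq_def)
      ultimately obtain l where "L \<longlonglongrightarrow> l" by (metis incseq_convergent)
      hence "(\<lambda>n. L (Suc n) - L n) \<longlonglongrightarrow> l - l" by (intro tendsto_diff LIMSEQ_Suc)
      hence "(\<lambda>n. of_int (s n) * g (Suc n)) \<longlonglongrightarrow> 0" by (simp add: LS)
      hence ev1: "\<forall>\<^sub>F n in sequentially. \<bar>of_int (s n) * g (Suc n)\<bar> < \<nu> / 2"
        using \<nu> by (auto simp: tendsto_iff dest!: spec[of _ "\<nu> / 2"])
      have "(\<lambda>n. c * (1 / q ^ Suc n)) \<longlonglongrightarrow> c * 0" using LIMSEQ_Suc[OF q_inv] by (intro tendsto_intros)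
      hence ev2: "\<forall>\<^sub>F n in sequentially. \<bar>c / q ^ Suc n\<bar> < \<nu> / 2"
        using \<nu> by (auto simp: tendsto_iff dest!: spec[of _ "\<nu> / 2"])
      obtain n0 where n0: "\<And>n. n \<ge> n0 \<Longrightarrow> \<bar>of_int (s n) * g (Suc n)\<bar> < \<nu> / 2 \<and> \<bar>c / q ^ Suc n\<bar> < \<nu> / 2"
        using eventually_conj[OF ev1 ev2] by (auto simp: eventually_sequentially)
      have Re_small: "\<bar>Re (\<omega> / p ^ Suc n)\<bar> < \<nu>" if "n \<ge> n0" "s n \<noteq> 0" for n
      proof -
        have "\<bar>of_int (s n) * g (Suc n)\<bar> = \<bar>g (Suc n)\<bar>" using s(1)[of n] that(2) by auto
        hence "\<bar>g (Suc n)\<bar> < \<nu> / 2" "\<bar>c / q ^ Suc n\<bar> < \<nu> / 2" using n0[OF that(1)] by auto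
        thus ?thesis unfolding g_def by linarith
      qed
      obtain i where i: "i \<ge> n0" "s i \<noteq> 0" using next_nz[of n0] by blast
      obtain j where j: "Suc i \<le> j" "j < Suc i + W" "s j \<noteq> 0" using next_nz[of "Suc i"] by blast
      define d where "d = j - i"
      have d: "1 \<le> d" "d \<le> W" using j by (auto simp: d_def)
      define x y where "x = \<omega> / p ^ Suc i" and "y = \<omega> / p ^ Suc j"
      have "x = y * p ^ d" using p0 j by (simp add: x_def y_def d_def power_diff field_simps)
      moreover have "norm y = norm \<omega>" by (simp add: y_def norm_divide norm_power norm_mult np)
      hence "y * cnj y = of_real ((norm \<omega>)\<^sup>2)" using complex_norm_square[of y] by simp
      ultimately have "x * cnj y = p ^ d * of_real ((norm \<omega>)\<^sup>2)" by (simp add: mult_ac)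
      hence "Im x * Re y - Re x * Im y = Im (p ^ d) * (norm \<omega>)\<^sup>2"
        by (simp add: complex_eq_iff)
      moreover have "\<bar>Im x * Re y - Re x * Im y\<bar> \<le> norm \<omega> * \<nu> + \<nu> * norm \<omega>"
      proof -
        have nx: "norm x = norm \<omega>" "norm y = norm \<omega>" by (simp_all add: x_def y_def norm_divide norm_power norm_mult np)
        have "\<bar>Im x * Re y\<bar> \<le> norm \<omega> * \<nu>"
          unfolding abs_mult using Re_small[of j] j i abs_Im_le_cmod[of x] nx
          by (intro mult_mono) (auto simp: y_def)
        moreover have "\<bar>Re x * Im y\<bar> \<le> \<nu> * norm \<omega>"
          unfolding abs_mult using Re_small[of i] i abs_Im_le_cmod[of y] nx \<nu>
          by (intro mult_mono) (auto simp: x_def)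
        ultimately show ?thesis by linarith
      qed
      ultimately have "\<bar>Im (p ^ d)\<bar> * (norm \<omega>)\<^sup>2 \<le> 2 * \<nu> * norm \<omega>" by (simp add: abs_mult)
      hence "norm \<omega> * (norm \<omega> * \<bar>Im (p ^ d)\<bar>) \<le> norm \<omega> * (2 * \<nu>)" by (simp add: power2_eq_square algebra_simps)
      hence "norm \<omega> * \<bar>Im (p ^ d)\<bar> \<le> 2 * \<nu>" using \<omega> by simp
      thus False using \<nu>_le[OF d] \<nu> by linarith
    qed
  qed
  \<comment> \<open>At the zero also \<open>L\<close> is 0, so it was 0 all along and the digits
    from \<open>s 1\<close> up to there vanish. As \<open>strict\<close> starts at index 2, the
    digit \<open>s 0\<close> may be nonzero; then \<open>q * r1\<close> would be 0 or 1, against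
    \<open>0 < r1 < 1 / q\<close>.\<close>
  then obtain n where n: "r n = 0" by blast
  hence "z n = 0" using transfer[of "f n"] by (simp add: r_def z_def)
  hence "L n = 0" using n by (simp add: L_def)
  hence Lz: "L m = 0" if "m \<le> n" for m using L0 Lmono[of 0 m] Lmono[OF that] by simp
  have sz: "s m = 0" if "1 \<le> m" "Suc m \<le> n" for m
    using LS[of m] Lz[of m] Lz[of "Suc m"] gne[of "m - 1"] that by simp
  have r0: "\<bar>r 0\<bar> = r1" using P0(2) f(4) by (simp add: r_def)
  obtain m where m: "n = Suc m" using n r0 r1_pos by (cases n) auto
  have "r (Suc m) = q ^ m * r 1" using sz by (intro r_pow) (auto simp: m)
  hence "r 1 = 0" using n m q0 by simp
  hence "q * r 0 = - of_int (s 0)" using rS[of 0] by simp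
  hence "q * r1 = \<bar>of_int (s 0)\<bar>" using r0 q0 by (metis abs_minus_cancel abs_mult abs_of_pos)
  hence "q * r1 = 0 \<or> q * r1 = 1" using s(1)[of 0] by auto
  moreover have "q * r1 < 1" using small q0 by (simp add: r1_def field_simps)
  ultimately show False using r1_pos q0 by auto
qed

section \<open>Digit sums and the choice of a balanced sign pattern\<close>

definition digit_sum :: "nat set \<Rightarrow> real" where
  "digit_sum A = (\<Sum>i. if Suc i \<in> A then (1 / q) ^ Suc i else 0)"

lemma summable_digits: "summable (\<lambda>i. if Suc i \<in> A then (1 / q) ^ Suc i else 0)"
  by (rule summable_comparison_test'[OF sums_summable[OF geometric_total], of 0]) (use q_gt_1 in auto)

lemma digit_sum_nonneg: "0 \<le> digit_sum A"
  unfolding digit_sum_def using q_gt_1 by (intro suminf_nonneg summable_digits) auto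

lemma digit_sum_compl: "(\<Sum>i. if Suc i \<in> A then 0 else (1 / q) ^ Suc i) = 1 / (q - 1) - digit_sum A"
proof -
  have "(\<lambda>i. (1 / q) ^ Suc i - (if Suc i \<in> A then (1 / q) ^ Suc i else 0)) sums (1 / (q - 1) - digit_sum A)"
    unfolding digit_sum_def by (intro sums_diff geometric_total summable_sums summable_digits)
  also have "(\<lambda>i. (1 / q) ^ Suc i - (if Suc i \<in> A then (1 / q) ^ Suc i else 0))
      = (\<lambda>i. if Suc i \<in> A then 0 else (1 / q) ^ Suc i)" by auto
  finally show ?thesis by (rule sums_unique[symmetric])
qed

lemma digit_sum_le: "digit_sum A \<le> 1 / (q - 1)"
proof -
  have "(\<Sum>i. if Suc i \<in> A then 0 else (1 / q) ^ Suc i) = digit_sum (- A)"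
    unfolding digit_sum_def by (intro suminf_cong) auto
  thus ?thesis using digit_sum_compl[of A] digit_sum_nonneg[of "- A"] by linarith
qed

lemma digit_sum_split: "digit_sum A = (if 1 \<in> A then 1 / q else 0) + digit_sum {i. Suc i \<in> A} / q"
proof -
  let ?f = "\<lambda>i. if Suc i \<in> A then (1 / q) ^ Suc i else 0"
  have "digit_sum A = ?f 0 + (\<Sum>i. ?f (Suc i))"
    unfolding digit_sum_def using suminf_split_head[OF summable_digits[of A]] by simp
  also have "(\<lambda>i. ?f (Suc i)) = (\<lambda>i. (1 / q) * (if Suc i \<in> {i. Suc i \<in> A} then (1 / q) ^ Suc i else 0))" by auto
  also have "(\<Sum>i. (1 / q) * (if Suc i \<in> {i. Suc i \<in> A} then (1 / q) ^ Suc i else 0)) = (1 / q) * digit_sum {i. Suc i \<in> A}"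
    unfolding digit_sum_def by (rule suminf_mult[OF summable_digits])
  finally show ?thesis by auto
qed

text \<open>\<open>A\<close> and its shift by one share no place, so their sums add up to at most
  \<open>1 / (q - 1)\<close>, while \<open>digit_sum_split\<close> expresses one through the other.
  The odd numbers attain the bound.\<close>

lemma digit_sum_no_consecutive:
  assumes "\<And>i. i \<in> A \<Longrightarrow> Suc i \<notin> A"
  shows "digit_sum A \<le> q / (q\<^sup>2 - 1)"
proof -
  have "digit_sum A + digit_sum {i. Suc i \<in> A} = (\<Sum>i. (if Suc i \<in> A then (1 / q) ^ Suc i else 0)
      + (if Suc i \<in> {i. Suc i \<in> A} then (1 / q) ^ Suc i else 0))"
    unfolding digit_sum_def by (intro suminf_add summable_digits)
  also have "\<dots> \<le> (\<Sum>i. (1 / q) ^ Suc i)"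
    using assms q_gt_1
    by (intro suminf_le summable_add summable_digits sums_summable[OF geometric_total]) auto
  also have "\<dots> = 1 / (q - 1)" using geometric_total by (rule sums_unique[symmetric])
  finally have 1: "digit_sum A + digit_sum {i. Suc i \<in> A} \<le> 1 / (q - 1)" .
  define x where "x = digit_sum {i. Suc i \<in> A}"
  show ?thesis
  proof (cases "1 \<in> A")
    case True
    hence A: "digit_sum A = 1 / q + x / q" using digit_sum_split[of A] by (simp add: x_def)
    have "x \<le> 1 / (q\<^sup>2 - 1)"
    proof -
      have "x * (q + 1) \<le> q / (q - 1) - 1"
        using 1 A q_gt_1 by (simp add: x_def[symmetric] field_simps)
      also have "\<dots> = 1 / (q - 1)" using q_gt_1 by (simp add: field_simps)
      finally have "x \<le> 1 / (q - 1) / (q + 1)" by (subst pos_le_divide_eq) (use q_gt_1 in auto)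
      thus ?thesis by (simp add: power2_eq_square algebra_simps)
    qed
    hence "digit_sum A \<le> 1 / q + 1 / (q\<^sup>2 - 1) / q" unfolding A using q_gt_1 by (intro add_left_mono divide_right_mono) auto
    also have "\<dots> = q / (q\<^sup>2 - 1)"
      using q_gt_1 one_less_power[OF q_gt_1, of 2] by (simp add: field_simps power2_eq_square)
    finally show ?thesis .
  next
    case False
    hence "digit_sum A = x / q" using digit_sum_split[of A] by (simp add: x_def)
    hence x: "x = q * digit_sum A" using q_gt_1 by simp
    have "digit_sum A * (q + 1) \<le> 1 / (q - 1)" using 1 x by (simp add: x_def[symmetric] algebra_simps)
    hence "digit_sum A \<le> 1 / (q - 1) / (q + 1)" by (subst pos_le_divide_eq) (use q_gt_1 in auto)
    also have "\<dots> = 1 / (q\<^sup>2 - 1)" by (simp add: power2_eq_square algebra_simps)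
    also have "\<dots> \<le> q / (q\<^sup>2 - 1)" using q_gt_1 one_less_power[OF q_gt_1, of 2] by (intro divide_right_mono) auto
    finally show ?thesis .
  qed
qed

text \<open>A conjugate on or outside the unit circle is refuted by
  \<open>balanced_functional_contradiction\<close>. It remains to find \<omega> and \<open>c\<close>
  whose sign pattern gives weight more than \<open>r\<close> both to \<open>A\<close> and to its
  complement; the bounds of \<open>least_positive_value_cases\<close> make this possible.\<close>

lemma conjugate_norm_less_one:
  fixes p :: complex
  assumes R: "irreducible R" "int_eval R (complex_of_real q) = 0" "int_eval R p = 0"
    and pq: "p \<noteq> of_real q"
  shows "norm p < 1"
proof (rule ccontr)
  assume "\<not> norm p < 1"
  hence p: "1 \<le> norm p" by simp
  hence p0: "p \<noteq> 0" by auto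
  obtain P1 where P1: "P1 \<in> sign_polys" "0 < int_eval P1 q"
      "\<And>Q. Q \<in> sign_polys \<Longrightarrow> 0 < int_eval Q q \<Longrightarrow> int_eval P1 q \<le> int_eval Q q"
    using least_positive_value by blast
  define r where "r = int_eval P1 q"
  define T where "T = 1 / (q - 1)"
  have "\<not> (\<exists>n. q ^ n * (2 - q) = 1)"
    using multinacci_conjugate[OF q_gt_1 q_lt_2 _ R p] pq by blast
  hence r: "r < 1 / (q\<^sup>2 - 1)" "r < 1 / q"
    using least_positive_value_cases[OF P1] by (auto simp: r_def)
  have q2: "q\<^sup>2 - 1 = (q - 1) * (q + 1)" by (simp add: power2_eq_square algebra_simps)
  have qT: "T = T / q + 1 / q" using q_gt_1 by (simp add: T_def field_simps)
  have rT: "q * r + r < T"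
  proof -
    have "r * (q + 1) < 1 / (q\<^sup>2 - 1) * (q + 1)" using r(1) q_gt_1 by (intro mult_strict_right_mono) auto
    also have "\<dots> = T" using q_gt_1 by (simp add: q2 T_def)
    finally show ?thesis by (simp add: algebra_simps)
  qed
  \<comment> \<open>With \<open>w = q / p\<close>, comparing \<open>Re (\<omega> / p^i)\<close> with
    \<open>c / q^i\<close> becomes comparing \<open>Re (\<omega> * w^i)\<close> with the constant
    \<open>c\<close>.\<close>
  define w where "w = of_real q / p"
  have w0: "w \<noteq> 0" using p0 q_gt_1 by (simp add: w_def)
  have w1: "w \<noteq> 1" using pq p0 by (auto simp: w_def)
  have contra: False
    if "\<omega> \<noteq> 0" and posA: "\<And>i. 1 \<le> i \<Longrightarrow> i \<in> A \<Longrightarrow> c \<le> Re (\<omega> * w ^ i)"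
      and negA: "\<And>i. 1 \<le> i \<Longrightarrow> i \<notin> A \<Longrightarrow> Re (\<omega> * w ^ i) \<le> c"
      and strict: "\<And>i. 2 \<le> i \<Longrightarrow> Re (\<omega> * w ^ i) \<noteq> c"
      and sums: "r < digit_sum A" "r < T - digit_sum A" for \<omega> c A
  proof -
    have eq: "Re (\<omega> / p ^ i) = Re (\<omega> * w ^ i) / q ^ i" for i
    proof -
      have "\<omega> / p ^ i = (\<omega> * w ^ i) / of_real (q ^ i)" using q_gt_1 by (simp add: w_def power_divide)
      thus ?thesis by (simp only: Re_divide_of_real)
    qed
    have qi: "q ^ i > 0" for i using q_gt_1 by simp
    show False
    proof (rule balanced_functional_contradiction[OF P1 _ R p \<open>\<omega> \<noteq> 0\<close>, of A c])
      show "int_eval P1 q < 1 / q" using r by (simp add: r_def)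
      show "int_eval P1 q < (\<Sum>i. if Suc i \<in> A then (1 / q) ^ Suc i else 0)"
        using sums(1) by (simp add: r_def digit_sum_def)
      show "int_eval P1 q < (\<Sum>i. if Suc i \<in> A then 0 else (1 / q) ^ Suc i)"
        using sums(2) by (simp add: r_def digit_sum_compl T_def)
      show "c / q ^ i \<le> Re (\<omega> / p ^ i)" if "1 \<le> i" "i \<in> A" for i
        unfolding eq using posA[OF that] qi[of i] by (intro divide_right_mono) auto
      show "Re (\<omega> / p ^ i) \<le> c / q ^ i" if "1 \<le> i" "i \<notin> A" for i
        unfolding eq using negA[OF that] qi[of i] by (intro divide_right_mono) auto
      show "Re (\<omega> / p ^ i) \<noteq> c / q ^ i" if "2 \<le> i" for i
        unfolding eq using strict[OF that] q_gt_1 by simp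
    qed
  qed
  show False
  \<comment> \<open>For a root of unity, \<open>\<omega> = 1 / w\<close> and a \<open>c\<close> just
    below 1 select the indices with \<open>w^(i-1) = 1\<close>, never two consecutive ones.
    Otherwise a generic direction \<omega> is used.\<close>
  proof (cases "\<exists>n\<ge>1. w ^ n = 1")
    case True
    then obtain n where n: "n \<ge> 1" "w ^ n = 1" by blast
    have nw: "norm w = 1" using power_eq_1_iff[OF n(2)] n(1) by simp
    define F where "F = insert (-1) ((\<lambda>j. Re (w ^ j)) ` {j. j < n \<and> w ^ j \<noteq> 1})"
    have finF: "finite F" by (simp add: F_def)
    have lt1: "Re (w ^ j) < 1" if "w ^ j \<noteq> 1" for j
    proof -
      have "norm (w ^ j) = 1" by (simp add: norm_power nw)
      hence "Re (w ^ j) \<le> 1" using complex_Re_le_cmod[of "w ^ j"] by simp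
      moreover have "Re (w ^ j) \<noteq> 1"
      proof
        assume "Re (w ^ j) = 1"
        hence "w ^ j = 1" using cmod_power2[of "w ^ j"] \<open>norm (w ^ j) = 1\<close> by (simp add: complex_eq_iff)
        thus False using that by blast
      qed
      ultimately show ?thesis by linarith
    qed
    define c where "c = (1 + Max F) / 2"
    have "Max F < 1" using finF lt1 by (subst Max_less_iff) (auto simp: F_def)
    hence c1: "c < 1" "Max F < c" by (auto simp: c_def)
    have cw: "Re (w ^ j) < c" if "w ^ j \<noteq> 1" for j
    proof -
      have "w ^ j = w ^ (n * (j div n) + j mod n)" by simp
      also have "\<dots> = w ^ (j mod n)" unfolding power_add power_mult using n by simp
      finally have "Re (w ^ j) \<in> F" using that n(1) by (auto simp: F_def)
      hence "Re (w ^ j) \<le> Max F" using finF by (intro Max_ge)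
      thus ?thesis using c1 by linarith
    qed
    define A where "A = {i. 1 \<le> i \<and> w ^ (i - 1) = 1}"
    have \<kappa>: "1 / w * w ^ i = w ^ (i - 1)" if "1 \<le> i" for i
      using that w0 by (cases i) auto
    show False
    proof (rule contra[of "1 / w" A c])
      show "1 / w \<noteq> 0" using w0 by simp
      show "c \<le> Re (1 / w * w ^ i)" if "1 \<le> i" "i \<in> A" for i
        using that c1 unfolding \<kappa>[OF that(1)] by (simp add: A_def)
      show "Re (1 / w * w ^ i) \<le> c" if "1 \<le> i" "i \<notin> A" for i
        using that cw[of "i - 1"] unfolding \<kappa>[OF that(1)] by (simp add: A_def)
      show "Re (1 / w * w ^ i) \<noteq> c" if "2 \<le> i" for i
      proof -
        have "1 \<le> i" using that by simp
        thus ?thesis unfolding \<kappa>[OF \<open>1 \<le> i\<close>] using cw[of "i - 1"] c1 by (cases "w ^ (i - 1) = 1") auto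
      qed
      have "1 \<in> A" by (simp add: A_def)
      hence "digit_sum A \<ge> 1 / q"
        using digit_sum_split[of A] digit_sum_nonneg[of "{i. Suc i \<in> A}"] q_gt_1 by simp
      thus "r < digit_sum A" using r by linarith
      have "Suc i \<notin> A" if "i \<in> A" for i
      proof
        assume "Suc i \<in> A"
        hence "w ^ i = 1" by (simp add: A_def)
        moreover have "w ^ i = w * w ^ (i - 1)" using that by (cases i) (auto simp: A_def)
        ultimately show False using that w1 by (simp add: A_def)
      qed
      hence "digit_sum A \<le> q / (q\<^sup>2 - 1)" by (rule digit_sum_no_consecutive)
      moreover have "T - q / (q\<^sup>2 - 1) = 1 / (q\<^sup>2 - 1)"
      proof -
        have "T = (q + 1) / (q\<^sup>2 - 1)" using q_gt_1 by (simp add: T_def q2)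
        hence "T - q / (q\<^sup>2 - 1) = (q + 1 - q) / (q\<^sup>2 - 1)" by (simp only: diff_divide_distrib)
        thus ?thesis by simp
      qed
      ultimately show "r < T - digit_sum A" using r by linarith
    qed
  next
    case False
    have wi: "w ^ i - w \<noteq> 0" if "2 \<le> i" for i
    proof
      assume "w ^ i - w = 0"
      moreover have "w ^ i = w * w ^ (i - 1)" using that by (cases i) auto
      ultimately have "w ^ (i - 1) = 1" using w0 by auto
      moreover have "1 \<le> i - 1" using that by simp
      ultimately show False using False by blast
    qed
    \<comment> \<open>Each \<open>i\<close> forbids one slope. If \<open>Im (w^i - w) = 0\<close>
      the quotient is 0 by convention; that case is excluded separately through
      \<open>wi\<close>.\<close>
    have "\<exists>s. s \<notin> (\<Union>i\<in>{2..}. {Re (w ^ i - w) / Im (w ^ i - w)})"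
    proof -
      have "countable (\<Union>i\<in>{2::nat..}. {Re (w ^ i - w) / Im (w ^ i - w)})" by simp
      thus ?thesis using uncountable_UNIV_real by (metis UNIV_eq_I)
    qed
    then obtain s where s: "\<And>i. 2 \<le> i \<Longrightarrow> s \<noteq> Re (w ^ i - w) / Im (w ^ i - w)" by auto
    define \<omega> where "\<omega> = Complex 1 s"
    have \<omega>0: "\<omega> \<noteq> 0" by (simp add: \<omega>_def complex_eq_iff)
    \<comment> \<open>Index 1 becomes a tie and may be put into the set or left out.\<close>
    define c where "c = Re (\<omega> * w)"
    have ne: "Re (\<omega> * w ^ i) \<noteq> c" if "2 \<le> i" for i
    proof
      assume "Re (\<omega> * w ^ i) = c"
      hence "Re (w ^ i - w) = s * Im (w ^ i - w)" by (simp add: \<omega>_def c_def algebra_simps)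
      moreover have "Im (w ^ i - w) \<noteq> 0"
      proof
        assume "Im (w ^ i - w) = 0"
        hence "w ^ i - w = 0" using calculation by (simp add: complex_eq_iff)
        thus False using wi[OF that] by blast
      qed
      ultimately show False using s[OF that] by simp
    qed
    define H where "H = {i. 2 \<le> i \<and> c < Re (\<omega> * w ^ i)}"
    have H1: "1 \<notin> H" by (simp add: H_def)
    define h where "h = digit_sum H"
    have h0: "0 \<le> h" unfolding h_def by (rule digit_sum_nonneg)
    have Suc_insert: "{i. Suc i \<in> insert 1 H} = insert 0 {i. Suc i \<in> H}" by auto
    have "digit_sum (insert 0 {i. Suc i \<in> H}) = digit_sum {i. Suc i \<in> H}"
      unfolding digit_sum_def by simp
    hence ins: "digit_sum (insert 1 H) = 1 / q + h"
      using digit_sum_split[of "insert 1 H"] digit_sum_split[of H] H1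
      unfolding Suc_insert h_def by simp
    have hT: "h \<le> T / q" using digit_sum_le[of "insert 1 H"] qT unfolding ins T_def[symmetric] by linarith
    show False
    \<comment> \<open>The candidates are \<open>insert 1 H\<close>, \<open>H\<close>, and the shift
      of \<open>H\<close> with \<open>\<omega> * w\<close> in place of \<omega>. If the first two
      fail, then \<open>h \<le> r\<close> and \<open>T / q - h \<le> r\<close>, and
      \<open>rT\<close> balances the third.\<close>
    proof (cases "r < T / q - h \<or> r < h")
      case True
      thus False
      proof
        assume *: "r < T / q - h"
        show False
        proof (rule contra[of \<omega> "insert 1 H" c])
          show "r < digit_sum (insert 1 H)" unfolding ins using r h0 by linarith
          show "r < T - digit_sum (insert 1 H)" unfolding ins using * qT by linarith
          show "c \<le> Re (\<omega> * w ^ i)" if "1 \<le> i" "i \<in> insert 1 H" for i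
            using that by (auto simp: H_def c_def)
          show "Re (\<omega> * w ^ i) \<le> c" if "1 \<le> i" "i \<notin> insert 1 H" for i
            using that by (auto simp: H_def)
        qed (use \<omega>0 ne in auto)
      next
        assume *: "r < h"
        show False
        proof (rule contra[of \<omega> H c])
          show "r < digit_sum H" using * by (simp add: h_def)
          show "r < T - digit_sum H" using hT qT r by (simp add: h_def)
          show "c \<le> Re (\<omega> * w ^ i)" if "1 \<le> i" "i \<in> H" for i
            using that by (auto simp: H_def)
          show "Re (\<omega> * w ^ i) \<le> c" if "1 \<le> i" "i \<notin> H" for i
          proof (cases "i = 1")
            case True thus ?thesis by (simp add: c_def)
          next
            case False thus ?thesis using that by (auto simp: H_def)
          qed
        qed (use \<omega>0 ne in auto)
      qed
    next
      case *: False
      define A where "A = {i. Suc i \<in> H}"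
      have A: "digit_sum A = q * h"
        using digit_sum_split[of H] H1 q_gt_1 by (simp add: A_def h_def)
      have "q * h \<le> q * r" "q * (T / q - h) \<le> q * r"
        using * q_gt_1 by (intro mult_left_mono; linarith)+
      hence **: "q * h \<le> q * r" "T - q * h \<le> q * r" using q_gt_1 by (simp_all add: algebra_simps)
      show False
      proof (rule contra[of "\<omega> * w" A c])
        show "\<omega> * w \<noteq> 0" using \<omega>0 w0 by simp
        show "r < digit_sum A" unfolding A using ** rT by linarith
        show "r < T - digit_sum A" unfolding A using ** rT by linarith
        show "c \<le> Re (\<omega> * w * w ^ i)" if "1 \<le> i" "i \<in> A" for i
          using that by (auto simp: A_def H_def mult.assoc)
        show "Re (\<omega> * w * w ^ i) \<le> c" if "1 \<le> i" "i \<notin> A" for i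
          using that by (auto simp: A_def H_def mult.assoc)
        show "Re (\<omega> * w * w ^ i) \<noteq> c" if "2 \<le> i" for i
          using ne[of "Suc i"] that by (simp add: mult.assoc)
      qed
    qed
  qed
qed

theorem pisot_base: "pisot q"
proof -
  obtain P where P: "lead_coeff P = 1" "int_eval P (complex_of_real q) = 0"
    using algebraic_integer .
  obtain R where R: "lead_coeff R = 1" "irreducible R" "int_eval R (complex_of_real q) = 0"
    using monic_irreducible_factor[OF P] by blast
  show ?thesis
    unfolding pisot_def using q_gt_1 R conjugate_norm_less_one[OF R(2,3)]
    by (auto simp: int_eval_def intro!: exI[of _ R])
qed

end

corollary small_sign_values:
  fixes q \<delta> :: real
  assumes "1 < q" "q < 2" "\<not> pisot q" "0 < \<delta>"
  obtains P where "P \<in> sign_polys" "0 < int_eval P q" "int_eval P q < \<delta>"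
proof -
  have "\<not> separated_base q \<delta>" using separated_base.pisot_base assms(3) by blast
  then obtain P where P: "P \<in> sign_polys" "int_eval P q \<noteq> 0" "\<bar>int_eval P q\<bar> < \<delta>"
    using assms unfolding separated_base_def by force
  show ?thesis
  proof (cases "int_eval P q > 0")
    case True thus ?thesis using that[of P] P by auto
  next
    case False thus ?thesis using that[of "- P"] P uminus_in_sign_polys[OF P(1)] by auto
  qed
qed

section \<open>Density of orbits\<close>

text \<open>The exponents are decided from the largest downwards. If \<open>b\<close> is skipped
  then \<open>z < q^b\<close>, which the gap condition keeps within reach of the smaller exponents
  up to the error \<open>C\<close>.\<close>

lemma greedy_subset_sum:
  fixes q C z :: real and F :: "nat set"
  assumes "finite F" "0 \<le> C" "\<And>i. i \<in> F \<Longrightarrow> q ^ i \<le> C + (\<Sum>j\<in>{j\<in>F. j < i}. q ^ j)"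
    and "0 \<le> z" "z \<le> (\<Sum>i\<in>F. q ^ i) + C"
  shows "\<exists>S\<subseteq>F. (\<Sum>i\<in>S. q ^ i) \<le> z \<and> z \<le> (\<Sum>i\<in>S. q ^ i) + C"
  using assms(1,3-)
proof (induction F arbitrary: z rule: finite_linorder_max_induct)
  case empty
  thus ?case by auto
next
  case (insert b A)
  have bA: "b \<notin> A" using insert.hyps by auto
  have cond: "q ^ i \<le> C + (\<Sum>j\<in>{j\<in>A. j < i}. q ^ j)" if "i \<in> A" for i
  proof -
    have "i < b" using insert.hyps(2) that by blast
    hence "{j \<in> insert b A. j < i} = {j\<in>A. j < i}" by auto
    thus ?thesis using insert.prems(1)[of i] that by simp
  qed
  have "{j \<in> insert b A. j < b} = A" using insert.hyps(2) by auto
  hence qb: "q ^ b \<le> C + (\<Sum>j\<in>A. q ^ j)" using insert.prems(1)[of b] by simp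
  show ?case
  proof (cases "q ^ b \<le> z")
    case True
    obtain S where S: "S \<subseteq> A" "(\<Sum>i\<in>S. q ^ i) \<le> z - q ^ b" "z - q ^ b \<le> (\<Sum>i\<in>S. q ^ i) + C"
      using insert.IH[OF cond, of "z - q ^ b"] True insert.prems(3) insert.hyps(1) bA by auto
    have "b \<notin> S" "finite S" using S(1) bA insert.hyps(1) finite_subset by auto
    thus ?thesis using S by (intro exI[of _ "insert b S"]) auto
  next
    case False
    then obtain S where "S \<subseteq> A" "(\<Sum>i\<in>S. q ^ i) \<le> z" "z \<le> (\<Sum>i\<in>S. q ^ i) + C"
      using insert.IH[OF cond, of z] qb insert.prems(2) by auto
    thus ?thesis by blast
  qed
qed

lemma bit_poly_eval_eq_sum:
  fixes x :: "'a::comm_ring_1"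
  assumes "A \<in> bit_polys"
  shows "int_eval A x = (\<Sum>i | coeff A i \<noteq> 0. x ^ i)" "finite {i. coeff A i \<noteq> 0}"
proof -
  show fin: "finite {i. coeff A i \<noteq> 0}"
    by (rule finite_subset[of _ "{..degree A}"]) (auto intro: le_degree)
  have "A = (\<Sum>i\<le>degree A. monom (coeff A i) i)" by (rule poly_as_sum_of_monoms[symmetric])
  hence "int_eval A x = (\<Sum>i\<le>degree A. of_int (coeff A i) * x ^ i)"
    by (metis (no_types, lifting) int_eval_monom int_eval_sum sum.cong)
  also have "\<dots> = (\<Sum>i | coeff A i \<noteq> 0. of_int (coeff A i) * x ^ i)"
    by (rule sum.mono_neutral_right) (auto intro: le_degree)
  also have "\<dots> = (\<Sum>i | coeff A i \<noteq> 0. x ^ i)"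
  proof (rule sum.cong)
    fix i assume "i \<in> {i. coeff A i \<noteq> 0}"
    moreover have "coeff A i \<in> {0, 1}" using assms unfolding bit_polys_def by blast
    ultimately show "of_int (coeff A i) * x ^ i = x ^ i" by simp
  qed simp
  finally show "int_eval A x = (\<Sum>i | coeff A i \<noteq> 0. x ^ i)" .
qed

text \<open>A tiny value \<open>A(Q) - B(Q)\<close> at \<open>Q = q^m\<close> is scaled by a power
  of \<open>Q\<close> into \<open>[\<delta> / Q, \<delta>)\<close>. Exchanging the scaled
  \<open>B\<close> for the scaled \<open>A\<close> is one step of the chain, and all exponents are
  multiples of \<open>m\<close>.\<close>

lemma fine_chain:
  fixes q \<delta> :: real and m :: nat
  assumes q: "1 < q" and m: "1 \<le> m" and \<delta>: "0 < \<delta>"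
    and small: "\<And>\<epsilon>. 0 < \<epsilon> \<Longrightarrow> \<exists>P\<in>sign_polys. 0 < int_eval P (q ^ m) \<and> int_eval P (q ^ m) < \<epsilon>"
  shows "\<exists>N C. (\<forall>s\<le>J. C s \<subseteq> {i. i < N \<and> m dvd i}) \<and>
    (\<forall>s<J. \<delta> / q ^ m \<le> (\<Sum>i\<in>C (Suc s). q ^ i) - (\<Sum>i\<in>C s. q ^ i) \<and>
      (\<Sum>i\<in>C (Suc s). q ^ i) - (\<Sum>i\<in>C s. q ^ i) < \<delta>)"
proof (induction J)
  case 0
  show ?case by (intro exI[of _ 0] exI[of _ "\<lambda>_. {}"]) auto
next
  case (Suc J)
  then obtain N C where C: "\<And>s. s \<le> J \<Longrightarrow> C s \<subseteq> {i. i < N \<and> m dvd i}"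
    and inc: "\<And>s. s < J \<Longrightarrow> \<delta> / q ^ m \<le> (\<Sum>i\<in>C (Suc s). q ^ i) - (\<Sum>i\<in>C s. q ^ i) \<and>
      (\<Sum>i\<in>C (Suc s). q ^ i) - (\<Sum>i\<in>C s. q ^ i) < \<delta>" by blast
  define Q where "Q = q ^ m"
  have Q1: "Q > 1" unfolding Q_def using q m by (intro one_less_power) auto
  \<comment> \<open>The bound \<open>\<delta> / Q^N\<close> forces a scaling exponent of at least
    \<open>N\<close>, so new exponents avoid those already used.\<close>
  obtain P where P: "P \<in> sign_polys" "0 < int_eval P Q" "int_eval P Q < \<delta> / Q ^ N"
    using small[of "\<delta> / Q ^ N"] \<delta> Q1 by (auto simp: Q_def)
  define e where "e = int_eval P Q"
  obtain A B where AB: "A \<in> bit_polys" "B \<in> bit_polys" "P = A - B"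
    using sign_poly_eq_bit_polys_diff[OF P(1)] .
  have "\<exists>t. \<delta> \<le> Q ^ t * e"
  proof -
    obtain t where "\<delta> / e < Q ^ t" using real_arch_pow[OF Q1] by blast
    thus ?thesis using P by (intro exI[of _ t]) (auto simp: e_def field_simps)
  qed
  then obtain t where t: "\<delta> \<le> Q ^ t * e" "\<And>u. u < t \<Longrightarrow> Q ^ u * e < \<delta>"
    using exists_least_iff[of "\<lambda>t. \<delta> \<le> Q ^ t * e"] by (auto simp: not_le)
  have QN: "Q ^ N * e < \<delta>" using P Q1 by (simp add: e_def field_simps)
  have "t > N"
  proof (rule ccontr)
    assume "\<not> t > N"
    hence "Q ^ t * e \<le> Q ^ N * e" using Q1 P by (intro mult_right_mono power_increasing) (auto simp: e_def)
    thus False using t(1) QN by linarith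
  qed
  then obtain u where u: "t = Suc u" "u \<ge> N" by (cases t) auto
  define sh where "sh = (\<lambda>i. m * (i + u))"
  have sh: "inj_on sh I" "sh i \<ge> N" "m dvd sh i" for I i
  proof -
    show "inj_on sh I" using m by (auto simp: sh_def inj_on_def)
    have "N \<le> i + u" using u by simp
    also have "\<dots> \<le> m * (i + u)" using m by (cases m) auto
    finally show "sh i \<ge> N" unfolding sh_def .
  qed (simp add: sh_def)
  define A' B' where "A' = sh ` {i. coeff A i \<noteq> 0}" and "B' = sh ` {i. coeff B i \<noteq> 0}"
  have sum_sh: "(\<Sum>i\<in>sh ` {i. coeff D i \<noteq> 0}. q ^ i) = Q ^ u * int_eval D Q" if "D \<in> bit_polys" for D
  proof -
    have "(\<Sum>i\<in>sh ` {i. coeff D i \<noteq> 0}. q ^ i) = (\<Sum>i | coeff D i \<noteq> 0. q ^ sh i)"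
      using sh(1) by (subst sum.reindex) auto
    also have "\<dots> = (\<Sum>i | coeff D i \<noteq> 0. Q ^ u * Q ^ i)"
      unfolding sh_def power_mult Q_def[symmetric] power_add by (simp only: mult.commute)
    finally show ?thesis by (simp add: sum_distrib_left bit_poly_eval_eq_sum[OF that])
  qed
  have fin: "finite A'" "finite B'" using bit_poly_eval_eq_sum(2) AB by (auto simp: A'_def B'_def)
  hence "finite (A' \<union> B')" by simp
  then obtain N' where N': "\<And>i. i \<in> A' \<union> B' \<Longrightarrow> i < N'"
    using finite_nat_set_iff_bounded[of "A' \<union> B'"] by blast
  \<comment> \<open>Adding \<open>B'\<close> to every old set preserves the differences;
    \<open>A'\<close> in its place on top of \<open>C J\<close> gives the new step.\<close>
  define C' where "C' = (\<lambda>s. if s \<le> J then C s \<union> B' else C J \<union> A')"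
  have finC: "finite (C s)" if "s \<le> J" for s
    using C[OF that] by (rule finite_subset) simp
  have disj: "C s \<inter> A' = {}" "C s \<inter> B' = {}" if "s \<le> J" for s
  proof -
    have "i < N" if "i \<in> C s" for i using C[OF \<open>s \<le> J\<close>] that by blast
    moreover have "i \<ge> N" if "i \<in> A' \<union> B'" for i using that sh(2) by (auto simp: A'_def B'_def)
    ultimately show "C s \<inter> A' = {}" "C s \<inter> B' = {}" by fastforce+
  qed
  have sumA: "(\<Sum>i\<in>C s \<union> A'. q ^ i) = (\<Sum>i\<in>C s. q ^ i) + Q ^ u * int_eval A Q" if "s \<le> J" for s
    using sum_sh[OF AB(1)] by (subst sum.union_disjoint) (use finC[OF that] fin disj[OF that] in \<open>auto simp: A'_def\<close>)
  have sumB: "(\<Sum>i\<in>C s \<union> B'. q ^ i) = (\<Sum>i\<in>C s. q ^ i) + Q ^ u * int_eval B Q" if "s \<le> J" for s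
    using sum_sh[OF AB(2)] by (subst sum.union_disjoint) (use finC[OF that] fin disj[OF that] in \<open>auto simp: B'_def\<close>)
  have step: "(\<Sum>i\<in>C J \<union> A'. q ^ i) - (\<Sum>i\<in>C J \<union> B'. q ^ i) = Q ^ u * e"
    unfolding sumA[OF order_refl] sumB[OF order_refl] by (simp add: e_def AB(3) algebra_simps)
  have ue: "Q ^ u * e < \<delta>" "\<delta> / Q \<le> Q ^ u * e"
    using t(1) t(2)[of u] u Q1 by (auto simp: field_simps)
  show ?case
  proof (intro exI[of _ "max N N'"] exI[of _ C'] conjI allI impI)
    fix s assume "s \<le> Suc J"
    show "C' s \<subseteq> {i. i < max N N' \<and> m dvd i}"
    proof
      fix i assume "i \<in> C' s"
      then consider "i \<in> C s" "s \<le> J" | "i \<in> C J" | "i \<in> A' \<union> B'" by (auto simp: C'_def split: if_splits)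
      thus "i \<in> {i. i < max N N' \<and> m dvd i}"
      proof cases
        case 3 thus ?thesis using N'[of i] sh(3) by (auto simp: A'_def B'_def)
      qed (use C[of s] C[of J] in auto)
    qed
  next
    fix s assume "s < Suc J"
    then consider "s < J" | "s = J" by linarith
    hence *: "\<delta> / q ^ m \<le> (\<Sum>i\<in>C' (Suc s). q ^ i) - (\<Sum>i\<in>C' s. q ^ i) \<and>
      (\<Sum>i\<in>C' (Suc s). q ^ i) - (\<Sum>i\<in>C' s. q ^ i) < \<delta>"
    proof cases
      case 1 thus ?thesis using inc[of s] by (simp add: C'_def sumB)
    next
      case 2 thus ?thesis using step ue by (simp add: C'_def Q_def)
    qed
    show "\<delta> / q ^ m \<le> (\<Sum>i\<in>C' (Suc s). q ^ i) - (\<Sum>i\<in>C' s. q ^ i)" using * by blast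
    show "(\<Sum>i\<in>C' (Suc s). q ^ i) - (\<Sum>i\<in>C' s. q ^ i) < \<delta>" using * by blast
  qed
qed

text \<open>The gap condition of \<open>greedy_subset_sum\<close> for the class of 1 modulo
  \<open>m\<close>, which avoids the multiples of \<open>m\<close> reserved for
  \<open>fine_chain\<close>. As \<open>q^m < 2\<close>, two copies of \<open>q^(i-m)\<close> exceed
  \<open>q^i\<close>: one is covered by induction, the other by the member of the class in
  \<open>[i - m, i)\<close>.\<close>

lemma power_le_residue_class_sum:
  fixes q :: real and m :: nat
  assumes q: "1 < q" and m: "2 \<le> m" and qm: "q ^ m < 2"
  shows "q ^ i \<le> q + (\<Sum>j | j < i \<and> j mod m = 1. q ^ j)"
proof (induction i rule: less_induct)
  case (less i)
  have nonneg: "(\<Sum>j | j < k \<and> j mod m = 1. q ^ j) \<ge> 0" for k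
    using q by (intro sum_nonneg) auto
  consider "i = 0" | "i = 1" | "2 \<le> i" "i \<le> m" | "m < i" by linarith
  thus ?case
  proof cases
    case 1 thus ?thesis using q nonneg[of i] by simp
  next
    case 2 thus ?thesis using q nonneg[of i] by simp
  next
    case 3
    have "q ^ i \<le> q ^ m" using 3 q by (intro power_increasing) auto
    moreover have "q \<le> (\<Sum>j | j < i \<and> j mod m = 1. q ^ j)"
    proof -
      have "(\<Sum>j\<in>{1}. q ^ j) \<le> (\<Sum>j | j < i \<and> j mod m = 1. q ^ j)"
        using 3 q m by (intro sum_mono2) auto
      thus ?thesis by simp
    qed
    ultimately show ?thesis using qm q by linarith
  next
    case 4
    define k where "k = i - m"
    have k: "i = k + m" "k \<ge> 1" using 4 by (auto simp: k_def)
    \<comment> \<open>The largest exponent below \<open>i\<close> congruent to 1 modulo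
      \<open>m\<close>.\<close>
    define j where "j = i - 1 - (i - 2) mod m"
    have i2: "i \<ge> 2" using 4 m by simp
    have b: "(i - 2) mod m < m" using m by simp
    have "i - 2 = m * ((i - 2) div m) + (i - 2) mod m" by simp
    hence j_eq: "j = m * ((i - 2) div m) + 1" unfolding j_def using i2 by linarith
    have j: "j mod m = 1" "k \<le> j" "j < i"
    proof -
      have "(1 + m * ((i - 2) div m)) mod m = 1 mod m" by (rule mod_mult_self2)
      also have "\<dots> = 1" using m by (intro mod_less) simp
      finally show "j mod m = 1" unfolding j_eq by (simp only: add.commute)
      show "k \<le> j" unfolding j_def k_def using b by linarith
      show "j < i" unfolding j_def using i2 by linarith
    qed
    have "{j. j < k \<and> j mod m = 1} \<union> {j} \<subseteq> {j. j < i \<and> j mod m = 1}" using j k by auto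
    hence "(\<Sum>j\<in>{j. j < k \<and> j mod m = 1} \<union> {j}. q ^ j) \<le> (\<Sum>j | j < i \<and> j mod m = 1. q ^ j)"
      using q by (intro sum_mono2) auto
    moreover have "(\<Sum>j\<in>{j. j < k \<and> j mod m = 1} \<union> {j}. q ^ j) = (\<Sum>j | j < k \<and> j mod m = 1. q ^ j) + q ^ j"
      using j by (subst sum.union_disjoint) auto
    moreover have "q ^ k \<le> q ^ j" using j q by (intro power_increasing) auto
    moreover have "q ^ i \<le> 2 * q ^ k" unfolding k power_add using qm q by simp
    moreover have "q ^ k \<le> q + (\<Sum>j | j < k \<and> j mod m = 1. q ^ j)" using less.IH[of k] k m by simp
    ultimately show ?thesis by linarith
  qed
qed

text \<open>The multiples of \<open>m\<close> below \<open>N\<close> are kept for the chain. Greedy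
  subtraction over the other exponents below \<open>k\<close> leaves a remainder in a range of
  length \<open>q + 1\<close>, which the chain crosses in steps shorter than
  \<open>d - c\<close>.\<close>

lemma dense_orbit:
  fixes q \<xi> c d :: real and m :: nat
  assumes q: "1 < q" and m: "2 \<le> m" and qm: "q ^ m < 2"
    and small: "\<And>\<epsilon>. 0 < \<epsilon> \<Longrightarrow> \<exists>P\<in>sign_polys. 0 < int_eval P (q ^ m) \<and> int_eval P (q ^ m) < \<epsilon>"
    and \<xi>: "0 < \<xi>" "\<xi> < 1 / (q - 1)" and cd: "0 \<le> c" "c < d"
  shows "\<exists>k. \<exists>S\<subseteq>{..<k}. c < q ^ k * \<xi> - (\<Sum>i\<in>S. q ^ i) \<and> q ^ k * \<xi> - (\<Sum>i\<in>S. q ^ i) < d"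
proof -
  define \<delta> where "\<delta> = d - c"
  have \<delta>: "\<delta> > 0" using cd by (simp add: \<delta>_def)
  have qm0: "q ^ m > 0" using q by simp
  obtain J :: nat where "(q + 1) * q ^ m / \<delta> < real J" using reals_Archimedean2 by blast
  hence J: "q + 1 < real J * (\<delta> / q ^ m)" using \<delta> qm0 by (simp add: field_simps)
  have m1: "1 \<le> m" using m by simp
  obtain N C where C: "\<And>s. s \<le> J \<Longrightarrow> C s \<subseteq> {i. i < N \<and> m dvd i}"
    and inc: "\<And>s. s < J \<Longrightarrow> \<delta> / q ^ m \<le> (\<Sum>i\<in>C (Suc s). q ^ i) - (\<Sum>i\<in>C s. q ^ i)"
      "\<And>s. s < J \<Longrightarrow> (\<Sum>i\<in>C (Suc s). q ^ i) - (\<Sum>i\<in>C s. q ^ i) < \<delta>"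
    using fine_chain[OF q m1 \<delta> small, of J] by blast
  define y where "y = (\<lambda>s. \<Sum>i\<in>C s. q ^ i)"
  have y0: "y 0 \<ge> 0" unfolding y_def using q by (intro sum_nonneg) auto
  have y_ge: "y 0 + real s * (\<delta> / q ^ m) \<le> y s" if "s \<le> J" for s
    using that
  proof (induction s)
    case (Suc s)
    have "real (Suc s) * (\<delta> / q ^ m) = real s * (\<delta> / q ^ m) + \<delta> / q ^ m" by (simp only: of_nat_Suc distrib_right mult_1_left add.commute)
    thus ?case using Suc inc(1)[of s] unfolding y_def by linarith
  qed simp
  define D where "D = (\<Sum>i<N. q ^ i)"
  define T where "T = 1 / (q - 1)"
  have TxS: "T - \<xi> > 0" using \<xi> by (simp add: T_def)
  \<comment> \<open>\<open>k1\<close> makes the greedy target \<open>z\<close> nonnegative and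
    \<open>k2\<close> keeps it at most the total over \<open>F\<close> plus \<open>q\<close>; both
    rely on \<xi> lying strictly inside its interval.\<close>
  obtain k1 where "(c + y 0 + 1) / \<xi> < q ^ k1" using real_arch_pow[OF q] by blast
  moreover obtain k2 where "(T + D) / (T - \<xi>) < q ^ k2" using real_arch_pow[OF q] by blast
  moreover define k where "k = max N (max k1 k2)"
  have "q ^ k1 \<le> q ^ k" "q ^ k2 \<le> q ^ k" using q by (auto intro!: power_increasing simp: k_def)
  ultimately have "(c + y 0 + 1) / \<xi> < q ^ k" "(T + D) / (T - \<xi>) < q ^ k" by linarith+
  hence k: "c + y 0 + 1 < q ^ k * \<xi>" "T + D < q ^ k * (T - \<xi>)"
    using \<xi>(1) TxS by (simp_all add: pos_divide_less_eq)
  define F where "F = {i. i < k \<and> (N \<le> i \<or> \<not> m dvd i)}"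
  have finF: "finite F" by (simp add: F_def)
  \<comment> \<open>The offset \<open>y 0 + 1\<close> makes the remainder exceed the lowest chain
    value.\<close>
  define z where "z = q ^ k * \<xi> - c - y 0 - 1"
  have F_sum: "(\<Sum>i\<in>F. q ^ i) \<ge> (q ^ k - 1) / (q - 1) - D"
  proof -
    have "(q ^ k - 1) / (q - 1) = (\<Sum>i<k. q ^ i)" using q by (subst geometric_sum) auto
    also have "\<dots> \<le> (\<Sum>i\<in>F \<union> {..<N}. q ^ i)" using q finF by (intro sum_mono2) (auto simp: F_def)
    also have "\<dots> \<le> (\<Sum>i\<in>F. q ^ i) + D"
      unfolding D_def using q finF by (subst sum_Un) (auto intro!: sum_nonneg)
    finally show ?thesis by simp
  qed
  have "z \<le> (\<Sum>i\<in>F. q ^ i) + q"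
  proof -
    have "(q ^ k - 1) / (q - 1) = q ^ k * T - T" by (simp add: T_def diff_divide_distrib)
    thus ?thesis using F_sum k(2) cd y0 q by (simp add: z_def algebra_simps)
  qed
  moreover have "0 \<le> z" using k by (simp add: z_def)
  moreover have "q ^ i \<le> q + (\<Sum>j\<in>{j\<in>F. j < i}. q ^ j)" if "i \<in> F" for i
  proof -
    have "(\<Sum>j | j < i \<and> j mod m = 1. q ^ j) \<le> (\<Sum>j\<in>{j\<in>F. j < i}. q ^ j)"
      using q finF that m by (intro sum_mono2) (auto simp: F_def mod_eq_0_iff_dvd[symmetric])
    thus ?thesis using power_le_residue_class_sum[OF q m qm, of i] by linarith
  qed
  ultimately obtain S where S: "S \<subseteq> F" "(\<Sum>i\<in>S. q ^ i) \<le> z" "z \<le> (\<Sum>i\<in>S. q ^ i) + q"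
    using greedy_subset_sum[OF finF, of q q z] q by auto
  define \<rho> where "\<rho> = q ^ k * \<xi> - c - (\<Sum>i\<in>S. q ^ i)"
  have \<rho>: "y 0 < \<rho>" "\<rho> \<le> y 0 + (q + 1)" using S by (auto simp: \<rho>_def z_def)
  have "\<rho> \<le> y J" using \<rho> y_ge[of J] J by linarith
  \<comment> \<open>The chain value just before the first one reaching \<open>\<rho>\<close> is less
    than \<delta> below \<open>\<rho>\<close>; its set is subtracted as well.\<close>
  then obtain s where s: "\<rho> \<le> y s" "\<And>t. t < s \<Longrightarrow> y t < \<rho>"
    using exists_least_iff[of "\<lambda>s. \<rho> \<le> y s"] by (auto simp: not_le)
  have "s \<le> J" using s(2)[of J] \<open>\<rho> \<le> y J\<close> by (meson not_le)
  moreover have "s \<noteq> 0" using s(1) \<rho> by (cases s) auto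
  ultimately obtain t where t: "s = Suc t" "t < J" by (cases s) auto
  have yt: "y t < \<rho>" "\<rho> - \<delta> < y t" using s t inc(2)[of t] by (auto simp: y_def)
  have Ct: "C t \<subseteq> {i. i < N \<and> m dvd i}" using C[of t] t by simp
  have disj: "S \<inter> C t = {}"
  proof (rule ccontr)
    assume "S \<inter> C t \<noteq> {}"
    then obtain x where "x \<in> F" "x < N" "m dvd x" using S(1) Ct by blast
    thus False by (simp add: F_def)
  qed
  have fin: "finite S" "finite (C t)" using S(1) Ct finF by (auto intro: finite_subset)
  have total: "(\<Sum>i\<in>S \<union> C t. q ^ i) = (\<Sum>i\<in>S. q ^ i) + y t"
    unfolding y_def using disj fin by (rule sum.union_disjoint[rotated 2])
  have "S \<union> C t \<subseteq> {..<k}" using S(1) Ct by (auto simp: F_def k_def)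
  moreover have "c < q ^ k * \<xi> - (\<Sum>i\<in>S \<union> C t. q ^ i)" "q ^ k * \<xi> - (\<Sum>i\<in>S \<union> C t. q ^ i) < d"
    using yt unfolding total \<rho>_def \<delta>_def by linarith+
  ultimately show ?thesis by blast
qed

section \<open>Codings of interior points\<close>

abbreviation word_map :: "real \<Rightarrow> (nat \<Rightarrow> real) \<Rightarrow> nat list \<Rightarrow> real \<Rightarrow> real" where
  "word_map lam p \<equiv> foldr (ifs_map lam p)"

lemma ifs_comp_eq_word_map: "ifs_comp lam p a j y = word_map lam p (map a [0..<j]) y"
  by (induction j arbitrary: y) auto

lemma word_map_affine: "word_map lam p w y = lam ^ length w * y + word_map lam p w 0"
  by (induction w) (auto simp: ifs_map_def algebra_simps)

lemma ifs_comp_zero_eq_sum: "ifs_comp lam p a j 0 = (1 - lam) * (\<Sum>k<j. lam ^ k * p (a k))"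
proof (induction j)
  case (Suc j)
  have "ifs_comp lam p a (Suc j) 0 = word_map lam p (map a [0..<j]) ((1 - lam) * p (a j))"
    by (simp add: ifs_comp_eq_word_map ifs_map_def)
  also have "\<dots> = lam ^ j * ((1 - lam) * p (a j)) + ifs_comp lam p a j 0"
    by (subst word_map_affine) (simp add: ifs_comp_eq_word_map)
  finally show ?case using Suc by (simp add: algebra_simps)
qed simp

text \<open>\<open>imin\<close> and \<open>imax\<close> mark the endpoints of the convex hull of the
  points. Since \<open>1 / 2 < lam\<close>, the images of the hull under these two maps overlap and
  cover it.\<close>

locale expanding_ifs =
  fixes n :: nat and p :: "nat \<Rightarrow> real" and lam :: real and imin imax :: nat
  assumes lam: "1 / 2 < lam" "lam < 1"
    and imin: "imin \<le> n" "\<And>i. i \<le> n \<Longrightarrow> p imin \<le> p i"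
    and imax: "imax \<le> n" "\<And>i. i \<le> n \<Longrightarrow> p i \<le> p imax"
    and nontrivial: "p imin < p imax"
begin

lemma ifs_map_mem:
  assumes "i \<le> n" "p imin \<le> y" "y \<le> p imax"
  shows "p imin \<le> ifs_map lam p i y" "ifs_map lam p i y \<le> p imax"
proof -
  have "lam * p imin + (1 - lam) * p imin \<le> lam * y + (1 - lam) * p i"
    using assms imin lam by (intro add_mono mult_left_mono) auto
  thus "p imin \<le> ifs_map lam p i y" by (simp add: ifs_map_def algebra_simps)
  have "lam * y + (1 - lam) * p i \<le> lam * p imax + (1 - lam) * p imax"
    using assms imax lam by (intro add_mono mult_left_mono) auto
  thus "ifs_map lam p i y \<le> p imax" by (simp add: ifs_map_def algebra_simps)
qed

lemma word_map_mem:
  assumes "set w \<subseteq> {..n}" "p imin \<le> y" "y \<le> p imax"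
  shows "p imin \<le> word_map lam p w y \<and> word_map lam p w y \<le> p imax"
  using assms by (induction w) (auto intro: ifs_map_mem)

text \<open>The extreme points of \<open>X\<close> are images of points of \<open>X\<close>, which
  confines them to the hull. Conversely each point of the hull has a preimage in the hull under an
  extreme map; after \<open>k\<close> such steps it is within \<open>lam^k * L\<close> of
  \<open>X\<close>, and \<open>X\<close> is closed.\<close>

lemma attractor_eq_interval:
  assumes X: "compact X" "X \<noteq> {}" "X = (\<Union>i\<le>n. ifs_map lam p i ` X)"
  shows "X = {p imin..p imax}"
proof
  show "X \<subseteq> {p imin..p imax}"
  proof -
    obtain s where s: "s \<in> X" "\<And>x. x \<in> X \<Longrightarrow> x \<le> s" using compact_attains_sup[OF X(1,2)] by blast
    obtain t where t: "t \<in> X" "\<And>x. x \<in> X \<Longrightarrow> t \<le> x" using compact_attains_inf[OF X(1,2)] by blast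
    obtain i x where i: "i \<le> n" "x \<in> X" "s = ifs_map lam p i x" using s(1) X(3) by blast
    have "lam * x + (1 - lam) * p i \<le> lam * s + (1 - lam) * p imax"
      using i s(2)[of x] imax(2)[of i] lam by (intro add_mono mult_left_mono) auto
    hence "s \<le> lam * s + (1 - lam) * p imax" using i by (simp add: ifs_map_def)
    hence "(1 - lam) * s \<le> (1 - lam) * p imax" by (simp add: algebra_simps)
    hence "s \<le> p imax" using lam by simp
    moreover obtain j y where j: "j \<le> n" "y \<in> X" "t = ifs_map lam p j y" using t(1) X(3) by blast
    have "lam * t + (1 - lam) * p imin \<le> lam * y + (1 - lam) * p j"
      using j t(2)[of y] imin(2)[of j] lam by (intro add_mono mult_left_mono) auto
    hence "lam * t + (1 - lam) * p imin \<le> t" using j by (simp add: ifs_map_def)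
    hence "(1 - lam) * p imin \<le> (1 - lam) * t" by (simp add: algebra_simps)
    hence "p imin \<le> t" using lam by simp
    ultimately show ?thesis using s t by force
  qed
  have ne: "\<exists>x. x \<in> X \<and> p imin \<le> x \<and> x \<le> p imax"
  proof -
    obtain x where "x \<in> X" using X(2) by blast
    moreover from this have "x \<in> {p imin..p imax}" using \<open>X \<subseteq> {p imin..p imax}\<close> by blast
    ultimately show ?thesis by auto
  qed
  define L where "L = p imax - p imin"
  have step: "\<exists>x'\<in>X. \<bar>x - x'\<bar> \<le> lam ^ k * L" if "p imin \<le> x" "x \<le> p imax" for k x
    using that
  proof (induction k arbitrary: x)
    case 0
    then show ?case using ne by (force simp: L_def abs_le_iff)
  next
    case (Suc k)
    have "\<exists>i\<le>n. \<exists>y. p imin \<le> y \<and> y \<le> p imax \<and> x = ifs_map lam p i y"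
    proof (cases "x \<le> lam * p imax + (1 - lam) * p imin")
      case True
      have "x \<ge> lam * p imin + (1 - lam) * p imin" using Suc.prems by (simp add: algebra_simps)
      thus ?thesis using True imin lam
        by (intro exI[of _ imin] conjI exI[of _ "(x - (1 - lam) * p imin) / lam"])
           (auto simp: ifs_map_def field_simps)
    next
      case False
      have "(2 * lam - 1) * p imin \<le> (2 * lam - 1) * p imax" using lam nontrivial by (intro mult_left_mono) auto
      hence "x \<ge> lam * p imin + (1 - lam) * p imax" using False by (simp add: algebra_simps)
      moreover have "x \<le> lam * p imax + (1 - lam) * p imax" using Suc.prems by (simp add: algebra_simps)
      ultimately show ?thesis using imax lam
        by (intro exI[of _ imax] conjI exI[of _ "(x - (1 - lam) * p imax) / lam"])
           (auto simp: ifs_map_def field_simps)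
    qed
    then obtain i y where iy: "i \<le> n" "p imin \<le> y" "y \<le> p imax" "x = ifs_map lam p i y" by blast
    obtain y' where y': "y' \<in> X" "\<bar>y - y'\<bar> \<le> lam ^ k * L" using Suc.IH iy by blast
    have "ifs_map lam p i y' \<in> X" using X(3) y' iy(1) by blast
    moreover have "\<bar>x - ifs_map lam p i y'\<bar> = lam * \<bar>y - y'\<bar>"
      using lam by (simp add: iy(4) ifs_map_def abs_mult flip: right_diff_distrib)
    moreover have "lam * \<bar>y - y'\<bar> \<le> lam * (lam ^ k * L)" using y' lam by (intro mult_left_mono) auto
    ultimately show ?case by (intro bexI[of _ "ifs_map lam p i y'"]) (auto simp: mult.assoc)
  qed
  show "{p imin..p imax} \<subseteq> X"
  proof
    fix x assume "x \<in> {p imin..p imax}"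
    hence x: "p imin \<le> x" "x \<le> p imax" by auto
    have "\<forall>e>0. \<exists>y\<in>X. dist y x < e"
    proof (intro allI impI)
      fix e :: real assume "e > 0"
      have L: "L > 0" using nontrivial by (simp add: L_def)
      obtain k where "lam ^ k < e / L" using real_arch_pow_inv[of "e / L" lam] lam L \<open>e > 0\<close> by auto
      hence "lam ^ k * L < e" using L by (simp add: field_simps)
      thus "\<exists>y\<in>X. dist y x < e" using step[OF x, of k] by (force simp: dist_real_def abs_minus_commute)
    qed
    hence "x \<in> closure X" by (simp add: closure_approachable)
    thus "x \<in> X" using X(1) by (simp add: compact_imp_closed)
  qed
qed

lemma coding_limit:
  assumes "\<And>k. a k \<le> n"
  shows "summable (\<lambda>k. lam ^ k * p (a k))" "(\<lambda>j. ifs_comp lam p a j 0) \<longlonglongrightarrow> coding lam p a"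
    "coding lam p a = (1 - lam) * (\<Sum>k. lam ^ k * p (a k))"
proof -
  define B where "B = max \<bar>p imin\<bar> \<bar>p imax\<bar>"
  have B: "\<bar>p (a k)\<bar> \<le> B" for k
    using imin(2)[OF assms[of k]] imax(2)[OF assms[of k]] by (auto simp: B_def abs_le_iff max_def)
  show sm: "summable (\<lambda>k. lam ^ k * p (a k))"
  proof (rule summable_comparison_test')
    show "summable (\<lambda>k. lam ^ k * B)" using lam by (intro summable_mult2 summable_geometric) auto
    show "norm (lam ^ k * p (a k)) \<le> lam ^ k * B" if "k \<ge> 0" for k
      using B[of k] lam by (auto simp: abs_mult intro!: mult_left_mono)
  qed
  have "(\<lambda>j. ifs_comp lam p a j 0) \<longlonglongrightarrow> (1 - lam) * (\<Sum>k. lam ^ k * p (a k))"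
    unfolding ifs_comp_zero_eq_sum by (intro tendsto_intros summable_LIMSEQ sm)
  thus "(\<lambda>j. ifs_comp lam p a j 0) \<longlonglongrightarrow> coding lam p a"
    "coding lam p a = (1 - lam) * (\<Sum>k. lam ^ k * p (a k))"
    unfolding coding_def by (simp_all add: limI)
qed

text \<open>Both \<open>imin\<close> and \<open>imax\<close> occur in a universal sequence, and one
  occurrence makes each inequality strict.\<close>

lemma coding_universal_mem:
  assumes a: "\<And>k. a k \<le> n" and u: "universal n a"
  shows "p imin < coding lam p a" "coding lam p a < p imax"
proof -
  have hit: "\<exists>k. a k = i" if i: "i \<le> n" for i
  proof -
    have "set [i] \<subseteq> {..n} \<longrightarrow> (\<exists>k. \<forall>j<length [i]. a (k + j) = [i] ! j)"
      using u unfolding universal_def by blast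
    then obtain k where "\<forall>j<length [i]. a (k + j) = [i] ! j" using i by auto
    hence "a k = i" by simp
    thus ?thesis by blast
  qed
  have geo: "(\<lambda>k. lam ^ k * c) sums (c / (1 - lam))" for c
    using sums_mult2[OF geometric_sums[of lam], of c] lam by simp
  note cl = coding_limit[of a, OF a]
  have "0 < (\<Sum>k. lam ^ k * p (a k) - lam ^ k * p imin)"
  proof -
    obtain k where "a k = imax" using hit imax(1) by blast
    hence "0 < lam ^ k * p (a k) - lam ^ k * p imin"
      using nontrivial lam by (simp flip: right_diff_distrib)
    thus ?thesis
      using imin(2)[OF a] lam
      by (intro suminf_pos2[of _ k] summable_diff cl(1) sums_summable[OF geo]) (simp_all flip: right_diff_distrib)
  qed
  also have "\<dots> = (\<Sum>k. lam ^ k * p (a k)) - p imin / (1 - lam)"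
    using suminf_diff[OF cl(1) sums_summable[OF geo[of "p imin"]]] sums_unique[OF geo[of "p imin"]] by linarith
  finally show "p imin < coding lam p a" using lam by (simp add: cl(3) field_simps)
  have "0 < (\<Sum>k. lam ^ k * p imax - lam ^ k * p (a k))"
  proof -
    obtain k where "a k = imin" using hit imin(1) by blast
    hence "0 < lam ^ k * p imax - lam ^ k * p (a k)"
      using nontrivial lam by (simp flip: right_diff_distrib)
    thus ?thesis
      using imax(2)[OF a] lam
      by (intro suminf_pos2[of _ k] summable_diff cl(1) sums_summable[OF geo]) (simp_all flip: right_diff_distrib)
  qed
  also have "\<dots> = p imax / (1 - lam) - (\<Sum>k. lam ^ k * p (a k))"
    using suminf_diff[OF sums_summable[OF geo[of "p imax"]] cl(1)] sums_unique[OF geo[of "p imax"]] by linarith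
  finally show "coding lam p a < p imax" using lam by (simp add: cl(3) field_simps)
qed

text \<open>In the coordinate \<open>p imin + G * \<xi>\<close> the inverses of the extreme maps are
  multiplication of \<xi> by \<open>1 / lam\<close>, followed by subtracting 0 or 1. The word is
  reversed because the digit removed first ends up with the highest power.\<close>

lemma binary_word_map:
  fixes S :: "nat set"
  defines "G \<equiv> (p imax - p imin) * (1 / lam - 1)"
  shows "word_map lam p (map (\<lambda>i. if i \<in> S then imax else imin) (rev [0..<k]))
      (p imin + G * ((1 / lam) ^ k * \<xi> - (\<Sum>i\<in>{i\<in>S. i < k}. (1 / lam) ^ i))) = p imin + G * \<xi>"
proof (induction k arbitrary: \<xi>)
  case (Suc k)
  let ?q = "1 / lam"
  define e where "e = (if k \<in> S then 1 else 0 :: real)"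
  have lq: "lam * ?q = 1" using lam by simp
  have "{i\<in>S. i < Suc k} = (if k \<in> S then insert k {i\<in>S. i < k} else {i\<in>S. i < k})"
    by (auto simp: less_Suc_eq)
  hence "(\<Sum>i\<in>{i\<in>S. i < Suc k}. ?q ^ i) = e * ?q ^ k + (\<Sum>i\<in>{i\<in>S. i < k}. ?q ^ i)"
    by (simp add: e_def)
  hence eq: "?q ^ Suc k * \<xi> - (\<Sum>i\<in>{i\<in>S. i < Suc k}. ?q ^ i)
      = ?q ^ k * (?q * \<xi> - e) - (\<Sum>i\<in>{i\<in>S. i < k}. ?q ^ i)"
    by (simp add: algebra_simps)
  have p_eq: "p (if k \<in> S then imax else imin) = p imin + e * (p imax - p imin)" by (simp add: e_def)
  have G: "lam * G = (1 - lam) * (p imax - p imin)"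
    using lam unfolding G_def by (simp add: field_simps)
  have "word_map lam p (map (\<lambda>i. if i \<in> S then imax else imin) (rev [0..<Suc k]))
      (p imin + G * (?q ^ Suc k * \<xi> - (\<Sum>i\<in>{i\<in>S. i < Suc k}. ?q ^ i)))
    = ifs_map lam p (if k \<in> S then imax else imin) (p imin + G * (?q * \<xi> - e))"
    unfolding eq using Suc.IH[of "?q * \<xi> - e"] by simp
  also have "\<dots> = lam * p imin + (lam * ?q) * (G * \<xi>) - e * (lam * G) + (1 - lam) * p imin + e * ((1 - lam) * (p imax - p imin))"
    unfolding ifs_map_def p_eq by (simp add: algebra_simps)
  also have "\<dots> = p imin + G * \<xi>" unfolding lq G by (simp add: algebra_simps)
  finally show ?case .
qed simp

text \<open>The conclusion of \<open>dense_orbit\<close> at \<open>q = 1 / lam\<close> enters as a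
  hypothesis, separating the coding argument from the arithmetic of \<open>lam\<close>.\<close>

context
  assumes dense: "\<And>\<xi> c d. 0 < \<xi> \<Longrightarrow> \<xi> < 1 / (1 / lam - 1) \<Longrightarrow> 0 \<le> c \<Longrightarrow> c < d \<Longrightarrow>
    \<exists>k. \<exists>S\<subseteq>{..<k}. c < (1 / lam) ^ k * \<xi> - (\<Sum>i\<in>S. (1 / lam) ^ i) \<and>
      (1 / lam) ^ k * \<xi> - (\<Sum>i\<in>S. (1 / lam) ^ i) < d"
begin

text \<open>Density is applied to the image of the hull under \<open>w\<close>: some preimage of
  \<open>x\<close> along extreme maps falls strictly inside it. Hence \<open>y\<close> is again
  interior and the construction can be repeated.\<close>

lemma prepend_word:
  assumes x: "p imin < x" "x < p imax" and w: "set w \<subseteq> {..n}"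
  shows "\<exists>u y. set u \<subseteq> {..n} \<and> p imin < y \<and> y < p imax \<and> x = word_map lam p (u @ w) y"
proof -
  define G where "G = (p imax - p imin) * (1 / lam - 1)"
  have G0: "G > 0" using nontrivial lam by (simp add: G_def)
  define lo hi where "lo = word_map lam p w (p imin)" and "hi = word_map lam p w (p imax)"
  have lp: "lam ^ length w > 0" using lam by simp
  have "hi - lo = lam ^ length w * (p imax - p imin)"
    unfolding hi_def lo_def
    using word_map_affine[of lam p w "p imax"] word_map_affine[of lam p w "p imin"] by (simp add: algebra_simps)
  moreover have "lam ^ length w * (p imax - p imin) > 0" using lp nontrivial by simp
  ultimately have lohi: "lo < hi" by linarith
  have lo: "p imin \<le> lo" using word_map_mem[OF w] nontrivial by (simp add: lo_def)
  define \<xi> where "\<xi> = (x - p imin) / G"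
  have "\<xi> < (p imax - p imin) / G" unfolding \<xi>_def using x G0 by (intro divide_strict_right_mono) auto
  also have "\<dots> = 1 / (1 / lam - 1)" using nontrivial by (simp add: G_def)
  finally have \<xi>1: "\<xi> < 1 / (1 / lam - 1)" .
  have \<xi>0: "0 < \<xi>" using x G0 by (simp add: \<xi>_def)
  have "0 \<le> (lo - p imin) / G" "(lo - p imin) / G < (hi - p imin) / G"
    using lo lohi G0 by (auto intro: divide_strict_right_mono)
  from dense[OF \<xi>0 \<xi>1 this] obtain k S where S: "S \<subseteq> {..<k}"
    and v: "(lo - p imin) / G < (1 / lam) ^ k * \<xi> - (\<Sum>i\<in>S. (1 / lam) ^ i)"
      "(1 / lam) ^ k * \<xi> - (\<Sum>i\<in>S. (1 / lam) ^ i) < (hi - p imin) / G" by blast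
  define y' where "y' = p imin + G * ((1 / lam) ^ k * \<xi> - (\<Sum>i\<in>S. (1 / lam) ^ i))"
  have y': "lo < y'" "y' < hi" using v G0 by (auto simp: y'_def field_simps)
  define u where "u = map (\<lambda>i. if i \<in> S then imax else imin) (rev [0..<k])"
  have "{i\<in>S. i < k} = S" using S by auto
  hence "word_map lam p u y' = p imin + G * \<xi>"
    using binary_word_map[of S k \<xi>] by (simp add: u_def y'_def G_def)
  also have "\<dots> = x" using G0 by (simp add: \<xi>_def)
  finally have ux: "word_map lam p u y' = x" .
  define t where "t = word_map lam p w 0"
  define y where "y = (y' - t) / lam ^ length w"
  have wy: "word_map lam p w y = y'"
    by (subst word_map_affine) (use lam in \<open>simp add: y_def t_def\<close>)
  have "lo = lam ^ length w * p imin + t" "hi = lam ^ length w * p imax + t"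
    unfolding lo_def hi_def t_def by (rule word_map_affine)+
  hence "p imin < y" "y < p imax" using y' lp by (auto simp: y_def field_simps)
  moreover have "set u \<subseteq> {..n}" using imin(1) imax(1) by (auto simp: u_def)
  ultimately show ?thesis using ux wy by (intro exI[of _ u] exI[of _ y]) auto
qed

text \<open>All words are enumerated and inserted one after the other by
  \<open>prepend_word\<close>. The nested prefixes determine a sequence, and its coding is
  \<open>x\<close> because the images of the hull along the prefixes shrink to
  \<open>x\<close>.\<close>

lemma exists_universal_coding:
  assumes x: "p imin < x" "x < p imax"
  shows "\<exists>a. (\<forall>k. a k \<le> n) \<and> universal n a \<and> coding lam p a = x"
proof -
  \<comment> \<open>Codes of words with a letter above \<open>n\<close> stand for the empty word, so
    that every \<open>W i\<close> is admissible.\<close>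
  define W where "W = (\<lambda>i. if set (from_nat i :: nat list) \<subseteq> {..n} then from_nat i else [] :: nat list)"
  have W: "set (W i) \<subseteq> {..n}" for i by (auto simp: W_def)
  \<comment> \<open>The trailing letter 0 makes the lengths grow even if \<open>u\<close> and
    \<open>W i\<close> are empty.\<close>
  have "\<exists>f. \<forall>i. (set (f i) \<subseteq> {..n} \<and> (\<exists>y. p imin < y \<and> y < p imax \<and> x = word_map lam p (f i) y))
      \<and> (\<exists>u. f (Suc i) = f i @ u @ W i @ [0])"
  proof (rule dependent_nat_choice)
    show "\<exists>l. set l \<subseteq> {..n} \<and> (\<exists>y. p imin < y \<and> y < p imax \<and> x = word_map lam p l y)"
      using x by (intro exI[of _ "[]"]) auto
  next
    fix l i assume l: "set l \<subseteq> {..n} \<and> (\<exists>y. p imin < y \<and> y < p imax \<and> x = word_map lam p l y)"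
    then obtain y where y: "p imin < y" "y < p imax" "x = word_map lam p l y" by blast
    have "set (W i @ [0]) \<subseteq> {..n}" using W by simp
    from prepend_word[OF y(1,2) this] obtain u y' where
      u: "set u \<subseteq> {..n}" "p imin < y'" "y' < p imax" "y = word_map lam p (u @ W i @ [0]) y'" by blast
    show "\<exists>l'. (set l' \<subseteq> {..n} \<and> (\<exists>y. p imin < y \<and> y < p imax \<and> x = word_map lam p l' y))
      \<and> (\<exists>u. l' = l @ u @ W i @ [0])"
      using l u y W[of i] by (intro exI[of _ "l @ u @ W i @ [0]"]) auto
  qed
  then obtain f where f: "\<And>i. set (f i) \<subseteq> {..n}"
      "\<And>i. \<exists>y. p imin < y \<and> y < p imax \<and> x = word_map lam p (f i) y"
      "\<And>i. \<exists>u. f (Suc i) = f i @ u @ W i @ [0]" by blast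
  have len: "strict_mono (\<lambda>i. length (f i))"
    unfolding strict_mono_Suc_iff
  proof
    fix i show "length (f i) < length (f (Suc i))" using f(3)[of i] by auto
  qed
  have prefix: "\<exists>v. f j = f i @ v" if "i \<le> j" for i j
    using that
  proof (induction j rule: dec_induct)
    case (step j)
    then show ?case using f(3)[of j] by auto
  qed simp
  have len_ge: "k \<le> length (f k)" for k using strict_mono_imp_increasing[OF len, of k] .
  define a where "a = (\<lambda>k. f (Suc k) ! k)"
  have a_eq: "a k = f i ! k" if "k < length (f i)" for i k
  proof (cases "i \<le> Suc k")
    case True
    then obtain v where "f (Suc k) = f i @ v" using prefix by blast
    thus ?thesis using that by (simp add: a_def nth_append)
  next
    case False
    then obtain v where "f i = f (Suc k) @ v" using prefix[of "Suc k" i] by auto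
    moreover have "k < length (f (Suc k))" using len_ge[of "Suc k"] by simp
    ultimately show ?thesis by (simp add: a_def nth_append)
  qed
  have a_le: "a k \<le> n" for k
  proof -
    have "k < length (f (Suc k))" using len_ge[of "Suc k"] by simp
    hence "a k \<in> set (f (Suc k))" by (simp add: a_def)
    thus ?thesis using f(1) by blast
  qed
  have "universal n a"
    unfolding universal_def
  proof (intro allI impI)
    fix w :: "nat list" assume w: "set w \<subseteq> {..n}"
    define i where "i = to_nat w"
    have Wi: "W i = w" using w by (simp add: W_def i_def)
    obtain u where u: "f (Suc i) = f i @ u @ w @ [0]" using f(3)[of i] Wi by auto
    have "a (length (f i) + length u + j) = w ! j" if "j < length w" for j
    proof -
      have "a (length (f i) + length u + j) = f (Suc i) ! (length (f i) + length u + j)"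
        using that by (intro a_eq) (simp add: u)
      thus ?thesis using that by (simp add: u nth_append)
    qed
    thus "\<exists>k. \<forall>i<length w. a (k + i) = w ! i" by blast
  qed
  moreover have "coding lam p a = x"
  proof -
    have word: "map a [0..<length (f i)] = f i" for i
      by (rule nth_equalityI) (auto simp: a_eq)
    define B where "B = max \<bar>p imin\<bar> \<bar>p imax\<bar>"
    have close: "norm (ifs_comp lam p a (length (f i)) 0 - x) \<le> lam ^ i * B" for i
    proof -
      obtain y where y: "p imin < y" "y < p imax" "x = word_map lam p (f i) y" using f(2) by blast
      have "\<bar>y\<bar> \<le> B" using y by (auto simp: B_def abs_le_iff max_def)
      moreover have "ifs_comp lam p a (length (f i)) 0 - x = - (lam ^ length (f i) * y)"
        unfolding ifs_comp_eq_word_map word using y(3) word_map_affine[of lam p "f i" y] by simp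
      moreover have "lam ^ length (f i) \<le> lam ^ i" using lam len_ge[of i] by (intro power_decreasing) auto
      ultimately show ?thesis using lam by (auto simp: abs_mult intro!: mult_mono)
    qed
    have "(\<lambda>i. lam ^ i * B) \<longlonglongrightarrow> 0 * B"
      using lam by (intro tendsto_mult LIMSEQ_power_zero tendsto_const) auto
    hence "(\<lambda>i. ifs_comp lam p a (length (f i)) 0 - x) \<longlonglongrightarrow> 0"
      using close by (intro Lim_null_comparison[of "\<lambda>i. ifs_comp lam p a (length (f i)) 0 - x" "\<lambda>i. lam ^ i * B"]) auto
    hence "(\<lambda>i. ifs_comp lam p a (length (f i)) 0) \<longlonglongrightarrow> x" by (simp add: LIM_zero_iff)
    moreover have "(\<lambda>i. ifs_comp lam p a (length (f i)) 0) \<longlonglongrightarrow> coding lam p a"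
      using LIMSEQ_subseq_LIMSEQ[OF coding_limit(2)[of a, OF a_le] len] by (simp add: o_def)
    ultimately show ?thesis using LIMSEQ_unique by blast
  qed
  ultimately show ?thesis using a_le by blast
qed

lemma interior_eq_X_uni_of_dense:
  assumes X: "compact X" "X \<noteq> {}" "X = (\<Union>i\<le>n. ifs_map lam p i ` X)"
  shows "interior X = X_uni n lam p X"
proof -
  have X_eq: "X = {p imin..p imax}" using attractor_eq_interval[OF X] .
  have "X_uni n lam p X = {p imin<..<p imax}"
  proof
    show "X_uni n lam p X \<subseteq> {p imin<..<p imax}"
      unfolding X_uni_def using coding_universal_mem by auto
    show "{p imin<..<p imax} \<subseteq> X_uni n lam p X"
      unfolding X_uni_def using exists_universal_coding by (auto simp: X_eq)
  qed
  thus ?thesis unfolding X_eq by (simp add: interior_atLeastAtMost_real)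
qed

end
end

section \<open>A lower bound for Pisot numbers\<close>

lemma root_of_unity_orthogonality:
  fixes M n m :: nat
  assumes "n < M" "m < M"
  defines "z \<equiv> \<lambda>k. cis (2 * pi * real k / real M)"
  shows "(\<Sum>k<M. z k ^ n * cnj (z k ^ m)) = (if n = m then of_nat M else 0)"
proof -
  have M: "M > 0" using assms by simp
  define t where "t = cis (2 * pi * (real n - real m) / real M)"
  have trm: "z k ^ n * cnj (z k ^ m) = t ^ k" for k
  proof -
    have "z k ^ n * cnj (z k ^ m) = cis (real n * (2 * pi * real k / real M) + - (real m * (2 * pi * real k / real M)))"
      unfolding z_def Complex.DeMoivre cis_cnj cis_mult ..
    also have "\<dots> = cis (real k * (2 * pi * (real n - real m) / real M))"
      by (rule arg_cong[of _ _ cis]) (simp add: algebra_simps diff_divide_distrib)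
    finally show ?thesis unfolding t_def Complex.DeMoivre .
  qed
  show ?thesis
  proof (cases "n = m")
    case True
    thus ?thesis unfolding trm by (simp add: t_def)
  next
    case False
    have "t \<noteq> 1"
    proof
      assume "t = 1"
      hence "cos (2 * pi * (real n - real m) / real M) = 1" by (simp add: t_def complex_eq_iff)
      then obtain x :: int where "2 * pi * (real n - real m) / real M = of_int x * 2 * pi"
        using cos_one_2pi_int by blast
      hence "2 * pi * (real n - real m) = 2 * pi * (of_int x * real M)" using M by (simp add: field_simps)
      hence "real n - real m = of_int x * real M" by (simp only: mult_cancel_left) simp
      hence "of_int (int n - int m) = (of_int (x * int M) :: real)" by simp
      hence e: "int n - int m = x * int M" by (simp only: of_int_eq_iff)
      moreover have "\<bar>int n - int m\<bar> < int M" using assms(1,2) by linarith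
      ultimately have "\<bar>x\<bar> * int M < 1 * int M" by (simp add: abs_mult)
      hence "x = 0" using M by (simp add: mult_less_cancel_right)
      thus False using e False by simp
    qed
    moreover have "t ^ M = 1"
    proof -
      have "t ^ M = cis (2 * pi * of_int (int n - int m))"
        unfolding t_def Complex.DeMoivre using M by simp
      also have "\<dots> = 1" by (rule cis_multiple_2pi) simp
      finally show ?thesis .
    qed
    ultimately show ?thesis unfolding trm using False by (simp add: geometric_sum)
  qed
qed

text \<open>The mean over the \<open>M\<close>-th roots of unity replaces the integral over the
  circle; it is exact as long as there are at most \<open>M\<close> coefficients.\<close>

lemma discrete_parseval:
  fixes b :: "nat \<Rightarrow> real" and L M :: nat
  assumes "L \<le> M"
  defines "z \<equiv> \<lambda>k. cis (2 * pi * real k / real M)"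
  shows "(\<Sum>k<M. (norm (\<Sum>n<L. of_real (b n) * z k ^ n))\<^sup>2) = real M * (\<Sum>n<L. (b n)\<^sup>2)"
proof -
  have "of_real (\<Sum>k<M. (norm (\<Sum>n<L. of_real (b n) * z k ^ n))\<^sup>2)
      = (\<Sum>k<M. (\<Sum>n<L. of_real (b n) * z k ^ n) * cnj (\<Sum>n<L. of_real (b n) * z k ^ n))"
    unfolding of_real_sum by (intro sum.cong refl) (simp only: complex_norm_square)
  also have "\<dots> = (\<Sum>k<M. \<Sum>n<L. \<Sum>m<L. of_real (b n * b m) * (z k ^ n * cnj (z k ^ m)))"
    unfolding cnj_sum sum_product by (intro sum.cong refl) (simp add: mult_ac)
  also have "\<dots> = (\<Sum>n<L. \<Sum>m<L. of_real (b n * b m) * (\<Sum>k<M. z k ^ n * cnj (z k ^ m)))"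
    unfolding sum_distrib_left by (rule trans[OF sum.swap sum.cong[OF refl sum.swap]])
  also have "\<dots> = (\<Sum>n<L. \<Sum>m<L. if n = m then of_real (b n * b m) * of_nat M else 0)"
  proof (intro sum.cong refl)
    fix n m assume "n \<in> {..<L}" "m \<in> {..<L}"
    hence "n < M" "m < M" using assms(1) by auto
    thus "of_real (b n * b m) * (\<Sum>k<M. z k ^ n * cnj (z k ^ m)) = (if n = m then of_real (b n * b m) * of_nat M else 0 :: complex)"
      unfolding z_def root_of_unity_orthogonality[OF \<open>n < M\<close> \<open>m < M\<close>] by simp
  qed
  also have "\<dots> = (\<Sum>n<L. of_real (b n * b n) * of_nat M)"
    by (intro sum.cong refl) (simp add: sum.delta)
  also have "\<dots> = of_real (real M * (\<Sum>n<L. (b n)\<^sup>2))"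
    by (simp add: sum_distrib_left power2_eq_square mult_ac)
  finally show ?thesis by (simp only: of_real_eq_iff)
qed

text \<open>The series is cut off at \<open>L\<close> terms and averaged over the
  \<open>L\<close>-th roots of unity. The tail \<epsilon> tends to 0, and \<open>1 - q z\<close> has
  mean square \<open>1 + q^2\<close>.\<close>

lemma parseval_bound:
  fixes b :: "nat \<Rightarrow> real" and q :: real
  assumes sm: "summable (\<lambda>n. \<bar>b n\<bar>)"
    and bound: "\<And>z :: complex. norm z = 1 \<Longrightarrow> norm (\<Sum>n. of_real (b n) * z ^ n) = norm (1 - of_real q * z)"
  shows "(\<Sum>n<N. (b n)\<^sup>2) \<le> 1 + q\<^sup>2"
proof -
  define \<epsilon> where "\<epsilon> = (\<lambda>L. \<Sum>n. \<bar>b (n + L)\<bar>)"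
  have \<epsilon>0: "\<epsilon> L \<ge> 0" for L
    unfolding \<epsilon>_def by (intro suminf_nonneg summable_ignore_initial_segment[OF sm]) auto
  have bd: "(\<Sum>n<L. (b n)\<^sup>2) \<le> 1 + q\<^sup>2 + 2 * \<epsilon> L * (1 + \<bar>q\<bar>) + (\<epsilon> L)\<^sup>2" if "L \<ge> 2" for L
  proof -
    define z where "z = (\<lambda>k. cis (2 * pi * real k / real L))"
    have nz: "norm (z k) = 1" for k by (simp add: z_def)
    have L0: "real L > 0" using that by simp
    have pt: "norm (\<Sum>n<L. of_real (b n) * z k ^ n) \<le> norm (1 - of_real q * z k) + \<epsilon> L" for k
    proof -
      have s1: "summable (\<lambda>n. norm (of_real (b n) * z k ^ n))"
        using sm by (simp add: norm_mult norm_power nz)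
      hence s2: "summable (\<lambda>n. of_real (b n) * z k ^ n)" by (rule summable_norm_cancel)
      have "(\<Sum>n<L. of_real (b n) * z k ^ n) = (\<Sum>n. of_real (b n) * z k ^ n) - (\<Sum>n. of_real (b (n + L)) * z k ^ (n + L))"
        using suminf_split_initial_segment[OF s2, of L] by simp
      hence "norm (\<Sum>n<L. of_real (b n) * z k ^ n)
          \<le> norm (\<Sum>n. of_real (b n) * z k ^ n) + norm (\<Sum>n. of_real (b (n + L)) * z k ^ (n + L))"
        by (metis norm_triangle_ineq4)
      moreover have "norm (\<Sum>n. of_real (b (n + L)) * z k ^ (n + L)) \<le> \<epsilon> L"
      proof -
        have "norm (\<Sum>n. of_real (b (n + L)) * z k ^ (n + L)) \<le> (\<Sum>n. norm (of_real (b (n + L)) * z k ^ (n + L)))"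
          using summable_ignore_initial_segment[OF s1, of L] by (intro summable_norm)
        also have "\<dots> = \<epsilon> L" by (simp add: \<epsilon>_def norm_mult norm_power nz)
        finally show ?thesis .
      qed
      ultimately show ?thesis using bound[OF nz[of k]] by linarith
    qed
    have sq: "(norm (\<Sum>n<L. of_real (b n) * z k ^ n))\<^sup>2
        \<le> (norm (1 - of_real q * z k))\<^sup>2 + (2 * \<epsilon> L * (1 + \<bar>q\<bar>) + (\<epsilon> L)\<^sup>2)" for k
    proof -
      have "norm (1 - of_real q * z k) \<le> 1 + \<bar>q\<bar>"
        using norm_triangle_ineq4[of 1 "of_real q * z k"] by (simp add: norm_mult nz)
      hence "2 * \<epsilon> L * norm (1 - of_real q * z k) \<le> 2 * \<epsilon> L * (1 + \<bar>q\<bar>)"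
        using \<epsilon>0 by (intro mult_left_mono) auto
      moreover have "(norm (\<Sum>n<L. of_real (b n) * z k ^ n))\<^sup>2 \<le> (norm (1 - of_real q * z k) + \<epsilon> L)\<^sup>2"
        using pt by (intro power_mono) auto
      ultimately show ?thesis by (simp add: power2_sum algebra_simps)
    qed
    have two: "(\<Sum>k<L. (norm (1 - of_real q * z k))\<^sup>2) = real L * (1 + q\<^sup>2)"
      using discrete_parseval[OF that, of "\<lambda>n. if n = 0 then 1 else - q"] unfolding z_def
      by (simp add: numeral_2_eq_2 lessThan_Suc)
    have "real L * (\<Sum>n<L. (b n)\<^sup>2) = (\<Sum>k<L. (norm (\<Sum>n<L. of_real (b n) * z k ^ n))\<^sup>2)"
      unfolding z_def by (rule discrete_parseval[symmetric]) simp
    also have "\<dots> \<le> (\<Sum>k<L. (norm (1 - of_real q * z k))\<^sup>2 + (2 * \<epsilon> L * (1 + \<bar>q\<bar>) + (\<epsilon> L)\<^sup>2))"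
      by (intro sum_mono sq)
    also have "\<dots> = real L * (1 + q\<^sup>2 + 2 * \<epsilon> L * (1 + \<bar>q\<bar>) + (\<epsilon> L)\<^sup>2)"
      by (simp add: sum.distrib two algebra_simps)
    finally show ?thesis using L0 by (simp only: mult_le_cancel_left_pos)
  qed
  have \<epsilon>_lim: "\<epsilon> \<longlonglongrightarrow> 0"
    unfolding \<epsilon>_def using suminf_exist_split2[OF sm] by simp
  have lim: "(\<lambda>L. 1 + q\<^sup>2 + 2 * \<epsilon> L * (1 + \<bar>q\<bar>) + (\<epsilon> L)\<^sup>2) \<longlonglongrightarrow> 1 + q\<^sup>2 + 2 * 0 * (1 + \<bar>q\<bar>) + 0\<^sup>2"
    by (intro tendsto_intros \<epsilon>_lim)
  have "\<forall>\<^sub>F L in sequentially. (\<Sum>n<N. (b n)\<^sup>2) \<le> 1 + q\<^sup>2 + 2 * \<epsilon> L * (1 + \<bar>q\<bar>) + (\<epsilon> L)\<^sup>2"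
    using eventually_ge_at_top[of "max 2 N"]
  proof eventually_elim
    case (elim L)
    have "(\<Sum>n<N. (b n)\<^sup>2) \<le> (\<Sum>n<L. (b n)\<^sup>2)" using elim by (intro sum_mono2) auto
    thus ?case using bd[of L] elim by auto
  qed
  hence "(\<Sum>n<N. (b n)\<^sup>2) \<le> 1 + q\<^sup>2 + 2 * 0 * (1 + \<bar>q\<bar>) + 0\<^sup>2"
    by (intro tendsto_lowerbound[OF lim]) auto
  thus ?thesis by simp
qed

text \<open>The costs of the steps \<open>1 \<rightarrow> 2\<close>, \<open>2 \<rightarrow> 3\<close>, \<open>3 \<rightarrow> 4\<close> add up to more than the budget \<open>q\<^sup>2\<close>, every
  other change of value is too expensive as well, and remaining at the same value has a fixed cost.\<close>

lemma small_base_integer_sequence: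
  fixes a :: "nat \<Rightarrow> int" and q :: real
  assumes q: "1 < q" "q < 1.152" and a0: "a 0 = 1"
    and budget: "\<And>N. (\<Sum>n<N. (of_int (a (Suc n)) - q * of_int (a n))\<^sup>2) \<le> q\<^sup>2"
  shows "\<forall>n\<ge>1. a n = 0"
proof -
  define e where "e = (\<lambda>n. (of_int (a (Suc n)) - q * of_int (a n) :: real)\<^sup>2)"
  define c where "c = (\<lambda>N. \<Sum>n<N. e n)"
  have cS: "c (Suc N) = c N + e N" for N by (simp add: c_def)
  have c_le: "c N \<le> q\<^sup>2" for N using budget[of N] by (simp add: c_def e_def)
  have e0: "e n \<ge> 0" for n by (simp add: e_def)
  have c_mono: "c M \<le> c N" if "M \<le> N" for M N
    unfolding c_def using that e0 by (intro sum_mono2) auto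
  have c0: "c N \<ge> 0" for N unfolding c_def by (intro sum_nonneg e0)
  have qsq: "q\<^sup>2 < 1.328" using power_strict_mono[OF q(2), of 2] q by (simp add: power2_eq_square)
  have sq: "(of_int k - q * x)\<^sup>2 \<ge> y\<^sup>2" if "of_int k - q * x \<ge> y \<or> q * x - of_int k \<ge> y" "y \<ge> 0" for k :: int and x y :: real
    unfolding abs_le_square_iff[symmetric] using that by auto
  show ?thesis
  proof (cases "a 1 = 0")
    case True
    \<comment> \<open>The first step exhausts the budget, so all later costs are 0 and the zeros
      persist.\<close>
    have e1: "e 0 = q\<^sup>2" using True a0 by (simp add: e_def)
    have "a (Suc n) = 0" for n
    proof (induction n)
      case (Suc n)
      have "c (Suc (Suc n)) \<ge> c (Suc n)" "c (Suc n) \<ge> c 1" by (intro c_mono; simp)+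
      moreover have "c 1 = q\<^sup>2" using cS[of 0] e1 by (simp add: c_def)
      ultimately have "e (Suc n) = 0" using cS[of "Suc n"] c_le[of "Suc (Suc n)"] e0[of "Suc n"] by linarith
      thus ?case using Suc by (simp add: e_def)
    qed (use True in simp)
    thus ?thesis by (metis One_nat_def Suc_le_D)
  next
    case False
    \<comment> \<open>A lower bound for the cost of every admissible step: staying at 1, 2 or 3
      costs at least \<open>(q - 1)^2\<close>, an admissible move more than 0.2.\<close>
    define \<mu> where "\<mu> = min ((q - 1)\<^sup>2) 0.2"
    have \<mu>: "\<mu> > 0" using q by (simp add: \<mu>_def)
    \<comment> \<open>The moves 1 to 2 and 2 to 3 cost at least \<open>0.848^2 > 0.719\<close> and
      \<open>0.696^2 > 0.484\<close>, and \<open>0.719 + 0.484 = 1.203\<close>. Positivity of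
      \<open>c n\<close> for \<open>n > 0\<close> rules out a later fall from 1 to 0, which alone
      costs \<open>q^2\<close>.\<close>
    have inv: "(a n = 1 \<and> (n \<noteq> 0 \<longrightarrow> c n > 0) \<or> a n = 2 \<and> c n \<ge> 0.719 \<or> a n = 3 \<and> c n \<ge> 1.203) \<and> c n \<ge> real n * \<mu>" for n
    proof (induction n)
      case 0
      thus ?case using a0 by (simp add: c_def)
    next
      case (Suc n)
      define k where "k = a (Suc n)"
      note le = c_le[of "Suc n", unfolded cS]
      have en: "e n = (of_int k - q * of_int (a n))\<^sup>2" by (simp add: e_def k_def)
      consider "a n = 1" "n \<noteq> 0 \<longrightarrow> c n > 0" | "a n = 2" "c n \<ge> 0.719" | "a n = 3" "c n \<ge> 1.203" using Suc by blast
      hence "(k = 1 \<or> k = 2 \<and> c (Suc n) \<ge> 0.719 \<or> k = 3 \<and> c (Suc n) \<ge> 1.203) \<and> e n \<ge> \<mu>"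
      proof cases
        case 1
        note en = en[unfolded 1(1)]
        have "\<not> k \<le> -1"
        proof
          assume "k \<le> -1"
          hence "e n \<ge> 2\<^sup>2" unfolding en using q by (intro sq) auto
          thus False using le c0[of n] qsq by simp
        qed
        moreover have "k \<noteq> 0"
        proof
          assume k: "k = 0"
          hence "e n = q\<^sup>2" by (simp add: en)
          hence "\<not> c n > 0" using le by simp
          hence "n = 0" using 1(2) by blast
          thus False using k False by (simp add: k_def)
        qed
        moreover have "\<not> k \<ge> 3"
        proof
          assume "k \<ge> 3"
          hence "e n \<ge> 1.8\<^sup>2" unfolding en using q by (intro sq) auto
          thus False using le c0[of n] qsq by (simp add: power2_eq_square)
        qed
        ultimately have "k = 1 \<or> k = 2" by linarith
        thus ?thesis
        proof
          assume k: "k = 1"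
          have "e n \<ge> (q - 1)\<^sup>2" unfolding en k using q by (intro sq) auto
          thus ?thesis using k by (simp add: \<mu>_def)
        next
          assume k: "k = 2"
          have "e n \<ge> 0.848\<^sup>2" unfolding en k using q by (intro sq) auto
          hence "e n \<ge> 0.719" by (simp add: power2_eq_square)
          moreover from this have "e n \<ge> \<mu>" by (simp add: \<mu>_def)
          ultimately show ?thesis using k c0[of n] by (simp add: cS)
        qed
      next
        case 2
        note en = en[unfolded 2(1)]
        have "\<not> k \<le> 1"
        proof
          assume "k \<le> 1"
          hence "e n \<ge> 1\<^sup>2" unfolding en using q by (intro sq) auto
          thus False using le 2 qsq by simp
        qed
        moreover have "\<not> k \<ge> 4"
        proof
          assume "k \<ge> 4"
          hence "e n \<ge> 1.6\<^sup>2" unfolding en using q by (intro sq) auto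
          thus False using le 2 qsq by (simp add: power2_eq_square)
        qed
        ultimately have "k = 2 \<or> k = 3" by linarith
        thus ?thesis
        proof
          assume k: "k = 2"
          have "e n \<ge> (q - 1)\<^sup>2" unfolding en k using q by (intro sq) auto
          thus ?thesis using k 2 e0[of n] by (simp add: \<mu>_def cS)
        next
          assume k: "k = 3"
          have "e n \<ge> 0.696\<^sup>2" unfolding en k using q by (intro sq) auto
          hence "e n \<ge> 0.484" by (simp add: power2_eq_square)
          moreover from this have "e n \<ge> \<mu>" by (simp add: \<mu>_def)
          ultimately show ?thesis using k 2 by (simp add: cS)
        qed
      next
        case 3
        note en = en[unfolded 3(1)]
        have "\<not> k \<le> 2"
        proof
          assume "k \<le> 2"
          hence "e n \<ge> 1\<^sup>2" unfolding en using q by (intro sq) auto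
          thus False using le 3 qsq by simp
        qed
        moreover have "\<not> k \<ge> 4"
        proof
          assume "k \<ge> 4"
          hence "e n \<ge> 0.54\<^sup>2" unfolding en using q by (intro sq) auto
          thus False using le 3 qsq by (simp add: power2_eq_square)
        qed
        ultimately have k: "k = 3" by linarith
        have "e n \<ge> (q - 1)\<^sup>2" unfolding en k using q by (intro sq) auto
        thus ?thesis using k 3 e0[of n] by (simp add: \<mu>_def cS)
      qed
      moreover have "c (Suc n) \<ge> real (Suc n) * \<mu>" if "e n \<ge> \<mu>"
        using that Suc by (simp add: cS algebra_simps)
      moreover have "c (Suc n) > 0" if "e n \<ge> \<mu>" using that \<mu> c0[of n] by (simp add: cS)
      ultimately show ?case by (auto simp: k_def)
    qed
    obtain N :: nat where "q\<^sup>2 / \<mu> < real N" using reals_Archimedean2 by blast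
    hence "q\<^sup>2 < real N * \<mu>" using \<mu> by (simp add: field_simps)
    thus ?thesis using inv[of N] c_le[of N] by linarith
  qed
qed

section \<open>Powers of Pisot numbers and Siegel's power series\<close>

lemma int_eval_pcompose: "int_eval (pcompose P Q) z = int_eval P (int_eval Q z)"
  by (induction P) (simp_all add: pcompose_pCons)

lemma int_eval_cnj: "int_eval P (cnj z) = cnj (int_eval P z)"
  by (induction P) simp_all

lemma int_eval_of_int: "int_eval P (of_int k) = of_int (poly P k)"
  by (induction P) simp_all

lemma pisot_iff:
  "pisot x \<longleftrightarrow> x > 1 \<and> (\<exists>R. lead_coeff R = 1 \<and> irreducible R \<and> int_eval R (complex_of_real x) = 0 \<and>
     (\<forall>z. int_eval R z = 0 \<and> z \<noteq> complex_of_real x \<longrightarrow> norm z < 1))"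
  by (simp add: pisot_def int_eval_def)

text \<open>If a conjugate \<open>z\<close> of \<open>q\<close> has modulus at least 1, then so have
  the conjugates \<open>z^2\<close> of \<open>q^2\<close> and \<open>z^3\<close> of
  \<open>q^3\<close>. Hence \<open>z^2 = q^2\<close> and \<open>z^3 = q^3\<close>, and division
  gives \<open>z = q\<close>.\<close>

lemma pisot_of_square_cube:
  assumes q: "1 < q" and "pisot (q ^ 2)" "pisot (q ^ 3)"
  shows "pisot q"
proof -
  obtain R2 where R2: "lead_coeff R2 = 1" "int_eval R2 (complex_of_real (q ^ 2)) = 0"
      "\<And>z. int_eval R2 z = 0 \<Longrightarrow> z \<noteq> complex_of_real (q ^ 2) \<Longrightarrow> norm z < 1"
    using assms(2) unfolding pisot_iff by blast
  obtain R3 where R3: "lead_coeff R3 = 1" "int_eval R3 (complex_of_real (q ^ 3)) = 0"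
      "\<And>z. int_eval R3 z = 0 \<Longrightarrow> z \<noteq> complex_of_real (q ^ 3) \<Longrightarrow> norm z < 1"
    using assms(3) unfolding pisot_iff by blast
  have "lead_coeff (pcompose R2 (monom 1 2)) = 1"
    using R2(1) by (subst lead_coeff_comp) (auto simp: degree_monom_eq)
  moreover have "int_eval (pcompose R2 (monom 1 2)) (complex_of_real q) = 0"
    using R2(2) by (simp add: int_eval_pcompose)
  ultimately obtain R where R: "lead_coeff R = 1" "irreducible R" "int_eval R (complex_of_real q) = 0"
      "R dvd pcompose R2 (monom 1 2)"
    using monic_irreducible_factor by metis
  have "norm z < 1" if z: "int_eval R z = 0" "z \<noteq> complex_of_real q" for z
  proof (rule ccontr)
    assume "\<not> norm z < 1"
    hence nz: "norm z \<ge> 1" by simp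
    have "int_eval (pcompose R2 (monom 1 2)) z = 0" using R(4) z(1) by (auto simp: dvd_def)
    hence "int_eval R2 (z ^ 2) = 0" by (simp add: int_eval_pcompose)
    moreover have "norm (z ^ 2) \<ge> 1" using nz by (simp add: norm_power one_le_power)
    ultimately have 2: "z ^ 2 = of_real (q ^ 2)" using R2(3)[of "z ^ 2"] by force
    have "int_eval (pcompose R3 (monom 1 3)) (complex_of_real q) = 0"
      using R3(2) by (simp add: int_eval_pcompose)
    hence "int_eval (pcompose R3 (monom 1 3)) z = 0"
      using common_root_transfer[OF R(2,3) _ z(1)] by blast
    hence "int_eval R3 (z ^ 3) = 0" by (simp add: int_eval_pcompose)
    moreover have "norm (z ^ 3) \<ge> 1" using nz by (simp add: norm_power one_le_power)
    ultimately have 3: "z ^ 3 = of_real (q ^ 3)" using R3(3)[of "z ^ 3"] by force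
    have "z ^ 2 * z = z ^ 2 * of_real q"
      using 3 unfolding 2 by (metis 2 of_real_mult power2_eq_square power3_eq_cube)
    thus False using z(2) nz by auto
  qed
  thus ?thesis unfolding pisot_iff using q R by blast
qed

text \<open>The \<open>a n\<close> are the Taylor coefficients of \<open>R / reflect_poly R\<close>.
  The factor \<open>1 - q z\<close> cancels the only pole in the closed unit disc, and on the circle
  the product has the modulus of \<open>1 - q z\<close>, so \<open>parseval_bound\<close>
  applies.\<close>

lemma coefficient_budget:
  fixes q :: real and R :: "int poly"
  assumes q: "1 < q" and R: "lead_coeff R = 1" "irreducible R" "int_eval R (complex_of_real q) = 0"
    and conj: "\<And>z. int_eval R z = 0 \<Longrightarrow> z \<noteq> complex_of_real q \<Longrightarrow> norm z < 1"
  obtains a :: "nat \<Rightarrow> int" where "a 0 = coeff R 0"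
    "\<And>N. (of_int (a 0))\<^sup>2 + (\<Sum>n<N. (of_int (a (Suc n)) - q * of_int (a n))\<^sup>2) \<le> 1 + q\<^sup>2"
    "(\<forall>n\<ge>1. a n = 0) \<Longrightarrow> R = smult (a 0) (reflect_poly R)"
proof -
  define Rc :: "complex poly" where "Rc = map_poly of_int R"
  have Rc: "poly Rc z = int_eval R z" for z by (simp add: Rc_def int_eval_def)
  have coeffRc: "coeff Rc n = of_int (coeff R n)" for n by (simp add: Rc_def coeff_map_poly)
  have degRc: "degree Rc = degree R" unfolding Rc_def by (rule degree_map_poly) auto
  have leadRc: "lead_coeff Rc = 1" using R(1) by (simp add: coeffRc degRc)
  have "[:- complex_of_real q, 1:] dvd Rc" using R(3) by (simp add: poly_eq_0_iff_dvd[symmetric] Rc)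
  then obtain S0 where S0: "Rc = [:- complex_of_real q, 1:] * S0" by (auto simp: dvd_def)
  have degR: "degree R > 0"
  proof (rule ccontr)
    assume "\<not> degree R > 0"
    then obtain c where "R = [:c:]" using degree_eq_zeroE by blast
    thus False using R(1,3) by simp
  qed
  \<comment> \<open>A double root would make the irreducible \<open>R\<close> divide its own
    derivative. By simplicity all zeros of \<open>S0\<close> lie in the open unit disc.\<close>
  have simple: "poly S0 (of_real q) \<noteq> 0"
  proof
    assume "poly S0 (of_real q) = 0"
    hence "poly (pderiv Rc) (of_real q) = 0" unfolding S0 pderiv_mult by (simp add: pderiv_pCons)
    moreover have "pderiv Rc = map_poly of_int (pderiv R)"
      by (intro poly_eqI) (simp add: coeff_pderiv coeff_map_poly coeffRc)
    ultimately have "int_eval (pderiv R) (complex_of_real q) = 0" by (simp add: int_eval_def)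
    hence "R dvd pderiv R" using irreducible_dvd_of_common_root[OF R(2,3)] by blast
    moreover have "pderiv R \<noteq> 0" using degR by (simp add: pderiv_eq_0_iff)
    ultimately have "degree R \<le> degree (pderiv R)" by (rule dvd_imp_degree_le)
    thus False using degR by (simp add: degree_pderiv)
  qed
  have S0_root: "norm z < 1" if "poly S0 z = 0" for z
  proof (rule conj)
    show "int_eval R z = 0" using that by (simp add: Rc[symmetric] S0)
    show "z \<noteq> of_real q" using that simple by auto
  qed
  have leadS0: "lead_coeff S0 = 1" using leadRc unfolding S0 lead_coeff_mult by simp
  define S where "S = reflect_poly S0"
  have S0z: "poly S 0 = 1" using leadS0 by (simp add: S_def)
  have S_nz: "poly S z \<noteq> 0" if "norm z \<le> 1" for z
  proof (cases "z = 0")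
    case True thus ?thesis using S0z by simp
  next
    case False
    have "norm (inverse z) \<ge> 1" using that False by (simp add: norm_inverse one_le_inverse)
    hence "poly S0 (inverse z) \<noteq> 0" using S0_root by force
    thus ?thesis using False by (simp add: S_def poly_reflect_poly_nz)
  qed
  have refl_lin: "reflect_poly [:- complex_of_real q, 1:] = [:1, - complex_of_real q:]"
    using q by (simp add: reflect_poly_def)
  have reflRc: "reflect_poly Rc = [:1, - complex_of_real q:] * S"
    unfolding S0 reflect_poly_mult refl_lin S_def ..
  have refl_coeff: "coeff (reflect_poly Rc) n = of_int (coeff (reflect_poly R) n)" for n
    by (simp add: coeff_reflect_poly coeffRc degRc)
  have S_ne: "S \<noteq> 0" using S0z by auto
  \<comment> \<open>A radius above 1 whose open disc contains no zero of \<open>S\<close>; the entry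
    2 keeps the set nonempty when \<open>S\<close> is constant.\<close>
  define r where "r = Min (insert 2 (norm ` {z. poly S z = 0}))"
  have fin: "finite (insert 2 (norm ` {z. poly S z = 0}))" using poly_roots_finite[OF S_ne] by simp
  have r1: "r > 1" unfolding r_def using fin S_nz by (subst Min_gr_iff) (auto simp: not_le[symmetric])
  have S_ball: "poly S z \<noteq> 0" if "norm z < r" for z
  proof
    assume "poly S z = 0"
    hence "r \<le> norm z" unfolding r_def using fin by (intro Min_le) auto
    thus False using that by simp
  qed
  define F G where "F = fps_of_poly Rc" and "G = fps_of_poly S"
  define b where "b = F / G"
  have G0: "G $ 0 \<noteq> 0" using S0z by (simp add: G_def poly_0_coeff_0)
  have bG: "b * G = F"
    unfolding b_def fps_divide_unit[OF G0] using inverse_mult_eq_1[OF G0] by (simp add: mult.assoc)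
  have ball: "eval_fps G z \<noteq> 0" if "z \<in> eball 0 (ereal r)" for z
    using that S_ball by (simp add: G_def in_eball_iff)
  have "Min {ereal r, fps_conv_radius F, fps_conv_radius G} \<le> fps_conv_radius b"
    unfolding b_def by (rule fps_conv_radius_divide') (use r1 ball in \<open>auto simp: F_def G_def\<close>)
  hence rad: "ereal r \<le> fps_conv_radius b" by (simp add: F_def G_def)
  have b_eval: "eval_fps b z = poly Rc z / poly S z" if "norm z = 1" for z
  proof -
    have "eval_fps b z = eval_fps F z / eval_fps G z"
      unfolding b_def by (rule eval_fps_divide'[of _ _ "ereal r"]) (use r1 ball that in \<open>auto simp: F_def G_def\<close>)
    thus ?thesis by (simp add: F_def G_def)
  qed
  have b_sum: "summable (\<lambda>n. norm (b $ n))"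
  proof -
    have "ereal (norm (1::complex)) < fps_conv_radius b"
      using less_le_trans[OF _ rad, of "ereal 1"] r1 by (simp add: one_ereal_def)
    hence "summable (\<lambda>n. norm (b $ n * 1 ^ n))"
      unfolding fps_conv_radius_def by (rule abs_summable_in_conv_radius)
    thus ?thesis by simp
  qed
  \<comment> \<open>The constant term of \<open>reflect_poly R\<close> is the leading coefficient 1
    of \<open>R\<close>, so the quotient has integer coefficients.\<close>
  define A :: "int fps" where "A = fps_of_poly R * fps_right_inverse (fps_of_poly (reflect_poly R)) 1"
  have "fps_of_poly (reflect_poly R) * fps_right_inverse (fps_of_poly (reflect_poly R)) 1 = 1"
    using R(1) by (intro fps_right_inverse) simp
  hence A: "A * fps_of_poly (reflect_poly R) = fps_of_poly R"
    unfolding A_def by (metis mult.assoc mult.commute mult_1_right)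
  define Ac where "Ac = Abs_fps (\<lambda>n. complex_of_int (A $ n))"
  have Ac: "Ac * fps_of_poly (reflect_poly Rc) = F"
  proof (rule fps_ext)
    fix n
    have "(Ac * fps_of_poly (reflect_poly Rc)) $ n = of_int ((A * fps_of_poly (reflect_poly R)) $ n)"
      by (simp add: fps_mult_nth Ac_def refl_coeff)
    thus "(Ac * fps_of_poly (reflect_poly Rc)) $ n = F $ n" by (simp add: A F_def coeffRc)
  qed
  have "fps_of_poly [:1, - complex_of_real q:] * G = fps_of_poly (reflect_poly Rc)"
    by (simp only: G_def reflRc fps_of_poly_mult)
  hence "(Ac * fps_of_poly [:1, - complex_of_real q:]) * G = b * G"
    by (simp only: mult.assoc Ac bG)
  moreover have "G \<noteq> 0" using G0 by auto
  ultimately have b_eq: "b = Ac * fps_of_poly [:1, - complex_of_real q:]" by simp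
  have b_eq': "b = Ac + fps_const (- of_real q) * (fps_X * Ac)"
    unfolding b_eq fps_of_poly_linear' by (simp only: distrib_left mult_1_right mult_ac)
  define a where "a = (\<lambda>n. A $ n)"
  define br where "br = (\<lambda>n. case n of 0 \<Rightarrow> of_int (a 0) | Suc m \<Rightarrow> of_int (a (Suc m)) - q * of_int (a m))"
  have b_nth: "b $ n = of_real (br n)" for n
    unfolding b_eq' br_def a_def by (cases n) (simp_all add: Ac_def)
  have budget: "(\<Sum>n<N. (br n)\<^sup>2) \<le> 1 + q\<^sup>2" for N
  proof (rule parseval_bound)
    show "summable (\<lambda>n. \<bar>br n\<bar>)" using b_sum by (simp add: b_nth)
    fix z :: complex assume z: "norm z = 1"
    \<comment> \<open>On the unit circle inversion is conjugation, and \<open>R\<close> has real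
      coefficients, so \<open>R\<close> and its reflection have equal modulus there.\<close>
    have "z * cnj z = 1" using complex_norm_square[of z] z by simp
    hence inv: "inverse z = cnj z" by (metis inverse_unique)
    have z0: "z \<noteq> 0" using z by auto
    have "norm (poly (reflect_poly Rc) z) = norm (poly Rc z)"
      using z0 z by (simp add: poly_reflect_poly_nz norm_mult norm_power inv Rc int_eval_cnj)
    hence "norm (poly Rc z) = norm (1 - of_real q * z) * norm (poly S z)"
      unfolding reflRc poly_mult norm_mult by (simp add: mult.commute)
    hence "norm (eval_fps b z) = norm (1 - of_real q * z)"
      using S_nz[of z] z by (simp add: b_eval norm_divide)
    thus "norm (\<Sum>n. of_real (br n) * z ^ n) = norm (1 - of_real q * z)"
      by (simp add: eval_fps_def b_nth)
  qed
  show ?thesis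
  proof (rule that[of a])
    have "coeff R 0 = (A * fps_of_poly (reflect_poly R)) $ 0" by (simp add: A)
    also have "\<dots> = a 0" using R(1) by (simp add: a_def)
    finally show "a 0 = coeff R 0" by simp
    show "(of_int (a 0))\<^sup>2 + (\<Sum>n<N. (of_int (a (Suc n)) - q * of_int (a n))\<^sup>2) \<le> 1 + q\<^sup>2" for N
      using budget[of "Suc N"] unfolding sum.lessThan_Suc_shift by (simp add: br_def)
    show "R = smult (a 0) (reflect_poly R)" if "\<forall>n\<ge>1. a n = 0"
    proof -
      have "A = fps_const (a 0)"
      proof (rule fps_ext)
        fix n show "A $ n = fps_const (a 0) $ n" using that by (cases n) (auto simp: a_def)
      qed
      hence "fps_of_poly R = fps_of_poly (smult (a 0) (reflect_poly R))"
        using A by (simp add: fps_of_poly_smult)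
      thus ?thesis by (simp only: fps_of_poly_eq_iff)
    qed
  qed
qed

text \<open>Below 1.152 the budget makes the series constant, so \<open>R\<close> is its own
  reflection up to sign and has no roots besides \<open>q\<close> and \<open>1 / q\<close>. Both are
  within \<open>q - 1 < 1\<close> of 1, so the nonzero integer \<open>R(1)\<close> has modulus below
  1.\<close>

lemma pisot_lower_bound:
  assumes "pisot q"
  shows "1.152 \<le> q"
proof (rule ccontr)
  assume "\<not> 1.152 \<le> q"
  hence q: "1 < q" "q < 1.152" using assms by (auto simp: pisot_iff)
  obtain R where R: "lead_coeff R = 1" "irreducible R" "int_eval R (complex_of_real q) = 0"
    and conj: "\<And>z. int_eval R z = 0 \<Longrightarrow> z \<noteq> complex_of_real q \<Longrightarrow> norm z < 1"
    using assms unfolding pisot_iff by blast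
  obtain a where a0: "a 0 = coeff R 0"
    and budget: "\<And>N. (of_int (a 0))\<^sup>2 + (\<Sum>n<N. (of_int (a (Suc n)) - q * of_int (a n))\<^sup>2) \<le> 1 + q\<^sup>2"
    and refl: "(\<forall>n\<ge>1. a n = 0) \<Longrightarrow> R = smult (a 0) (reflect_poly R)"
    using coefficient_budget[OF q(1) R conj] by blast
  have no_root: "int_eval R (of_int k) \<noteq> (0::complex)" if "real_of_int k \<noteq> q" for k
  proof
    assume "int_eval R (of_int k) = (0::complex)"
    hence "int_eval [:-k, 1:] (complex_of_real q) = 0"
      using common_root_transfer[OF R(2), of "of_int k" "[:-k, 1:]" "of_real q"] R(3) by simp
    hence "complex_of_real q = of_real (of_int k)" by simp
    thus False using that by (metis of_real_eq_iff)
  qed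
  have "a 0 \<noteq> 0"
  proof
    assume "a 0 = 0"
    hence "int_eval R (of_int 0) = (0::complex)" unfolding int_eval_of_int by (simp add: a0 poly_0_coeff_0)
    thus False using no_root[of 0] q by simp
  qed
  moreover have "(of_int (a 0))\<^sup>2 < (4::real)"
  proof -
    have "q\<^sup>2 < 1.328" using power_strict_mono[OF q(2), of 2] q by (simp add: power2_eq_square)
    thus ?thesis using budget[of 0] by simp
  qed
  have "\<bar>a 0\<bar> < 2"
  proof (rule ccontr)
    assume "\<not> \<bar>a 0\<bar> < 2"
    hence "2\<^sup>2 \<le> (real_of_int \<bar>a 0\<bar>)\<^sup>2" by (intro power_mono) auto
    thus False using \<open>(of_int (a 0))\<^sup>2 < (4::real)\<close> by simp
  qed
  ultimately have a1: "a 0 = 1 \<or> a 0 = -1" by linarith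
  \<comment> \<open>Multiplication by the sign \<open>a 0\<close> normalises the initial term to 1
    and leaves all costs unchanged.\<close>
  define a' where "a' = (\<lambda>n. a 0 * a n)"
  have "\<forall>n\<ge>1. a' n = 0"
  proof (rule small_base_integer_sequence[OF q])
    show "a' 0 = 1" using a1 by (auto simp: a'_def)
    show "(\<Sum>n<N. (of_int (a' (Suc n)) - q * of_int (a' n))\<^sup>2) \<le> q\<^sup>2" for N
    proof -
      have "(of_int (a' (Suc n)) - q * of_int (a' n))\<^sup>2 = (of_int (a (Suc n)) - q * of_int (a n))\<^sup>2" for n
        using a1 by (auto simp: a'_def power2_eq_square algebra_simps)
      thus ?thesis using budget[of N] a1 by auto
    qed
  qed
  hence "\<forall>n\<ge>1. a n = 0" using \<open>a 0 \<noteq> 0\<close> by (simp add: a'_def)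
  note refl = refl[OF this]
  define Rc :: "complex poly" where "Rc = map_poly of_int R"
  have Rc: "poly Rc z = int_eval R z" for z by (simp add: Rc_def int_eval_def)
  have leadRc: "lead_coeff Rc = 1"
    using R(1) by (simp add: Rc_def coeff_map_poly degree_map_poly)
  have coeffRc: "coeff Rc n = of_int (coeff R n)" for n by (simp add: Rc_def coeff_map_poly)
  have degRc: "degree Rc = degree R" unfolding Rc_def by (rule degree_map_poly) auto
  have inverse_root: "int_eval R (inverse z) = 0" if "int_eval R z = 0" "z \<noteq> 0" for z :: complex
  proof -
    have "map_poly of_int (reflect_poly R) = reflect_poly Rc"
      by (intro poly_eqI) (simp add: coeff_map_poly coeff_reflect_poly coeffRc degRc)
    hence "int_eval (reflect_poly R) z = z ^ degree Rc * int_eval R (inverse z)"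
      using that(2) by (simp add: int_eval_def poly_reflect_poly_nz Rc_def)
    moreover have "int_eval (smult (a 0) (reflect_poly R)) z = 0" using that(1) refl by simp
    ultimately show ?thesis using \<open>a 0 \<noteq> 0\<close> that(2) by simp
  qed
  \<comment> \<open>The reciprocal of a nonzero root inside the unit disc is a root outside it, and
    only \<open>q\<close> is available there.\<close>
  have roots: "z = of_real q \<or> z = of_real (1 / q)" if "poly Rc z = 0" for z
  proof (rule ccontr)
    assume *: "\<not> ?thesis"
    have Rz: "int_eval R z = 0" using that by (simp add: Rc)
    have z0: "z \<noteq> 0" using no_root[of 0] Rz q by auto
    have "norm z < 1" using conj[OF Rz] * by blast
    hence "norm (inverse z) > 1" using z0 by (simp add: norm_inverse one_less_inverse)
    hence "inverse z = of_real q" using conj[OF inverse_root[OF Rz z0]] by force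
    hence "z = of_real (1 / q)" by (metis inverse_eq_divide inverse_inverse_eq of_real_1 of_real_divide)
    thus False using * by blast
  qed
  have Rc_ne: "Rc \<noteq> 0" using leadRc by auto
  have fin: "finite {z. poly Rc z = 0}" using poly_roots_finite[OF Rc_ne] .
  have "poly Rc 1 = poly (smult (lead_coeff Rc) (\<Prod>z|poly Rc z = 0. [:-z, 1:] ^ order z Rc)) 1"
    by (simp only: complex_poly_decompose)
  also have "\<dots> = (\<Prod>z|poly Rc z = 0. (1 - z) ^ order z Rc)"
    by (simp add: leadRc poly_prod)
  finally have "norm (poly Rc 1) = (\<Prod>z|poly Rc z = 0. norm (1 - z) ^ order z Rc)"
    by (simp add: prod_norm[symmetric] norm_power)
  also have "\<dots> \<le> (\<Prod>z|poly Rc z = 0. q - 1)"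
  proof (rule prod_mono)
    fix z assume "z \<in> {z. poly Rc z = 0}"
    hence z: "poly Rc z = 0" by simp
    have "norm (1 - z) \<le> q - 1"
      using roots[OF z]
    proof
      assume "z = of_real q"
      hence e: "1 - z = of_real (1 - q)" by simp
      show ?thesis unfolding e norm_of_real using q by simp
    next
      assume "z = of_real (1 / q)"
      hence e: "1 - z = of_real (1 - 1 / q)" by simp
      have "1 - 1 / q \<le> q - 1" "1 - 1 / q \<ge> 0"
      proof -
        have "(q - 1)\<^sup>2 \<ge> 0" by simp
        thus "1 - 1 / q \<le> q - 1" using q by (simp add: field_simps power2_eq_square)
        show "1 - 1 / q \<ge> 0" using q by simp
      qed
      thus ?thesis unfolding e norm_of_real by simp
    qed
    moreover have "order z Rc > 0" using z Rc_ne by (simp add: order_root)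
    \<comment> \<open>Factors below 1 only shrink under higher multiplicity.\<close>
    ultimately have "norm (1 - z) ^ order z Rc \<le> norm (1 - z) ^ 1"
      using q by (intro power_decreasing) auto
    thus "0 \<le> norm (1 - z) ^ order z Rc \<and> norm (1 - z) ^ order z Rc \<le> q - 1"
      using \<open>norm (1 - z) \<le> q - 1\<close> by simp
  qed
  also have "\<dots> = (q - 1) ^ card {z. poly Rc z = 0}" by simp
  also have "\<dots> < 1"
  proof -
    have "of_real q \<in> {z. poly Rc z = 0}" using R(3) by (simp add: Rc)
    hence "card {z. poly Rc z = 0} > 0" using fin card_gt_0_iff by blast
    thus ?thesis using q by (intro power_less_one_iff[THEN iffD2]) auto
  qed
  finally have lt: "norm (poly Rc 1) < 1" .
  have "poly Rc 1 = of_int (poly R 1)" using int_eval_of_int[of R 1, where 'a = complex] by (simp add: Rc)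
  moreover have "poly Rc 1 \<noteq> 0" using no_root[of 1] q by (simp add: Rc)
  ultimately have "norm (poly Rc 1) \<ge> 1" by (simp add: norm_of_int)
  thus False using lt by simp
qed

section \<open>Numerical bounds for \<open>theta\<close> and the final assembly\<close>

lemma theta_bounds: "1 < theta" "theta < 1.325"
proof -
  let ?f = "\<lambda>x::real. x ^ 3 - x - 1"
  have "\<exists>x\<ge>1. x \<le> 1.325 \<and> ?f x = 0"
    by (rule IVT') (auto intro!: continuous_intros simp: power3_eq_cube)
  then obtain x where x: "1 \<le> x" "x \<le> 1.325" "?f x = 0" by blast
  \<comment> \<open>The description in \<open>theta\<close> requires a unique real root: every real
    root exceeds 1, where the cubic is increasing.\<close>
  have gt: "y > 1" if "?f y = 0" for y
  proof (rule ccontr)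
    assume "\<not> y > 1"
    hence y: "y \<le> 1" by simp
    show False
    proof (cases "y \<ge> -1")
      case True
      have "y * (y\<^sup>2 - 1) \<le> \<bar>y\<bar> * \<bar>y\<^sup>2 - 1\<bar>" by (metis abs_ge_self abs_mult)
      also have "y\<^sup>2 \<le> 1" using True y by (simp add: abs_square_le_1 abs_le_iff)
      hence "\<bar>y\<bar> * \<bar>y\<^sup>2 - 1\<bar> < 1"
      proof (cases "y = 0")
        case False
        hence "y\<^sup>2 > 0" by simp
        hence "\<bar>y\<^sup>2 - 1\<bar> < 1" using \<open>y\<^sup>2 \<le> 1\<close> by simp
        moreover have "\<bar>y\<bar> \<le> 1" using True y by simp
        ultimately have "\<bar>y\<bar> * \<bar>y\<^sup>2 - 1\<bar> \<le> 1 * \<bar>y\<^sup>2 - 1\<bar>" by (intro mult_right_mono) auto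
        thus ?thesis using \<open>\<bar>y\<^sup>2 - 1\<bar> < 1\<close> by simp
      qed simp
      finally show False using that by (simp add: power2_eq_square power3_eq_cube algebra_simps)
    next
      case False
      hence "y\<^sup>2 > 1" using one_less_power[of "- y" 2] by simp
      hence "y * (y\<^sup>2 - 1) < 0" using False by (simp add: mult_neg_pos)
      thus False using that by (simp add: power2_eq_square power3_eq_cube algebra_simps)
    qed
  qed
  have mono: "?f y < ?f z" if "1 < y" "y < z" for y z
  proof -
    have "z ^ 3 - y ^ 3 - (z - y) = (z - y) * (z\<^sup>2 + z * y + y\<^sup>2 - 1)"
      by (simp add: power2_eq_square power3_eq_cube algebra_simps)
    moreover have "z\<^sup>2 + z * y + y\<^sup>2 - 1 > 0"
    proof -
      have "y\<^sup>2 > 1" using that by (simp add: one_less_power)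
      moreover have "z * y > 0" "z\<^sup>2 \<ge> 0" using that by auto
      ultimately show ?thesis by linarith
    qed
    ultimately have "z ^ 3 - y ^ 3 - (z - y) > 0" using that by simp
    thus ?thesis by simp
  qed
  have uniq: "y = x" if "?f y = 0" for y
    using mono[of y x] mono[of x y] gt[OF that] gt[OF x(3)] that x(3) by (cases y x rule: linorder_cases) auto
  have "theta = x"
    unfolding theta_def
  proof (rule the_equality)
    show "x ^ 3 - x - 1 = 0" by (rule x(3))
    show "y = x" if "y ^ 3 - y - 1 = 0" for y using that by (rule uniq)
  qed
  moreover have "x \<noteq> 1.325"
  proof
    assume "x = 1.325"
    with x(3) have "(1.325::real) ^ 3 - 1.325 - 1 = 0" by simp
    thus False by (simp add: power3_eq_cube)
  qed
  ultimately show "1 < theta" "theta < 1.325" using gt[OF x(3)] x by auto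
qed

text \<open>The exponent \<open>m\<close> is free because the second claim of the theorem takes 2 or
  3, whichever power of \<open>1 / lam\<close> is not a Pisot number.\<close>

lemma interior_eq_X_uni_of_not_pisot:
  fixes n m :: nat and p :: "nat \<Rightarrow> real" and lam :: real and X :: "real set"
  assumes two_points: "\<exists>i\<le>n. \<exists>j\<le>n. p i \<noteq> p j"
    and X: "compact X" "X \<noteq> {}" "X = (\<Union>i\<le>n. ifs_map lam p i ` X)"
    and lam: "0 < lam" "lam < 1" and m: "2 \<le> m" "(1 / lam) ^ m < 2" and np: "\<not> pisot ((1 / lam) ^ m)"
  shows "interior X = X_uni n lam p X"
proof -
  have q1: "1 < 1 / lam" using lam by simp
  have "(1 / lam) ^ 1 \<le> (1 / lam) ^ m" using q1 m by (intro power_increasing) auto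
  hence "1 / lam < 2" using m by simp
  hence half: "1 / 2 < lam" using lam by (simp add: field_simps)
  have fin: "finite (p ` {..n})" "p ` {..n} \<noteq> {}" by auto
  obtain imin where imin: "Min (p ` {..n}) = p imin" "imin \<in> {..n}"
    using Min_in[OF fin] by (rule imageE)
  obtain imax where imax: "Max (p ` {..n}) = p imax" "imax \<in> {..n}"
    using Max_in[OF fin] by (rule imageE)
  have lo: "p imin \<le> p i" and hi: "p i \<le> p imax" if "i \<le> n" for i
    unfolding imin(1)[symmetric] imax(1)[symmetric] using that by simp_all
  interpret expanding_ifs n p lam imin imax
  proof
    obtain i j where "i \<le> n" "j \<le> n" "p i \<noteq> p j" using two_points by blast
    thus "p imin < p imax" using lo[of i] lo[of j] hi[of i] hi[of j] by linarith
  qed (use half lam imin imax lo hi in auto)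
  show ?thesis
  proof (rule interior_eq_X_uni_of_dense[OF _ X])
    fix \<xi> c d :: real
    assume "0 < \<xi>" "\<xi> < 1 / (1 / lam - 1)" "0 \<le> c" "c < d"
    thus "\<exists>k. \<exists>S\<subseteq>{..<k}. c < (1 / lam) ^ k * \<xi> - (\<Sum>i\<in>S. (1 / lam) ^ i) \<and>
      (1 / lam) ^ k * \<xi> - (\<Sum>i\<in>S. (1 / lam) ^ i) < d"
    proof (intro dense_orbit[OF q1 m])
      fix \<epsilon> :: real assume "0 < \<epsilon>"
      have "1 < (1 / lam) ^ m" using q1 m by (intro one_less_power) auto
      from small_sign_values[OF this m(2) np \<open>0 < \<epsilon>\<close>]
      show "\<exists>P\<in>sign_polys. 0 < int_eval P ((1 / lam) ^ m) \<and> int_eval P ((1 / lam) ^ m) < \<epsilon>" by blast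
    qed
  qed
qed

lemma inverse_square_less:
  fixes lam t :: real
  assumes "0 < t" "t powr (-1/2) < lam"
  shows "0 < lam" "(1 / lam) ^ 2 < t"
proof -
  have "0 < t powr (-1/2)" using assms by simp
  thus lam: "0 < lam" using assms by linarith
  have "(t powr (-1/2))\<^sup>2 < lam\<^sup>2" using assms by (intro power_strict_mono) auto
  moreover have "(t powr (-1/2))\<^sup>2 = 1 / t"
  proof -
    have "(t powr (-1/2))\<^sup>2 = t powr (-1/2) * t powr (-1/2)" by (rule power2_eq_square)
    also have "\<dots> = t powr (-1)" by (simp flip: powr_add)
    also have "\<dots> = 1 / t" using assms by (simp add: powr_minus_divide)
    finally show ?thesis .
  qed
  ultimately have "1 / t < lam\<^sup>2" by simp
  thus "(1 / lam) ^ 2 < t" using assms(1) lam by (simp add: field_simps)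
qed

theorem theorem6p1:
  fixes n :: nat and p :: "nat \<Rightarrow> real" and lam :: real and X :: "real set"
  assumes two_points: "\<exists>i\<le>n. \<exists>j\<le>n. p i \<noteq> p j"
    and X_compact: "compact X" and X_nonempty: "X \<noteq> {}"
    and X_attractor: "X = (\<Union>i\<le>n. ifs_map lam p i ` X)"
  shows "(2 powr (-1/2) < lam \<and> lam < 1 \<and> \<not> pisot (1 / lam ^ 2)
            \<longrightarrow> interior X = X_uni n lam p X)
       \<and> (theta powr (-1/2) < lam \<and> lam < 1 \<longrightarrow> interior X = X_uni n lam p X)"
proof (intro conjI impI)
  note main = interior_eq_X_uni_of_not_pisot[OF two_points X_compact X_nonempty X_attractor]
  assume "2 powr (-1/2) < lam \<and> lam < 1 \<and> \<not> pisot (1 / lam ^ 2)"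
  thus "interior X = X_uni n lam p X"
    using inverse_square_less[of 2 lam] by (intro main[of 2]) (auto simp: power_one_over)
next
  note main = interior_eq_X_uni_of_not_pisot[OF two_points X_compact X_nonempty X_attractor]
  assume *: "theta powr (-1/2) < lam \<and> lam < 1"
  define q where "q = 1 / lam"
  have lam: "0 < lam" "lam < 1" and q2: "q ^ 2 < 1.325"
    using inverse_square_less[of theta lam] theta_bounds * by (auto simp: q_def)
  have q1: "1 < q" using lam by (simp add: q_def)
  \<comment> \<open>\<open>1.152^2 = 1.327104\<close> exceeds 1.325, which brings \<open>q\<close>
    below the bound of \<open>pisot_lower_bound\<close>.\<close>
  have q_lt: "q < 1.152"
  proof (rule ccontr)
    assume "\<not> q < 1.152"
    hence "1.152 ^ 2 \<le> q ^ 2" by (intro power_mono) auto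
    thus False using q2 by (simp add: power2_eq_square)
  qed
  \<comment> \<open>The bound \<open>q^3 < 2\<close> makes \<open>m = 3\<close> admissible as
    well.\<close>
  have "q ^ 3 = q ^ 2 * q" by (simp add: power2_eq_square power3_eq_cube)
  also have "\<dots> \<le> 1.325 * 1.152" using q2 q_lt q1 by (intro mult_mono) auto
  finally have q3: "q ^ 3 < 2" by simp
  have "\<not> pisot (q ^ 2) \<or> \<not> pisot (q ^ 3)"
    using pisot_of_square_cube[OF q1] pisot_lower_bound[of q] q_lt by auto
  thus "interior X = X_uni n lam p X"
    using main[of 2] main[of 3] lam q2 q3 by (auto simp: q_def)
qed

end
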